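(* The quotient $P^u(\mathbb{Z})\backslash D$ is the universal Poincaré torsor over $\mathbb{H}_d$.
   Context: $\mathrm{M}_{m,n}(R)$ denotes $m\times n$ matrices over $R$; $d\ge1$; $\mathbb{H}_d$ is the set of symmetric $\tau\in\mathrm{M}_d(\mathbb{C})$ with $\mathrm{Im}(\tau)$ positive definite. $\mathbb{Z}(1)=2\pi i\mathbb{Z}$, of Hodge type $(-1,-1)$. $M=\mathbb{Z}(1)\oplus\mathbb{Z}^{2d}\oplus\mathbb{Z}$ with $\mathbb{Z}$-basis $2\pi i e_0,e_1,\dots,e_{2d+1}$ and weight filtration $W_{-3}M=0$, $W_{-2}M=\mathbb{Z}\cdot 2\pi i e_0$, $W_{-1}M=\mathbb{Z}(1)\oplus\mathbb{Z}^{2d}$, $W_0M=M$. $D$ is the set of filtrations $F$ on $M_{\mathbb{C}}$ such that $(M,W,F)$ is a mixed $\mathbb{Z}$-Hodge structure of type $\{(-1,-1),(-1,0),(0,-1),(0,0)\}$ and $\Psi\colon(x,y)\mapsto 2\pi i\,x^t\begin{pmatrix}0&-1_d\\1_d&0\end{pmatrix}y$ is a polarisation on $\mathrm{Gr}^W_{-1}M=\mathbb{Z}^{2d}$ (i.e. a morphism of Hodge structures to $\mathbb{Z}(1)$ such that $(v,w)\mapsto(-1)^p\Psi(v,\overline{w})$ is a complex inner product on each Hodge component $M^{p,q}$). Such $F$ is given by $F^0$, and $D$ is in bijection (this gives its complex structure) with $\mathbb{H}_d\times\mathrm{M}_{1,d}(\mathbb{C})\times\mathrm{M}_{d,1}(\mathbb{C})\times\mathbb{C}$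 via $(\tau,u,v,w)\mapsto F^0=\begin{pmatrix}u&w\\ \tau&v\\1_d&0\\0&1\end{pmatrix}\mathbb{C}^{d+1}\subset M_{\mathbb{C}}=\bigoplus_j\mathbb{C}e_j$. For a ring $R$, $P^u(R)$ is the Heisenberg group of matrices $\begin{pmatrix}1&x&z\\0&1_{2d}&y\\0&0&1\end{pmatrix}$ with $x\in\mathrm{M}_{1,2d}(R)$, $y\in\mathrm{M}_{2d,1}(R)$, $z\in R$, with respect to the basis $2\pi i e_0,e_1,\dots,e_{2d+1}$ (so the entries $x,z$ become $2\pi i x,2\pi i z$ in the basis $e_0,\dots,e_{2d+1}$ of $M_{\mathbb{C}}$); $P^u(\mathbb{Z})$ acts on $D$ by acting on $F^0$. For $\tau\in\mathbb{H}_d$, $A_\tau=\mathrm{M}_{d,1}(\mathbb{C})/(1_d\ \,-\tau)\mathrm{M}_{2d,1}(\mathbb{Z})$, the principally polarised abelian variety attached to $\tau$. The universal Poincaré torsor over $\mathbb{H}_d$ is the complex analytic family over $\mathbb{H}_d$ whose fibre at $\tau$ is the Poincaré $\mathbb{C}^\times$-torsor on $A_\tau\times A_\tau^\vee$; viewed over $A_\tau^\vee=\mathrm{Ext}^1(A_\tau,\mathbb{C}^\times)$ it is the universal extension of $A_\tau$ by $\mathbb{C}^\times$. In the identification, the coordinate $v$ gives the point of $A_\tau$, $u$ gives the point of the dual $A_\tau^\vee$ (realised as $\mathrm{M}_{1,d}(\mathbb{C})/\mathrm{M}_{1,2d}(\mathbb{Z}(1))\begin{pmatrix}\tau\\1_d\end{pmatrix}$),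 and $w$ modulo $\mathbb{Z}(1)$ is the coordinate on the $\mathbb{C}^\times$-fibres. *)

theory Defs
  imports "HOL-Analysis.Analysis" "HOL-Algebra.Coset"
begin

section \<open>Complex vector spaces and holomorphic functions\<close>

class complex_space = euclidean_space +
  fixes cscale :: "complex \<Rightarrow> 'a \<Rightarrow> 'a"
  assumes cscale_add_right: "cscale c (x + y) = cscale c x + cscale c y"
    and cscale_add_left: "cscale (c + c') x = cscale c x + cscale c' x"
    and cscale_cscale: "cscale c (cscale c' x) = cscale (c * c') x"
    and cscale_of_real: "cscale (complex_of_real r) x = r *\<^sub>R x"

instantiation complex :: complex_space
begin
definition "cscale c (z::complex) = c * z"
instance
  by standard (auto simp: cscale_complex_def algebra_simps scaleR_conv_of_real)
end

instantiation vec :: (complex_space, finite) complex_space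
begin
definition "cscale c (x :: 'a ^ 'b) = (\<chi> i. cscale c (x $ i))"
instance
  by standard
    (auto simp: cscale_vec_def vec_eq_iff cscale_add_right cscale_add_left cscale_cscale
       cscale_of_real)
end

instantiation prod :: (complex_space, complex_space) complex_space
begin
definition "cscale c (x :: 'a \<times> 'b) = (cscale c (fst x), cscale c (snd x))"
instance
  by standard
    (auto simp: cscale_prod_def cscale_add_right cscale_add_left cscale_cscale cscale_of_real
       prod_eq_iff)
end

definition complex_subspace :: "'a::complex_space set \<Rightarrow> bool" where
  "complex_subspace L \<longleftrightarrow> subspace L \<and> (\<forall>c. \<forall>x\<in>L. cscale c x \<in> L)"

text \<open>Complex differentiability at every point. The derivative is taken within \<open>S\<close>, so that this is
  the right notion for open sets, for relatively open subsets of a complex subspace (such as the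
  Siegel space inside the symmetric matrices), and for complex submanifolds.\<close>

definition holo_on :: "('a::complex_space \<Rightarrow> 'b::complex_space) \<Rightarrow> 'a set \<Rightarrow> bool" where
  "holo_on f S \<longleftrightarrow>
    (\<forall>x\<in>S. \<exists>f'. (f has_derivative f') (at x within S) \<and> (\<forall>c v. f' (cscale c v) = cscale c (f' v)))"


section \<open>Complex manifolds\<close>

text \<open>An atlas is recorded through local parametrisations \<open>\<phi> : V \<rightarrow> X\<close>, i.e. inverses of charts. In a
  manifold \<open>V\<close> is open in some complex subspace of the model space.\<close>

datatype ('a, 'm) cmfd = Cmfd (points: "'a set") (params: "('m set \<times> ('m \<Rightarrow> 'a)) set")

definition mfd_open :: "('a, 'm::complex_space) cmfd \<Rightarrow> 'a set \<Rightarrow> bool" where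
  "mfd_open X U \<longleftrightarrow> U \<subseteq> points X \<and>
    (\<forall>(V, \<phi>)\<in>params X. openin (top_of_set V) {s\<in>V. \<phi> s \<in> U})"

definition complex_manifold :: "('a, 'm::complex_space) cmfd \<Rightarrow> bool" where
  "complex_manifold X \<longleftrightarrow>
    (\<forall>(V, \<phi>)\<in>params X. inj_on \<phi> V \<and> \<phi> ` V \<subseteq> points X \<and>
       (\<exists>L. complex_subspace L \<and> openin (top_of_set L) V)) \<and>
    (\<forall>(V, \<phi>)\<in>params X. \<forall>(W, \<psi>)\<in>params X.
       openin (top_of_set V) {s\<in>V. \<phi> s \<in> \<psi> ` W} \<and>
       holo_on (inv_into W \<psi> \<circ> \<phi>) {s\<in>V. \<phi> s \<in> \<psi> ` W}) \<and>
    (\<exists>C. countable C \<and> C \<subseteq> params X \<and> points X = (\<Union>(V, \<phi>)\<in>C. \<phi> ` V)) \<and>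
    (\<forall>x\<in>points X. \<forall>y\<in>points X. x \<noteq> y \<longrightarrow>
       (\<exists>U U'. mfd_open X U \<and> mfd_open X U' \<and> x \<in> U \<and> y \<in> U' \<and> U \<inter> U' = {}))"

text \<open>Holomorphic maps on a subset \<open>Z\<close> of \<open>X\<close>, which is meant to be open or a complex submanifold
  (e.g. a fibre product).\<close>

definition hol_map ::
    "('a, 'm::complex_space) cmfd \<Rightarrow> 'a set \<Rightarrow> ('b, 'n::complex_space) cmfd \<Rightarrow> ('a \<Rightarrow> 'b) \<Rightarrow> bool" where
  "hol_map X Z Y f \<longleftrightarrow> Z \<subseteq> points X \<and> f ` Z \<subseteq> points Y \<and>
    (\<forall>(V, \<phi>)\<in>params X. \<forall>s\<in>V. \<phi> s \<in> Z \<longrightarrow>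
       (\<exists>(W, \<psi>)\<in>params Y. \<exists>N. openin (top_of_set {r\<in>V. \<phi> r \<in> Z}) N \<and> s \<in> N \<and>
          f ` \<phi> ` N \<subseteq> \<psi> ` W \<and> holo_on (inv_into W \<psi> \<circ> f \<circ> \<phi>) N))"

definition biholomorphic ::
    "('a, 'm::complex_space) cmfd \<Rightarrow> 'a set \<Rightarrow> ('b, 'n::complex_space) cmfd \<Rightarrow> 'b set \<Rightarrow> ('a \<Rightarrow> 'b) \<Rightarrow> bool"
  where
  "biholomorphic X Z Y Z' f \<longleftrightarrow>
    bij_betw f Z Z' \<and> hol_map X Z Y f \<and> hol_map Y Z' X (inv_into Z f)"

definition domain_mfd :: "'m::complex_space set \<Rightarrow> ('m, 'm) cmfd" where
  "domain_mfd S = Cmfd S {(S, \<lambda>s. s)}"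

definition prod_mfd ::
    "('a, 'm::complex_space) cmfd \<Rightarrow> ('b, 'n::complex_space) cmfd \<Rightarrow> ('a \<times> 'b, 'm \<times> 'n) cmfd" where
  "prod_mfd X Y = Cmfd (points X \<times> points Y)
     {(V \<times> W, map_prod \<phi> \<psi>) | V \<phi> W \<psi>. (V, \<phi>) \<in> params X \<and> (W, \<psi>) \<in> params Y}"

text \<open>The quotient of \<open>X\<close> along \<open>q\<close>: local parametrisations are those of \<open>X\<close>, restricted to open sets on
  which \<open>q\<close> is injective. These cover the quotient (as \<^const>\<open>complex_manifold\<close> demands) only if \<open>q\<close> is
  a local bijection.\<close>

definition quotient_mfd :: "('a, 'm::complex_space) cmfd \<Rightarrow> ('a \<Rightarrow> 'b) \<Rightarrow> ('b, 'm) cmfd" where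
  "quotient_mfd X q = Cmfd (q ` points X)
     {(V', q \<circ> \<phi>) | V V' \<phi>. (V, \<phi>) \<in> params X \<and> openin (top_of_set V) V' \<and> inj_on (q \<circ> \<phi>) V'}"


section \<open>The mixed Hodge structures\<close>

text \<open>Indices of the basis \<open>e\<^sub>0, e\<^sub>1, \<dots>, e\<^sub>2\<^sub>d, e\<^sub>2\<^sub>d\<^sub>+\<^sub>1\<close>; the type \<open>'d\<close> has \<open>d \<ge> 1\<close> elements.\<close>

type_synonym 'd mix = "unit + ('d + 'd) + unit"

abbreviation E0 :: "'d mix" where "E0 \<equiv> Inl ()"
abbreviation EM :: "'d + 'd \<Rightarrow> 'd mix" where "EM k \<equiv> Inr (Inl k)"
abbreviation E1 :: "'d mix" where "E1 \<equiv> Inr (Inr ())"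

definition Z1 :: "complex set" where
  "Z1 = {2 * of_real pi * \<i> * of_int n | n. True}"

definition latM :: "(complex ^ ('d::finite) mix) set" where
  "latM = {m. m $ E0 \<in> Z1 \<and> (\<forall>k. m $ EM k \<in> \<int>) \<and> m $ E1 \<in> \<int>}"

definition weight_lat :: "int \<Rightarrow> (complex ^ ('d::finite) mix) set" where
  "weight_lat k = {m \<in> latM.
     (k < 0 \<longrightarrow> m $ E1 = 0) \<and> (k < -1 \<longrightarrow> (\<forall>j. m $ EM j = 0)) \<and> (k < -2 \<longrightarrow> m $ E0 = 0)}"

definition weight_fil :: "int \<Rightarrow> (complex ^ ('d::finite) mix) set" where
  "weight_fil k = vec.span (weight_lat k)"

text \<open>The complex conjugation of \<open>M\<^sub>\<complex> = M \<otimes> \<complex>\<close> fixes \<open>M\<close>; since \<open>2\<pi>i e\<^sub>0 \<in> M\<close>, it sends \<open>e\<^sub>0\<close> to \<open>-e\<^sub>0\<close>.\<close>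

definition conjM :: "complex ^ ('d::finite) mix \<Rightarrow> complex ^ 'd mix" where
  "conjM m = (\<chi> i. if i = E0 then - cnj (m $ i) else cnj (m $ i))"

text \<open>Subspaces of \<open>Gr\<^sup>W\<^sub>k\<close> are represented by their preimages in \<open>W\<^sub>k\<close>, so that the zero subspace becomes
  \<open>W\<^sub>k\<^sub>-\<^sub>1\<close>. Thus \<open>gr_fil F p k\<close> is \<open>F\<^sup>p Gr\<^sup>W\<^sub>k\<close> and \<open>hodge_piece F p q\<close> is \<open>M\<^sup>p\<^sup>,\<^sup>q \<subseteq> Gr\<^sup>W\<^sub>p\<^sub>+\<^sub>q\<close>.\<close>

definition gr_fil ::
    "(int \<Rightarrow> (complex ^ ('d::finite) mix) set) \<Rightarrow> int \<Rightarrow> int \<Rightarrow> (complex ^ 'd mix) set" where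
  "gr_fil F p k = {a + b | a b. a \<in> F p \<inter> weight_fil k \<and> b \<in> weight_fil (k - 1)}"

definition hodge_piece ::
    "(int \<Rightarrow> (complex ^ ('d::finite) mix) set) \<Rightarrow> int \<Rightarrow> int \<Rightarrow> (complex ^ 'd mix) set" where
  "hodge_piece F p q = gr_fil F p (p + q) \<inter> conjM ` gr_fil F q (p + q)"

text \<open>The last condition says that \<open>F\<close> induces a Hodge structure of weight \<open>k\<close> on \<open>Gr\<^sup>W\<^sub>k\<close>: the filtration
  is opposed to its conjugate, \<open>Gr = F\<^sup>p \<oplus> conj F\<^sup>k\<^sup>+\<^sup>1\<^sup>-\<^sup>p\<close>.\<close>

definition mixed_hodge_structure :: "(int \<Rightarrow> (complex ^ ('d::finite) mix) set) \<Rightarrow> bool" where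
  "mixed_hodge_structure F \<longleftrightarrow>
    (\<forall>p. vec.subspace (F p)) \<and> antimono F \<and> (\<exists>a. F a = UNIV) \<and> (\<exists>b. F b = {0}) \<and>
    (\<forall>k p. {a + b | a b. a \<in> gr_fil F p k \<and> b \<in> conjM ` gr_fil F (k + 1 - p) k} = weight_fil k \<and>
           gr_fil F p k \<inter> conjM ` gr_fil F (k + 1 - p) k = weight_fil (k - 1))"

definition hodge_types :: "(int \<Rightarrow> (complex ^ ('d::finite) mix) set) \<Rightarrow> (int \<times> int) set" where
  "hodge_types F = {(p, q). hodge_piece F p q \<noteq> weight_fil (p + q - 1)}"

definition dotc :: "complex ^ ('n::finite) \<Rightarrow> complex ^ 'n \<Rightarrow> complex" where
  "dotc x y = (\<Sum>i\<in>UNIV. x $ i * y $ i)"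

definition Jmat :: "complex ^ ('d + 'd) ^ (('d::finite) + 'd)" where
  "Jmat = (\<chi> i j. case (i, j) of
      (Inl a, Inr b) \<Rightarrow> if a = b then -1 else 0
    | (Inr a, Inl b) \<Rightarrow> if a = b then 1 else 0
    | _ \<Rightarrow> 0)"

definition Psi :: "complex ^ (('d::finite) + 'd) \<Rightarrow> complex ^ ('d + 'd) \<Rightarrow> complex" where
  "Psi x y = 2 * of_real pi * \<i> * dotc x (Jmat *v y)"

definition int_vecs :: "(complex ^ ('n::finite)) set" where
  "int_vecs = {y. \<forall>i. y $ i \<in> \<int>}"

definition cnj_vec :: "complex ^ ('n::finite) \<Rightarrow> complex ^ 'n" where
  "cnj_vec x = (\<chi> i. cnj (x $ i))"

text \<open>\<open>M\<^sup>p\<^sup>,\<^sup>q\<close> for \<open>p + q = -1\<close>, as a subspace of \<open>\<complex>\<^sup>2\<^sup>d = Gr\<^sup>W\<^sub>-\<^sub>1 \<otimes> \<complex>\<close>.\<close>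

definition mid_piece ::
    "(int \<Rightarrow> (complex ^ ('d::finite) mix) set) \<Rightarrow> int \<Rightarrow> int \<Rightarrow> (complex ^ ('d + 'd)) set" where
  "mid_piece F p q = (\<lambda>m. \<chi> k. m $ EM k) ` hodge_piece F p q"

definition complex_inner_product_on ::
    "(complex ^ ('n::finite)) set \<Rightarrow> (complex ^ 'n \<Rightarrow> complex ^ 'n \<Rightarrow> complex) \<Rightarrow> bool" where
  "complex_inner_product_on V h \<longleftrightarrow>
    (\<forall>x\<in>V. \<forall>y\<in>V. \<forall>z\<in>V. \<forall>c. h (x + y) z = h x z + h y z \<and> h (c *s x) z = c * h x z) \<and>
    (\<forall>x\<in>V. \<forall>y\<in>V. h y x = cnj (h x y)) \<and>
    (\<forall>x\<in>V. x \<noteq> 0 \<longrightarrow> h x x \<in> \<real> \<and> 0 < Re (h x x))"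

text \<open>The first two conditions say that \<open>\<Psi>\<close> is a morphism of Hodge structures to \<open>\<int>(1)\<close>, whose only
  Hodge type is \<open>(-1, -1)\<close>.\<close>

definition Psi_polarises :: "(int \<Rightarrow> (complex ^ ('d::finite) mix) set) \<Rightarrow> bool" where
  "Psi_polarises F \<longleftrightarrow>
    (\<forall>x \<in> (int_vecs :: (complex ^ ('d + 'd)) set). \<forall>y\<in>int_vecs. Psi x y \<in> Z1) \<and>
    (\<forall>p q p' q'. p + q = -1 \<longrightarrow> p' + q' = -1 \<longrightarrow> (p + p', q + q') \<noteq> (-1, -1) \<longrightarrow>
       (\<forall>x\<in>mid_piece F p q. \<forall>y\<in>mid_piece F p' q'. Psi x y = 0)) \<and>
    (\<forall>p q. p + q = -1 \<longrightarrow>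
       complex_inner_product_on (mid_piece F p q) (\<lambda>x y. (-1) powi p * Psi x (cnj_vec y)))"

definition period_domain :: "(int \<Rightarrow> (complex ^ ('d::finite) mix) set) set" where
  "period_domain = {F. mixed_hodge_structure F \<and>
     hodge_types F \<subseteq> {(-1, -1), (-1, 0), (0, -1), (0, 0)} \<and> Psi_polarises F}"

definition siegel :: "(complex ^ 'd ^ ('d::finite)) set" where
  "siegel = {\<tau>. transpose \<tau> = \<tau> \<and>
     (\<forall>x :: real ^ 'd. x \<noteq> 0 \<longrightarrow> 0 < x \<bullet> ((\<chi> i j. Im (\<tau> $ i $ j)) *v x))}"

text \<open>Both row vectors \<open>u\<close> and column vectors \<open>v\<close> are elements of \<open>\<complex>\<^sup>d\<close>.\<close>

type_synonym 'd coords = "(complex ^ 'd ^ 'd) \<times> (complex ^ 'd) \<times> (complex ^ 'd) \<times> complex"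

definition coord_domain :: "('d::finite) coords set" where
  "coord_domain = siegel \<times> UNIV \<times> UNIV \<times> UNIV"

definition F0_mat :: "('d::finite) coords \<Rightarrow> complex ^ ('d + unit) ^ 'd mix" where
  "F0_mat = (\<lambda>(\<tau>, u, v, w). \<chi> i j. case (i, j) of
      (Inl _, Inl b) \<Rightarrow> u $ b                             | (Inl _, Inr _) \<Rightarrow> w
    | (Inr (Inl (Inl a)), Inl b) \<Rightarrow> \<tau> $ a $ b              | (Inr (Inl (Inl a)), Inr _) \<Rightarrow> v $ a
    | (Inr (Inl (Inr a)), Inl b) \<Rightarrow> if a = b then 1 else 0 | (Inr (Inl (Inr a)), Inr _) \<Rightarrow> 0
    | (Inr (Inr _), Inl b) \<Rightarrow> 0                           | (Inr (Inr _), Inr _) \<Rightarrow> 1)"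

definition hodge_fil :: "('d::finite) coords \<Rightarrow> int \<Rightarrow> (complex ^ 'd mix) set" where
  "hodge_fil c p = (if p < 0 then UNIV else if p = 0 then range ((*v) (F0_mat c)) else {0})"

definition D_mfd :: "(int \<Rightarrow> (complex ^ ('d::finite) mix) set, 'd coords) cmfd" where
  "D_mfd = Cmfd period_domain {(coord_domain, hodge_fil)}"


section \<open>The Heisenberg group and the quotient\<close>

definition heis ::
    "'r::comm_ring_1 ^ ('d + 'd) \<Rightarrow> 'r ^ ('d + 'd) \<Rightarrow> 'r \<Rightarrow> 'r ^ ('d mix) ^ (('d::finite) mix)" where
  "heis x y z = (\<chi> i j. case (i, j) of
      (Inl _, Inl _) \<Rightarrow> 1       | (Inl _, Inr (Inl b)) \<Rightarrow> x $ b                      | (Inl _, Inr (Inr _)) \<Rightarrow> z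
    | (Inr (Inl a), Inl _) \<Rightarrow> 0 | (Inr (Inl a), Inr (Inl b)) \<Rightarrow> if a = b then 1 else 0 | (Inr (Inl a), Inr (Inr _)) \<Rightarrow> y $ a
    | (Inr (Inr _), Inl _) \<Rightarrow> 0 | (Inr (Inr _), Inr (Inl b)) \<Rightarrow> 0                     | (Inr (Inr _), Inr (Inr _)) \<Rightarrow> 1)"

definition Pu :: "('r::comm_ring_1 ^ ('d mix) ^ (('d::finite) mix)) set" where
  "Pu = {heis x y z | x y z. True}"

text \<open>Change of basis from \<open>2\<pi>i e\<^sub>0, e\<^sub>1, \<dots>\<close> to \<open>e\<^sub>0, e\<^sub>1, \<dots>\<close>.\<close>

definition Pu_mat :: "int ^ ('d mix) ^ (('d::finite) mix) \<Rightarrow> complex ^ ('d mix) ^ ('d mix)" where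
  "Pu_mat g = (\<chi> i j. (if i = E0 then 2 * of_real pi * \<i> else 1) * of_int (g $ i $ j) /
                     (if j = E0 then 2 * of_real pi * \<i> else 1))"

definition Pu_orbit ::
    "(int \<Rightarrow> (complex ^ ('d::finite) mix) set) \<Rightarrow> (int \<Rightarrow> (complex ^ 'd mix) set) set" where
  "Pu_orbit F = {\<lambda>p. (*v) (Pu_mat g) ` F p | g. g \<in> Pu}"

definition Pu_quotient ::
    "((int \<Rightarrow> (complex ^ ('d::finite) mix) set) set, 'd coords) cmfd" where
  "Pu_quotient = quotient_mfd D_mfd Pu_orbit"


section \<open>The families of abelian varieties\<close>

definition one_minus_tau :: "complex ^ 'd ^ ('d::finite) \<Rightarrow> complex ^ ('d + 'd) ^ 'd" where
  "one_minus_tau \<tau> = (\<chi> i j. case j of Inl b \<Rightarrow> if i = b then 1 else 0 | Inr b \<Rightarrow> - \<tau> $ i $ b)"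

definition tau_one :: "complex ^ 'd ^ ('d::finite) \<Rightarrow> complex ^ 'd ^ ('d + 'd)" where
  "tau_one \<tau> = (\<chi> i j. case i of Inl a \<Rightarrow> \<tau> $ a $ j | Inr a \<Rightarrow> if a = j then 1 else 0)"

definition av_cls :: "complex ^ 'd ^ ('d::finite) \<Rightarrow> complex ^ 'd \<Rightarrow> (complex ^ 'd) set" where
  "av_cls \<tau> v = {v + one_minus_tau \<tau> *v y | y. y \<in> int_vecs}"

definition dual_cls :: "complex ^ 'd ^ ('d::finite) \<Rightarrow> complex ^ 'd \<Rightarrow> (complex ^ 'd) set" where
  "dual_cls \<tau> u = {u + x v* tau_one \<tau> | x. \<forall>i. x $ i \<in> Z1}"

definition av_group :: "complex ^ 'd ^ ('d::finite) \<Rightarrow> (complex ^ 'd) set monoid" where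
  "av_group \<tau> = \<lparr>carrier = range (av_cls \<tau>), monoid.mult = (\<lambda>A B. {a + b | a b. a \<in> A \<and> b \<in> B}),
                one = av_cls \<tau> 0\<rparr>"

definition dual_mfd :: "complex ^ 'd ^ ('d::finite) \<Rightarrow> ((complex ^ 'd) set, complex ^ 'd) cmfd" where
  "dual_mfd \<tau> = quotient_mfd (domain_mfd UNIV) (dual_cls \<tau>)"

definition dual_family ::
    "((complex ^ 'd ^ ('d::finite)) \<times> (complex ^ 'd) set, (complex ^ 'd ^ 'd) \<times> (complex ^ 'd)) cmfd"
  where
  "dual_family = quotient_mfd (domain_mfd (siegel \<times> UNIV)) (\<lambda>(\<tau>, u). (\<tau>, dual_cls \<tau> u))"

text \<open>The fibre product over the Siegel space of the families \<open>A\<close> and \<open>A\<^sup>\<or>\<close>.\<close>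

type_synonym 'd AAdual = "(complex ^ 'd ^ 'd) \<times> (complex ^ 'd) set \<times> (complex ^ 'd) set"

definition AAdual_family ::
    "(('d::finite) AAdual, (complex ^ 'd ^ 'd) \<times> (complex ^ 'd) \<times> (complex ^ 'd)) cmfd" where
  "AAdual_family = quotient_mfd (domain_mfd (siegel \<times> UNIV \<times> UNIV))
     (\<lambda>(\<tau>, v, u). (\<tau>, av_cls \<tau> v, dual_cls \<tau> u))"


section \<open>The universal Poincare torsor\<close>

definition Cx_mfd :: "(complex, complex) cmfd" where
  "Cx_mfd = domain_mfd (- {0})"

definition Cx_group :: "complex monoid" where
  "Cx_group = \<lparr>carrier = - {0}, monoid.mult = (*), one = 1\<rparr>"

definition Cx_torsor ::
    "('e, 'm::complex_space) cmfd \<Rightarrow> ('b, 'n::complex_space) cmfd \<Rightarrow> ('e \<Rightarrow> 'b) \<Rightarrow>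
     (complex \<Rightarrow> 'e \<Rightarrow> 'e) \<Rightarrow> bool" where
  "Cx_torsor E B p act \<longleftrightarrow>
    complex_manifold E \<and> complex_manifold B \<and>
    hol_map E (points E) B p \<and> p ` points E = points B \<and>
    hol_map (prod_mfd Cx_mfd E) ((- {0}) \<times> points E) E (\<lambda>(t, e). act t e) \<and>
    (\<forall>e\<in>points E. act 1 e = e) \<and>
    (\<forall>e\<in>points E. \<forall>s t. s \<noteq> 0 \<longrightarrow> t \<noteq> 0 \<longrightarrow> act (s * t) e = act s (act t e)) \<and>
    (\<forall>e\<in>points E. \<forall>t. t \<noteq> 0 \<longrightarrow> p (act t e) = p e) \<and>
    (\<forall>e\<in>points E. \<forall>e'\<in>points E. p e = p e' \<longrightarrow> (\<exists>!t. t \<noteq> 0 \<and> e' = act t e)) \<and>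
    (\<forall>b\<in>points B. \<exists>U \<Phi>. mfd_open B U \<and> b \<in> U \<and>
       biholomorphic E {e\<in>points E. p e \<in> U} (prod_mfd B Cx_mfd) (U \<times> (- {0})) \<Phi> \<and>
       (\<forall>e\<in>points E. p e \<in> U \<longrightarrow> fst (\<Phi> e) = p e \<and>
          (\<forall>t. t \<noteq> 0 \<longrightarrow> snd (\<Phi> (act t e)) = t * snd (\<Phi> e))))"

text \<open>Identification of \<open>A\<^sub>\<tau>\<^sup>\<or>\<close> with \<open>Ext\<^sup>1(A\<^sub>\<tau>, \<complex>\<^sup>\<times>)\<close>: put \<open>V = \<complex>\<^sup>d\<close> and identify \<open>\<Lambda> = (1 -\<tau>)\<int>\<^sup>2\<^sup>d\<close> with
  \<open>\<int>\<^sup>2\<^sup>d\<close>. From \<open>0 \<rightarrow> \<Lambda> \<rightarrow> V \<rightarrow> A\<^sub>\<tau> \<rightarrow> 0\<close> one gets a surjection \<open>Hom(\<Lambda>, \<complex>\<^sup>\<times>) \<rightarrow> Ext\<^sup>1(A\<^sub>\<tau>, \<complex>\<^sup>\<times>)\<close>, sending a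
  character to the pushout of this sequence along it, with kernel the restrictions of \<open>exp \<circ> f\<close>, for \<open>f\<close>
  complex linear on \<open>V\<close>. Writing characters as \<open>\<chi>\<^sub>a : y \<mapsto> exp(ay)\<close> with \<open>a\<close> a row vector in \<open>\<complex>\<^sup>2\<^sup>d\<close>, which
  is unique modulo \<open>2\<pi>i\<int>\<^sup>2\<^sup>d\<close>, the kernel is given by \<open>a \<in> \<complex>\<^sup>d (1 -\<tau>)\<close>. As \<open>(1 -\<tau>)(\<tau>; 1) = 0\<close>, the map
  \<open>a \<mapsto> a(\<tau>; 1)\<close> identifies \<open>Ext\<^sup>1(A\<^sub>\<tau>, \<complex>\<^sup>\<times>)\<close> with the quotient \<open>\<complex>\<^sup>d / \<int>(1)\<^sup>2\<^sup>d (\<tau>; 1)\<close>, which is \<open>A\<^sub>\<tau>\<^sup>\<or>\<close>. So a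
  point of \<open>A\<^sub>\<tau>\<^sup>\<or>\<close> is the class of \<open>a(\<tau>; 1)\<close> for some \<open>a\<close>, and it corresponds to the pushout along \<open>\<chi>\<^sub>a\<close>.\<close>

text \<open>The Poincare torsor on \<open>A\<^sub>\<tau> \<times> A\<^sub>\<tau>\<^sup>\<or>\<close> is trivialised along \<open>{0} \<times> A\<^sub>\<tau>\<^sup>\<or>\<close>, and its restriction to
  \<open>A\<^sub>\<tau> \<times> {b}\<close> is the torsor attached to \<open>b \<in> A\<^sub>\<tau>\<^sup>\<or> = Pic\<^sup>0(A\<^sub>\<tau>)\<close>, where \<open>Ext\<^sup>1(A\<^sub>\<tau>, \<complex>\<^sup>\<times>) = Pic\<^sup>0(A\<^sub>\<tau>)\<close> forgets
  the group law. The torsor of the class of \<open>\<chi>\<^sub>a\<close> is \<open>V \<times> \<complex>\<^sup>\<times>\<close> modulo \<open>(v + \<lambda>, t) \<sim> (v, \<chi>\<^sub>a(\<lambda>) t)\<close>; a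
  torsor is isomorphic to it iff its pullback to \<open>V\<close> has a section \<open>\<sigma>\<close> (the image of \<open>(v, 1)\<close>) with
  \<open>\<sigma>(v + \<lambda>) = \<chi>\<^sub>a(\<lambda>) \<sigma>(v)\<close>.\<close>

definition poincare_torsor ::
    "complex ^ 'd ^ ('d::finite) \<Rightarrow> ('e, 'm::complex_space) cmfd \<Rightarrow> ('e \<Rightarrow> 'd AAdual) \<Rightarrow>
     (complex \<Rightarrow> 'e \<Rightarrow> 'e) \<Rightarrow> bool" where
  "poincare_torsor \<tau> E p act \<longleftrightarrow>
    (\<exists>\<epsilon>. hol_map (dual_mfd \<tau>) (points (dual_mfd \<tau>)) E \<epsilon> \<and>
       (\<forall>b\<in>points (dual_mfd \<tau>). p (\<epsilon> b) = (\<tau>, av_cls \<tau> 0, b))) \<and>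
    (\<forall>a :: complex ^ ('d + 'd). \<exists>\<sigma>. hol_map (domain_mfd UNIV) UNIV E \<sigma> \<and>
       (\<forall>v. p (\<sigma> v) = (\<tau>, av_cls \<tau> v, dual_cls \<tau> (a v* tau_one \<tau>))) \<and>
       (\<forall>v. \<forall>y\<in>int_vecs. \<sigma> (v + one_minus_tau \<tau> *v y) = act (exp (dotc a y)) (\<sigma> v)))"

definition group_extension ::
    "('a, 'x) monoid_scheme \<Rightarrow> ('a \<Rightarrow> 'b) \<Rightarrow> ('b, 'y) monoid_scheme \<Rightarrow> ('b \<Rightarrow> 'c) \<Rightarrow>
     ('c, 'z) monoid_scheme \<Rightarrow> bool" where
  "group_extension A \<iota> G \<pi> C \<longleftrightarrow>
    comm_group G \<and> \<iota> \<in> hom A G \<and> inj_on \<iota> (carrier A) \<and> \<pi> \<in> hom G C \<and>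
    \<pi> ` carrier G = carrier C \<and> kernel G C \<pi> = \<iota> ` carrier A"

text \<open>Here \<open>E\<close> is viewed over the family \<open>A\<^sup>\<or>\<close> through \<open>r e = (\<tau>, b)\<close>. The relative group law \<open>add\<close>, the
  zero section and the inverse are holomorphic, the fibres are extensions of \<open>A\<^sub>\<tau>\<close> by \<open>\<complex>\<^sup>\<times>\<close>, and the
  last condition says that the extension over \<open>b\<close> has class \<open>b\<close>: \<open>\<psi>\<close> is a morphism from the sequence
  \<open>\<Lambda> \<rightarrow> V \<rightarrow> A\<^sub>\<tau>\<close> to it which is \<open>\<chi>\<^sub>a\<close> on \<open>\<Lambda>\<close> and the identity on \<open>A\<^sub>\<tau>\<close>, i.e. it is the pushout along \<open>\<chi>\<^sub>a\<close>.\<close>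

definition universal_extension ::
    "('e, 'm::complex_space) cmfd \<Rightarrow> ('e \<Rightarrow> ('d::finite) AAdual) \<Rightarrow> (complex \<Rightarrow> 'e \<Rightarrow> 'e) \<Rightarrow> bool" where
  "universal_extension E p act \<longleftrightarrow>
    (\<exists>add zero.
      let r = (\<lambda>e. (fst (p e), snd (snd (p e))));
          G = (\<lambda>x. \<lparr>carrier = {e\<in>points E. r e = x}, monoid.mult = add, one = zero x\<rparr>)
      in
      hol_map (prod_mfd E E) {(e, e'). e \<in> points E \<and> e' \<in> points E \<and> r e = r e'} E
        (\<lambda>(e, e'). add e e') \<and>
      hol_map dual_family (points dual_family) E zero \<and>
      hol_map E (points E) E (\<lambda>e. inv\<^bsub>G (r e)\<^esub> e) \<and>
      (\<forall>(\<tau>, b)\<in>points dual_family.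
         group_extension Cx_group (\<lambda>t. act t (zero (\<tau>, b))) (G (\<tau>, b)) (\<lambda>e. fst (snd (p e)))
           (av_group \<tau>) \<and>
         (\<forall>e\<in>carrier (G (\<tau>, b)). \<forall>t. t \<noteq> 0 \<longrightarrow> act t e = add (act t (zero (\<tau>, b))) e)) \<and>
      (\<forall>\<tau>\<in>siegel. \<forall>a :: complex ^ ('d + 'd). \<exists>\<psi>.
         let b = dual_cls \<tau> (a v* tau_one \<tau>) in
         hol_map (domain_mfd UNIV) UNIV E \<psi> \<and>
         (\<forall>v. p (\<psi> v) = (\<tau>, av_cls \<tau> v, b)) \<and>
         (\<forall>v v'. \<psi> (v + v') = add (\<psi> v) (\<psi> v')) \<and>
         (\<forall>y\<in>int_vecs. \<psi> (one_minus_tau \<tau> *v y) = act (exp (dotc a y)) (zero (\<tau>, b)))))"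

definition universal_poincare_torsor ::
    "('e, 'm::complex_space) cmfd \<Rightarrow> ('e \<Rightarrow> ('d::finite) AAdual) \<Rightarrow> (complex \<Rightarrow> 'e \<Rightarrow> 'e) \<Rightarrow> bool" where
  "universal_poincare_torsor E p act \<longleftrightarrow>
    Cx_torsor E AAdual_family p act \<and> (\<forall>\<tau>\<in>siegel. poincare_torsor \<tau> E p act) \<and>
    universal_extension E p act"

end

theory Submission
  imports Defs
begin

text \<open>In the coordinates \<open>(\<tau>, u, v, w)\<close> the element of \<open>P\<^sup>u(\<int>)\<close> with entries \<open>x, y, z\<close> acts, with \<open>\<xi> = 2\<pi>i x\<close> and
  \<open>\<zeta> = 2\<pi>i z\<close>, by translating \<open>u\<close> by \<open>\<xi>(\<tau>; 1)\<close>, \<open>v\<close> by \<open>(1 -\<tau>)y\<close>, and \<open>w\<close> by an affine function of \<open>(u, v)\<close>.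
  The vectors \<open>\<xi>\<close> and \<open>y\<close> can be read off continuously from a point and its image, because they are the
  coordinates with respect to a basis of \<open>\<complex>\<^sup>d\<close> over \<open>\<real>\<close> that varies continuously with \<open>\<tau>\<close>; so the action is
  free and properly discontinuous. The map \<open>(\<tau>, u, v, w) \<mapsto> (\<tau>, v, u)\<close> and translation of \<open>w\<close> descend to
  the projection and to the \<open>\<complex>\<^sup>\<times>\<close>-action, and adding \<open>v\<close> and \<open>w\<close> for fixed \<open>(\<tau>, u)\<close> descends to the group law
  of the universal extension. The class of the extension at \<open>u = a(\<tau>; 1)\<close> is detected by the section
  \<open>v \<mapsto> (\<tau>, u, v, a\<^sub>1v)\<close>, where \<open>a\<^sub>1\<close> is the first half of \<open>a\<close>.\<close>

section \<open>Holomorphic functions\<close>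

text \<open>Surjectivity of the coordinates onto \<open>period_domain\<close> is a proof of its own.
  The bound on Hodge types makes \<open>F p\<close> vanish on each graded piece above its range,
  opposedness turns this into fullness below it, and only \<open>F 0\<close> remains. The
  polarisation then forces \<open>F 0\<close> to be a graph: \<tau> is symmetric because the middle
  part is isotropic, and Im \<tau> is positive because the form is. The identity
  \<open>dotc_one_minus_tau\<close>, a form of (1 -\<tau>)(\<tau>; 1) = 0, links the action to the
  extension: it yields both the Heisenberg cocycle in \<open>heis_act_act\<close> and the factor
  exp(ay) of the pushout section. The group law descends because, for fixed u and \<xi>, the shift
  of w is additive in v, y and \<zeta>. All holomorphy is checked on lifts to the domain upstairs.
  The lifts must be local wherever a logarithm, or a lattice vector depending on the point, has to
  be chosen.\<close>

lemma cscale_zero_right [simp]: "cscale c (0::'a::complex_space) = 0"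
  using cscale_add_right[of c 0 "0::'a"] by simp

lemma holo_onI:
  assumes "\<And>x. x \<in> S \<Longrightarrow> \<exists>f'. (f has_derivative f') (at x within S) \<and> (\<forall>c v. f' (cscale c v) = cscale c (f' v))"
  shows "holo_on f S"
  using assms by (auto simp: holo_on_def)

lemma holo_onE:
  assumes "holo_on f S" "x \<in> S"
  obtains f' where "(f has_derivative f') (at x within S)" "\<And>c v. f' (cscale c v) = cscale c (f' v)"
  using assms by (force simp: holo_on_def)

lemma holo_on_cong: "(\<And>x. x \<in> S \<Longrightarrow> f x = g x) \<Longrightarrow> holo_on f S \<Longrightarrow> holo_on g S"
  unfolding holo_on_def by (metis has_derivative_transform)

lemma holo_on_subset: "holo_on f S \<Longrightarrow> T \<subseteq> S \<Longrightarrow> holo_on f T"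
  unfolding holo_on_def by (meson has_derivative_subset subsetD)

lemma holo_on_continuous_on: "holo_on f S \<Longrightarrow> continuous_on S f"
  unfolding holo_on_def by (meson has_derivative_continuous_on has_derivative_continuous
      continuous_on_eq_continuous_within)

lemma holo_on_compose:
  assumes "holo_on f S" "holo_on g T" "f ` S \<subseteq> T"
  shows "holo_on (\<lambda>x. g (f x)) S"
proof (rule holo_onI)
  fix x assume x: "x \<in> S"
  obtain f' where f': "(f has_derivative f') (at x within S)" "\<And>c v. f' (cscale c v) = cscale c (f' v)"
    by (rule holo_onE[OF assms(1) x]) blast
  obtain g' where g': "(g has_derivative g') (at (f x) within T)" "\<And>c v. g' (cscale c v) = cscale c (g' v)"
    using assms(2,3) x by (meson holo_onE image_subset_iff)
  have "(g \<circ> f has_derivative g' \<circ> f') (at x within S)"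
    by (rule diff_chain_within[OF f'(1) has_derivative_subset[OF g'(1) assms(3)]])
  then show "\<exists>h'. ((\<lambda>x. g (f x)) has_derivative h') (at x within S) \<and> (\<forall>c v. h' (cscale c v) = cscale c (h' v))"
    by (intro exI[of _ "g' \<circ> f'"]) (simp add: f'(2) g'(2) o_def)
qed

named_theorems holo_intros

lemma holo_on_const [holo_intros]: "holo_on (\<lambda>x. c) S"
  by (intro holo_onI exI[of _ "\<lambda>_. 0"]) (auto intro!: derivative_eq_intros)

lemma holo_on_id [holo_intros]: "holo_on (\<lambda>x. x) S"
  by (intro holo_onI exI[of _ "\<lambda>x. x"]) (auto intro!: derivative_eq_intros)

lemma holo_on_Pair [holo_intros]:
  assumes "holo_on f S" "holo_on g S"
  shows "holo_on (\<lambda>x. (f x, g x)) S"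
proof (rule holo_onI)
  fix x assume x: "x \<in> S"
  obtain f' where f': "(f has_derivative f') (at x within S)" "\<And>c v. f' (cscale c v) = cscale c (f' v)"
    by (rule holo_onE[OF assms(1) x]) blast
  obtain g' where g': "(g has_derivative g') (at x within S)" "\<And>c v. g' (cscale c v) = cscale c (g' v)"
    by (rule holo_onE[OF assms(2) x]) blast
  show "\<exists>h'. ((\<lambda>x. (f x, g x)) has_derivative h') (at x within S) \<and> (\<forall>c v. h' (cscale c v) = cscale c (h' v))"
    by (intro exI[of _ "\<lambda>v. (f' v, g' v)"] conjI has_derivative_Pair f' g')
      (simp add: f'(2) g'(2) cscale_prod_def)
qed

lemma holo_on_linear:
  assumes "bounded_linear h" "\<And>c v. h (cscale c v) = cscale c (h v)" "holo_on f S"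
  shows "holo_on (\<lambda>x. h (f x)) S"
  by (rule holo_on_compose[OF assms(3), where T=UNIV])
     (auto intro!: holo_onI exI[of _ h] bounded_linear_imp_has_derivative assms)

lemma holo_on_fst [holo_intros]: "holo_on f S \<Longrightarrow> holo_on (\<lambda>x. fst (f x)) S"
  by (rule holo_on_linear[OF bounded_linear_fst]) (auto simp: cscale_prod_def)

lemma holo_on_snd [holo_intros]: "holo_on f S \<Longrightarrow> holo_on (\<lambda>x. snd (f x)) S"
  by (rule holo_on_linear[OF bounded_linear_snd]) (auto simp: cscale_prod_def)

lemma holo_on_vec_nth [holo_intros]: "holo_on f S \<Longrightarrow> holo_on (\<lambda>x. f x $ i) S"
  by (rule holo_on_linear[OF bounded_linear_vec_nth]) (auto simp: cscale_vec_def)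

lemma holo_on_add [holo_intros]:
  "holo_on f S \<Longrightarrow> holo_on g S \<Longrightarrow> holo_on (\<lambda>x. f x + g x) S"
  using holo_on_linear[where h = "\<lambda>p. fst p + snd p", OF _ _ holo_on_Pair[of f S g]]
  by (simp add: bounded_linear_add bounded_linear_fst bounded_linear_snd cscale_prod_def cscale_add_right)

lemma holo_on_minus [holo_intros]: "holo_on f S \<Longrightarrow> holo_on (\<lambda>x. - f x) S"
proof (erule holo_on_linear[rotated 2])
  show "bounded_linear (uminus :: 'b \<Rightarrow> 'b)"
    by (rule bounded_linear_minus[OF bounded_linear_ident])
  fix c and v :: 'b
  show "- cscale c v = cscale c (- v)"
    by (metis add.right_inverse cscale_add_right cscale_zero_right minus_unique)
qed

lemma holo_on_diff [holo_intros]: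
  "holo_on f S \<Longrightarrow> holo_on g S \<Longrightarrow> holo_on (\<lambda>x. f x - g x) S"
  using holo_on_add[OF _ holo_on_minus, of f S g] by simp

lemma holo_on_sum [holo_intros]:
  assumes "\<And>i. i \<in> I \<Longrightarrow> holo_on (f i) S"
  shows "holo_on (\<lambda>x. \<Sum>i\<in>I. f i x) S"
  using assms by (induction I rule: infinite_finite_induct) (auto intro: holo_intros)

lemma holo_on_mult [holo_intros]:
  fixes f g :: "'a::complex_space \<Rightarrow> complex"
  assumes "holo_on f S" "holo_on g S"
  shows "holo_on (\<lambda>x. f x * g x) S"
proof (rule holo_onI)
  fix x assume x: "x \<in> S"
  obtain f' where f': "(f has_derivative f') (at x within S)" "\<And>c v. f' (cscale c v) = cscale c (f' v)"
    by (rule holo_onE[OF assms(1) x]) blast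
  obtain g' where g': "(g has_derivative g') (at x within S)" "\<And>c v. g' (cscale c v) = cscale c (g' v)"
    by (rule holo_onE[OF assms(2) x]) blast
  show "\<exists>h'. ((\<lambda>x. f x * g x) has_derivative h') (at x within S) \<and> (\<forall>c v. h' (cscale c v) = cscale c (h' v))"
    by (rule exI, rule conjI, rule has_derivative_mult[OF f'(1) g'(1)])
      (simp add: f'(2) g'(2) cscale_complex_def algebra_simps)
qed

lemma holo_on_field:
  fixes f :: "complex \<Rightarrow> complex"
  assumes "\<And>x. x \<in> S \<Longrightarrow> \<exists>D. (f has_field_derivative D) (at x)"
  shows "holo_on f S"
proof (rule holo_onI)
  fix x assume "x \<in> S"
  then obtain D where D: "(f has_field_derivative D) (at x)" using assms by blast
  show "\<exists>f'. (f has_derivative f') (at x within S) \<and> (\<forall>c v. f' (cscale c v) = cscale c (f' v))"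
    using has_field_derivative_at_within[OF D]
    by (intro exI[of _ "(*) D"]) (auto simp: has_field_derivative_def cscale_complex_def)
qed

lemma holo_on_exp [holo_intros]: "holo_on f S \<Longrightarrow> holo_on (\<lambda>x. exp (f x :: complex)) S"
  by (rule holo_on_compose[where T=UNIV]) (auto intro!: holo_on_field DERIV_exp)

lemma holo_on_vec_lambda [holo_intros]:
  fixes f :: "'n::finite \<Rightarrow> 'a::complex_space \<Rightarrow> 'b::complex_space"
  assumes "\<And>i. holo_on (f i) S"
  shows "holo_on (\<lambda>x. \<chi> i. f i x) S"
proof (rule holo_onI)
  fix x assume x: "x \<in> S"
  have "\<forall>i. \<exists>f'. (f i has_derivative f') (at x within S) \<and> (\<forall>c v. f' (cscale c v) = cscale c (f' v))"
    using assms x unfolding holo_on_def by blast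
  then obtain f' where f': "\<And>i. (f i has_derivative f' i) (at x within S)"
      "\<And>i c v. f' i (cscale c v) = cscale c (f' i v)"
    by metis
  have "((\<lambda>x. \<chi> i. f i x) has_derivative (\<lambda>v. \<chi> i. f' i v)) (at x within S)"
    by (subst has_derivative_componentwise_within)
       (auto simp: Basis_vec_def inner_axis intro!: has_derivative_inner_left f')
  then show "\<exists>h'. ((\<lambda>x. \<chi> i. f i x) has_derivative h') (at x within S) \<and> (\<forall>c v. h' (cscale c v) = cscale c (h' v))"
    by (intro exI[of _ "\<lambda>v. \<chi> i. f' i v"]) (simp add: f'(2) cscale_vec_def)
qed

lemma holo_on_dotc [holo_intros]:
  "holo_on f S \<Longrightarrow> holo_on g S \<Longrightarrow> holo_on (\<lambda>x. dotc (f x) (g x)) S"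
  unfolding dotc_def by (intro holo_intros)

section \<open>Manifolds uniformised by a domain\<close>

text \<open>All charts are restrictions of the single map \<open>q\<close>, so a map out of
  \<open>X\<close> can be tested after composition with \<open>q\<close>. The target of a map needs
  more: \<open>charts_cover\<close> also provides around each point a chart domain on which
  \<open>q\<close> is injective, so that a lift can be read in a chart.\<close>

definition charts_from :: "('b, 'm::complex_space) cmfd \<Rightarrow> 'm set \<Rightarrow> ('m \<Rightarrow> 'b) \<Rightarrow> bool" where
  "charts_from X S q \<longleftrightarrow> points X = q ` S \<and>
     (\<forall>(V, \<phi>)\<in>params X. openin (top_of_set S) V \<and> \<phi> = q)"

definition charts_cover :: "('b, 'm::complex_space) cmfd \<Rightarrow> 'm set \<Rightarrow> ('m \<Rightarrow> 'b) \<Rightarrow> bool" where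
  "charts_cover X S q \<longleftrightarrow> charts_from X S q \<and>
     (\<forall>s\<in>S. \<exists>V. (V, q) \<in> params X \<and> s \<in> V \<and> inj_on q V)"

lemma charts_from_cover: "charts_cover X S q \<Longrightarrow> charts_from X S q"
  by (simp add: charts_cover_def)

lemma charts_from_points: "charts_from X S q \<Longrightarrow> points X = q ` S"
  by (simp add: charts_from_def)

lemma charts_from_domain: "charts_from (domain_mfd S) S (\<lambda>s. s)"
  by (auto simp: charts_from_def domain_mfd_def)

lemma charts_cover_domain: "charts_cover (domain_mfd S) S (\<lambda>s. s)"
  by (auto simp: charts_cover_def charts_from_domain) (auto simp: domain_mfd_def)

lemma charts_from_prod:
  assumes "charts_from X S q" "charts_from Y T r"
  shows "charts_from (prod_mfd X Y) (S \<times> T) (map_prod q r)"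
proof -
  have "points (prod_mfd X Y) = map_prod q r ` (S \<times> T)"
    using assms by (auto simp: charts_from_def prod_mfd_def)
  moreover have "openin (top_of_set (S \<times> T)) (V \<times> W)"
    if "(V, \<phi>) \<in> params X" "(W, \<psi>) \<in> params Y" for V \<phi> W \<psi>
    using assms that by (auto simp: charts_from_def intro!: openin_Times)
  ultimately show ?thesis
    using assms by (fastforce simp: charts_from_def prod_mfd_def)
qed

lemma charts_cover_prod:
  assumes "charts_cover X S q" "charts_cover Y T r"
  shows "charts_cover (prod_mfd X Y) (S \<times> T) (map_prod q r)"
  unfolding charts_cover_def
proof (intro conjI ballI)
  show "charts_from (prod_mfd X Y) (S \<times> T) (map_prod q r)"
    by (intro charts_from_prod charts_from_cover assms)
  fix z assume z: "z \<in> S \<times> T"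
  obtain V where V: "(V, q) \<in> params X" "fst z \<in> V" "inj_on q V"
    using z assms(1) by (auto simp: charts_cover_def)
  obtain W where W: "(W, r) \<in> params Y" "snd z \<in> W" "inj_on r W"
    using z assms(2) by (auto simp: charts_cover_def)
  show "\<exists>V. (V, map_prod q r) \<in> params (prod_mfd X Y) \<and> z \<in> V \<and> inj_on (map_prod q r) V"
    using V W by (intro exI[of _ "V \<times> W"])
      (auto simp: prod_mfd_def map_prod_def inj_on_def mem_Times_iff)
qed

text \<open>A lift \<open>F\<close> is continuous, so on a smaller neighbourhood it stays in one
  chart domain \<open>W\<close> of \<open>Y\<close>. There \<open>r\<close> is injective, and the
  coordinate expression \<open>inv_into W r \<circ> f \<circ> q\<close> is \<open>F\<close>
  itself.\<close>

lemma hol_map_lift: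
  fixes X :: "('a, 'm::complex_space) cmfd" and Y :: "('b, 'n::complex_space) cmfd"
  assumes X: "charts_from X S q" and Y: "charts_cover Y T r"
    and Z: "Z \<subseteq> q ` S"
    and lift: "\<And>s. s \<in> S \<Longrightarrow> q s \<in> Z \<Longrightarrow>
      \<exists>N F. open N \<and> s \<in> N \<and> holo_on F (N \<inter> {x\<in>S. q x \<in> Z}) \<and>
        (\<forall>x\<in>N \<inter> {x\<in>S. q x \<in> Z}. F x \<in> T \<and> f (q x) = r (F x))"
  shows "hol_map X Z Y f"
  unfolding hol_map_def
proof (intro conjI ballI)
  show "Z \<subseteq> points X" using X Z by (simp add: charts_from_def)
  have Yp: "points Y = r ` T" using Y by (auto simp: charts_cover_def charts_from_def)
  show "f ` Z \<subseteq> points Y"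
  proof (rule image_subsetI)
    fix z assume z: "z \<in> Z"
    then obtain s where "s \<in> S" "z = q s" using Z by auto
    then show "f z \<in> points Y" using lift[of s] z Yp by auto
  qed
  fix P assume P: "P \<in> params X"
  obtain V where P_eq: "P = (V, q)" and V: "openin (top_of_set S) V"
    using X P by (cases P) (auto simp: charts_from_def)
  have VS: "V \<subseteq> S" using V openin_imp_subset by blast
  show "case P of (V, \<phi>) \<Rightarrow> \<forall>s\<in>V. \<phi> s \<in> Z \<longrightarrow> (\<exists>(W, \<psi>)\<in>params Y. \<exists>N.
          openin (top_of_set {r \<in> V. \<phi> r \<in> Z}) N \<and> s \<in> N \<and> f ` \<phi> ` N \<subseteq> \<psi> ` W \<and>
          holo_on (inv_into W \<psi> \<circ> f \<circ> \<phi>) N)"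
    unfolding P_eq prod.case
  proof (intro ballI impI)
    fix s assume s: "s \<in> V" "q s \<in> Z"
    obtain N F where N: "open N" "s \<in> N" "holo_on F (N \<inter> {x\<in>S. q x \<in> Z})"
      and F: "\<And>x. x \<in> N \<Longrightarrow> x \<in> S \<Longrightarrow> q x \<in> Z \<Longrightarrow> F x \<in> T \<and> f (q x) = r (F x)"
      using lift[of s] s VS by blast
    have FsT: "F s \<in> T" using F N s VS V by auto
    then obtain W where W: "(W, r) \<in> params Y" "F s \<in> W" "inj_on r W"
      using Y unfolding charts_cover_def by blast
    have "openin (top_of_set T) W" using W(1) Y by (auto simp: charts_cover_def charts_from_def)
    then obtain O' where O': "open O'" "W = T \<inter> O'" by (auto simp: openin_open)
    let ?D = "{x \<in> V. q x \<in> Z}"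
    have D: "N \<inter> ?D \<subseteq> N \<inter> {x\<in>S. q x \<in> Z}" using VS by auto
    have hF: "holo_on F (N \<inter> ?D)" using holo_on_subset[OF N(3) D] .
    have "openin (top_of_set (N \<inter> ?D)) ((N \<inter> ?D) \<inter> F -` O')"
      using continuous_openin_preimage_gen[OF holo_on_continuous_on[OF hF] O'(1)] .
    moreover have "openin (top_of_set ?D) (N \<inter> ?D)"
      using N(1) by (metis inf_commute openin_open_Int)
    ultimately have op: "openin (top_of_set ?D) ((N \<inter> ?D) \<inter> F -` O')"
      using openin_trans by blast
    let ?N = "(N \<inter> ?D) \<inter> F -` O'"
    have FW: "F x \<in> W" "f (q x) = r (F x)" if "x \<in> ?N" for x
    proof -
      have x: "x \<in> N" "x \<in> S" "q x \<in> Z" "F x \<in> O'" using that VS by auto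
      have 1: "F x \<in> T" "f (q x) = r (F x)" using F[OF x(1-3)] by simp_all
      show "F x \<in> W" unfolding O'(2) using 1(1) x(4) by (rule IntI)
      show "f (q x) = r (F x)" by (rule 1)
    qed
    have 1: "f ` q ` ?N \<subseteq> r ` W"
    proof -
      have "f (q y) \<in> r ` W" if y: "y \<in> ?N" for y
        unfolding FW(2)[OF y] by (rule imageI) (rule FW(1)[OF y])
      then show ?thesis unfolding image_subset_iff ball_simps(9) by (rule ballI)
    qed
    have 2: "holo_on (inv_into W r \<circ> f \<circ> q) ?N"
    proof (rule holo_on_cong)
      show "holo_on F ?N" by (rule holo_on_subset[OF hF]) (rule Int_lower1)
      fix x assume x: "x \<in> ?N"
      show "F x = (inv_into W r \<circ> f \<circ> q) x"
        unfolding o_def FW(2)[OF x] by (rule inv_into_f_f[OF W(3) FW(1)[OF x], symmetric])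
    qed
    have 3: "s \<in> ?N"
    proof -
      have "F s \<in> O'" using W(2) unfolding O'(2) by (rule IntD2)
      then show ?thesis using s N(2) by simp
    qed
    show "\<exists>(W, \<psi>)\<in>params Y. \<exists>N.
          openin (top_of_set {r \<in> V. q r \<in> Z}) N \<and> s \<in> N \<and> f ` q ` N \<subseteq> \<psi> ` W \<and>
          holo_on (inv_into W \<psi> \<circ> f \<circ> q) N"
      unfolding bex_simps
      by (rule bexI[OF _ W(1)], unfold prod.case, rule exI, intro conjI) (rule op, rule 3, rule 1, rule 2)
  qed
qed

lemma hol_map_lift_global:
  fixes X :: "('a, 'm::complex_space) cmfd" and Y :: "('b, 'n::complex_space) cmfd"
  assumes X: "charts_from X S q" and Y: "charts_cover Y T r"
    and F: "holo_on F S" "\<And>x. x \<in> S \<Longrightarrow> F x \<in> T \<and> f (q x) = r (F x)"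
  shows "hol_map X (points X) Y f"
proof -
  have "hol_map X (q ` S) Y f"
  proof (rule hol_map_lift[OF X Y], simp)
    fix s
    show "\<exists>N F. open N \<and> s \<in> N \<and> holo_on F (N \<inter> {x\<in>S. q x \<in> q ` S}) \<and>
        (\<forall>x\<in>N \<inter> {x\<in>S. q x \<in> q ` S}. F x \<in> T \<and> f (q x) = r (F x))"
      using F holo_on_subset[OF F(1)] by (intro exI[of _ UNIV] exI[of _ F]) auto
  qed
  then show ?thesis using charts_from_points[OF X] by simp
qed

lemma mfd_open_charts_from:
  assumes "charts_from X S q" "U \<subseteq> q ` S" "openin (top_of_set S) {s\<in>S. q s \<in> U}"
  shows "mfd_open X U"
  unfolding mfd_open_def
proof (intro conjI ballI)
  show "U \<subseteq> points X" using assms by (simp add: charts_from_def)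
  fix P assume P: "P \<in> params X"
  obtain V \<phi> where P_eq: "P = (V, \<phi>)" by force
  have V: "openin (top_of_set S) V" "\<phi> = q" using assms P P_eq by (auto simp: charts_from_def)
  obtain O' where O': "open O'" "{s\<in>S. q s \<in> U} = S \<inter> O'"
    using assms(3) by (auto simp: openin_open)
  have VS: "V \<subseteq> S" using V(1) openin_imp_subset by blast
  have "{s \<in> V. q s \<in> U} = V \<inter> {s\<in>S. q s \<in> U}" using VS by auto
  also have "\<dots> = V \<inter> O'" using O' VS by auto
  finally show "case P of (V, \<phi>) \<Rightarrow> openin (top_of_set V) {s \<in> V. \<phi> s \<in> U}"
    using O'(1) by (simp add: P_eq V(2) openin_open_Int)
qed

section \<open>Quotients of a domain by a free and properly discontinuous action\<close>

definition quot :: "'m::complex_space set \<Rightarrow> ('m \<Rightarrow> 'b) \<Rightarrow> ('b, 'm) cmfd" where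
  "quot S q = Cmfd (q ` S) {(V, q) | V. openin (top_of_set S) V \<and> inj_on q V}"

lemma quotient_mfd_domain: "quotient_mfd (domain_mfd S) q = quot S q"
  by (auto simp: quotient_mfd_def domain_mfd_def quot_def o_def)

lemma charts_from_quot: "charts_from (quot S q) S q"
  by (auto simp: charts_from_def quot_def)

text \<open>The function \<open>K\<close> recovers a group element \<open>g\<close> continuously from \<open>s\<close> and \<open>A g s\<close>. As \<open>\<Gamma>\<close> is uniformly
  discrete, this makes the action free and properly discontinuous.\<close>

locale covering_quotient =
  fixes S :: "'m::complex_space set" and q :: "'m \<Rightarrow> 'b" and \<Gamma> :: "'g::metric_space set"
    and A :: "'g \<Rightarrow> 'm \<Rightarrow> 'm" and K :: "'m \<Rightarrow> 'm \<Rightarrow> 'g" and \<delta> :: real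
  assumes orbit: "s \<in> S \<Longrightarrow> s' \<in> S \<Longrightarrow> q s = q s' \<longleftrightarrow> (\<exists>g\<in>\<Gamma>. s' = A g s)"
    and A_in: "g \<in> \<Gamma> \<Longrightarrow> s \<in> S \<Longrightarrow> A g s \<in> S"
    and A_holo: "g \<in> \<Gamma> \<Longrightarrow> holo_on (A g) S"
    and K_cont: "continuous_on (S \<times> S) (\<lambda>(s, s'). K s s')"
    and K_A: "g \<in> \<Gamma> \<Longrightarrow> s \<in> S \<Longrightarrow> K s (A g s) = g"
    and \<delta>_pos: "\<delta> > 0"
    and discrete: "g \<in> \<Gamma> \<Longrightarrow> g' \<in> \<Gamma> \<Longrightarrow> dist g g' < \<delta> \<Longrightarrow> g = g'"
begin

lemma q_A: "g \<in> \<Gamma> \<Longrightarrow> s \<in> S \<Longrightarrow> q (A g s) = q s"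
  using orbit[of s "A g s"] A_in by auto

text \<open>\<open>K\<close> varies by less than \<delta>/2 near (s, s'), and its value at (x, A g
  x) is g. So all group elements that carry a point of \<open>U\<close> into \<open>U'\<close> lie
  in one ball of radius \<delta>/2 and therefore coincide.\<close>

lemma unique_element:
  assumes "s \<in> S" "s' \<in> S"
  obtains U U' where "openin (top_of_set S) U" "openin (top_of_set S) U'" "s \<in> U" "s' \<in> U'"
    "\<And>g g' x x'. g \<in> \<Gamma> \<Longrightarrow> g' \<in> \<Gamma> \<Longrightarrow> x \<in> U \<Longrightarrow> x' \<in> U \<Longrightarrow> A g x \<in> U' \<Longrightarrow> A g' x' \<in> U' \<Longrightarrow> g = g'"
proof -
  let ?B = "ball (K s s') (\<delta> / 2)"
  have "openin (top_of_set (S \<times> S)) ((S \<times> S) \<inter> (\<lambda>(s, s'). K s s') -` ?B)"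
    using continuous_openin_preimage_gen[OF K_cont open_ball] .
  moreover have "(s, s') \<in> (S \<times> S) \<inter> (\<lambda>(s, s'). K s s') -` ?B" using assms \<delta>_pos by auto
  ultimately obtain U U' where U: "openin (top_of_set S) U" "openin (top_of_set S) U'" "s \<in> U" "s' \<in> U'"
    and sub: "U \<times> U' \<subseteq> (S \<times> S) \<inter> (\<lambda>(s, s'). K s s') -` ?B"
    by (metis Times_in_interior_subtopology)
  have "g = g'" if g: "g \<in> \<Gamma>" "g' \<in> \<Gamma>" "x \<in> U" "x' \<in> U" "A g x \<in> U'" "A g' x' \<in> U'" for g g' x x'
  proof (rule discrete)
    have "(x, A g x) \<in> U \<times> U'" "(x', A g' x') \<in> U \<times> U'" using g by auto
    with sub have 1: "x \<in> S" "x' \<in> S" "dist (K s s') (K x (A g x)) < \<delta> / 2"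
      "dist (K s s') (K x' (A g' x')) < \<delta> / 2"
      by auto
    have "dist (K s s') g < \<delta> / 2" "dist (K s s') g' < \<delta> / 2"
      using 1(3,4) K_A[OF g(1) 1(1)] K_A[OF g(2) 1(2)] by simp_all
    then show "dist g g' < \<delta>" by (rule dist_triangle_half_r)
  qed (rule g)+
  then show ?thesis using that[OF U] by blast
qed

lemma locally_injective:
  assumes "s \<in> S"
  obtains V where "openin (top_of_set S) V" "s \<in> V" "inj_on q V"
proof -
  obtain U U' where U: "openin (top_of_set S) U" "openin (top_of_set S) U'" "s \<in> U" "s \<in> U'"
    and uniq: "\<And>g g' x x'. g \<in> \<Gamma> \<Longrightarrow> g' \<in> \<Gamma> \<Longrightarrow> x \<in> U \<Longrightarrow> x' \<in> U \<Longrightarrow> A g x \<in> U' \<Longrightarrow> A g' x' \<in> U' \<Longrightarrow> g = g'"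
    using unique_element[OF assms assms] by metis
  have sub: "U \<subseteq> S" using U(1) openin_imp_subset by blast
  have "inj_on q (U \<inter> U')"
  proof (rule inj_onI)
    fix x y assume x: "x \<in> U \<inter> U'" and y: "y \<in> U \<inter> U'" and "q x = q y"
    then obtain g where g: "g \<in> \<Gamma>" "y = A g x" using orbit[of x y] sub by auto
    \<comment> \<open>\<open>orbit\<close> for the pair x, x supplies an element fixing x, which
      stands in for the unit of the group.\<close>
    obtain e where e: "e \<in> \<Gamma>" "x = A e x" using orbit[of x x] sub x by auto
    have "A g x \<in> U'" "A e x \<in> U'" using x y g(2) e(2) by simp_all
    then have "g = e" using uniq[of g e x x] g(1) e(1) x by blast
    then show "x = y" using g(2) e(2) by simp
  qed
  then show ?thesis using that[of "U \<inter> U'"] U by (auto intro: openin_Int)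
qed

lemma charts_cover_quot: "charts_cover (quot S q) S q"
  unfolding charts_cover_def
proof (intro conjI ballI charts_from_quot)
  fix s assume "s \<in> S"
  then show "\<exists>V. (V, q) \<in> params (quot S q) \<and> s \<in> V \<and> inj_on q V"
    using locally_injective[of s] by (auto simp: quot_def)
qed

lemma open_A_preimage:
  assumes "openin (top_of_set S) W" "g \<in> \<Gamma>"
  shows "openin (top_of_set S) {s\<in>S. A g s \<in> W}"
proof -
  have "openin (top_of_set S) (S \<inter> A g -` W)"
    by (rule continuous_openin_preimage[OF holo_on_continuous_on[OF A_holo[OF assms(2)]] _ assms(1)])
       (use A_in assms in auto)
  then show ?thesis by (simp add: vimage_def Int_def)
qed

text \<open>Orbits are the fibres of \<open>q\<close>, so a saturation is a union of preimages under
  group elements; this makes \<open>q\<close> an open map.\<close>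

lemma saturation_eq:
  assumes "W \<subseteq> S"
  shows "{s\<in>S. q s \<in> q ` W} = (\<Union>g\<in>\<Gamma>. {s\<in>S. A g s \<in> W})"
proof -
  have "q s \<in> q ` W \<longleftrightarrow> (\<exists>g\<in>\<Gamma>. A g s \<in> W)" if s: "s \<in> S" for s
  proof
    assume "q s \<in> q ` W"
    then obtain t where t: "t \<in> W" "q s = q t" by auto
    then obtain g where "g \<in> \<Gamma>" "t = A g s" using orbit[OF s, of t] assms by auto
    then show "\<exists>g\<in>\<Gamma>. A g s \<in> W" using t(1) by auto
  next
    assume "\<exists>g\<in>\<Gamma>. A g s \<in> W"
    then obtain g where "g \<in> \<Gamma>" "A g s \<in> W" by auto
    then show "q s \<in> q ` W" using q_A[OF _ s, of g] by (metis imageI)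
  qed
  then show ?thesis by auto
qed

lemma open_saturation:
  assumes "openin (top_of_set S) W"
  shows "openin (top_of_set S) {s\<in>S. q s \<in> q ` W}"
  unfolding saturation_eq[OF openin_imp_subset[OF assms]]
  by (intro openin_Union) (use open_A_preimage[OF assms] in auto)

lemma mfd_open_image:
  assumes "openin (top_of_set S) W"
  shows "mfd_open (quot S q) (q ` W)"
  using assms openin_imp_subset[OF assms]
  by (intro mfd_open_charts_from[OF charts_from_quot]) (auto intro: open_saturation)

text \<open>At most one group element g carries points of \<open>U\<close> into \<open>U'\<close>.
  If there is none, the images are already disjoint. Otherwise it is enough to separate the distinct
  points \<open>A g s\<close> and \<open>s'\<close> in the ambient space and to shrink
  \<open>U\<close> and \<open>U'\<close> accordingly.\<close>

lemma hausdorff: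
  assumes s: "s \<in> S" "s' \<in> S" and ne: "q s \<noteq> q s'"
  obtains U U' where "openin (top_of_set S) U" "openin (top_of_set S) U'" "s \<in> U" "s' \<in> U'"
    "q ` U \<inter> q ` U' = {}"
proof -
  obtain U U' where U: "openin (top_of_set S) U" "openin (top_of_set S) U'" "s \<in> U" "s' \<in> U'"
    and uniq: "\<And>g g' x x'. g \<in> \<Gamma> \<Longrightarrow> g' \<in> \<Gamma> \<Longrightarrow> x \<in> U \<Longrightarrow> x' \<in> U \<Longrightarrow> A g x \<in> U' \<Longrightarrow> A g' x' \<in> U' \<Longrightarrow> g = g'"
    using unique_element[OF s] by metis
  have sub: "U \<subseteq> S" "U' \<subseteq> S" using U openin_imp_subset by blast+
  show ?thesis
  proof (cases "\<exists>g\<in>\<Gamma>. \<exists>x\<in>U. A g x \<in> U'")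
    case False
    have "q ` U \<inter> q ` U' = {}"
    proof (rule ccontr)
      assume "q ` U \<inter> q ` U' \<noteq> {}"
      then obtain a b where ab: "a \<in> U" "b \<in> U'" "q a = q b" by auto
      then obtain h where "h \<in> \<Gamma>" "b = A h a" using orbit[of a b] sub by auto
      then show False using False ab by auto
    qed
    then show ?thesis by (rule that[OF U])
  next
    case True
    then obtain g x where g: "g \<in> \<Gamma>" "x \<in> U" "A g x \<in> U'" by auto
    have "A g s \<noteq> s'" using ne q_A[OF g(1) s(1)] by auto
    then obtain O1 O2 where O': "open O1" "open O2" "A g s \<in> O1" "s' \<in> O2" "O1 \<inter> O2 = {}"
      using hausdorff by metis
    let ?U = "U \<inter> {s\<in>S. A g s \<in> S \<inter> O1}" and ?U' = "U' \<inter> (S \<inter> O2)"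
    have "openin (top_of_set S) ?U"
      by (intro openin_Int U open_A_preimage g openin_open_Int O')
    moreover have "openin (top_of_set S) ?U'" by (intro openin_Int U openin_open_Int O')
    moreover have "q ` ?U \<inter> q ` ?U' = {}"
    proof (rule ccontr)
      assume "q ` ?U \<inter> q ` ?U' \<noteq> {}"
      then obtain a b where ab: "a \<in> ?U" "b \<in> ?U'" "q a = q b" by auto
      then obtain h where h: "h \<in> \<Gamma>" "b = A h a" using orbit[of a b] by auto
      have "h = g" using uniq[of h g a x] ab(1,2) h g by blast
      then have "b \<in> O1 \<inter> O2" using ab(1,2) h(2) by blast
      then show False using O'(5) by blast
    qed
    moreover have "s \<in> ?U" "s' \<in> ?U'" using U(3,4) s O'(3,4) A_in[OF g(1) s(1)] by auto
    ultimately show ?thesis using that[of ?U ?U'] by blast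
  qed
qed

lemma complex_manifold_quot:
  assumes L: "complex_subspace L" "openin (top_of_set L) S"
  shows "complex_manifold (quot S q)"
proof -
  have charts: "inj_on q V \<and> q ` V \<subseteq> points (quot S q) \<and> (\<exists>L. complex_subspace L \<and> openin (top_of_set L) V)"
    if "openin (top_of_set S) V" "inj_on q V" for V
    using that L openin_trans[OF that(1) L(2)] openin_imp_subset[OF that(1)] by (auto simp: quot_def)
  have overlap: "openin (top_of_set V) {s\<in>V. q s \<in> q ` W} \<and> holo_on (inv_into W q \<circ> q) {s\<in>V. q s \<in> q ` W}"
    if V: "openin (top_of_set S) V" "inj_on q V" and W: "openin (top_of_set S) W" "inj_on q W" for V W
  proof
    have sub: "V \<subseteq> S" "W \<subseteq> S" using V W openin_imp_subset by blast+
    have "{s\<in>V. q s \<in> q ` W} = V \<inter> {s\<in>S. q s \<in> q ` W}" using sub by auto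
    moreover have "openin (top_of_set S) \<dots>" by (intro openin_Int V open_saturation W)
    ultimately show op: "openin (top_of_set V) {s\<in>V. q s \<in> q ` W}"
      using sub(1) by (metis (lifting) openin_subset_trans inf_le1)
    show "holo_on (inv_into W q \<circ> q) {s\<in>V. q s \<in> q ` W}"
    proof (rule holo_onI)
      fix x assume x: "x \<in> {s\<in>V. q s \<in> q ` W}"
      \<comment> \<open>The coordinate change sends y to the point of its orbit that lies in
        \<open>W\<close>. Near x this is \<open>A g y\<close>, for the g that moves x into
        \<open>W\<close>, so the derivative of \<open>A g\<close> can be transferred.\<close>
      then obtain g where g: "g \<in> \<Gamma>" "A g x \<in> W"
        using saturation_eq[OF sub(2)] sub(1) by blast
      let ?T = "{s\<in>V. q s \<in> q ` W}" and ?N = "{s\<in>S. A g s \<in> W}"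
      obtain O' where O': "open O'" "?N = S \<inter> O'"
        using open_A_preimage[OF W(1) g(1)] by (auto simp: openin_open)
      have xS: "x \<in> S" using x sub by blast
      then have "x \<in> S \<inter> O'" unfolding O'(2)[symmetric] using g by blast
      then have xO: "x \<in> O'" ..
      obtain f' where f': "(A g has_derivative f') (at x within S)" "\<And>c v. f' (cscale c v) = cscale c (f' v)"
        by (rule holo_onE[OF A_holo[OF g(1)] xS]) blast
      have "(A g has_derivative f') (at x within ?T)"
        by (rule has_derivative_subset[OF f'(1)]) (use sub in blast)
      then have "(inv_into W q \<circ> q has_derivative f') (at x within ?T)"
      proof (rule has_derivative_transform_eventually)
        have eq: "A g y = (inv_into W q \<circ> q) y" if y: "y \<in> O'" "y \<in> ?T" for y
        proof -
          have "y \<in> S \<inter> O'" using y sub by auto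
          then have "A g y \<in> W" "q (A g y) = q y"
            unfolding O'(2)[symmetric] using q_A[OF g(1)] by auto
          then show ?thesis using inv_into_f_f[OF W(2), of "A g y"] by simp
        qed
        show "A g x = (inv_into W q \<circ> q) x" by (rule eq[OF xO x])
        show "\<forall>\<^sub>F y in at x within ?T. A g y = (inv_into W q \<circ> q) y"
          unfolding eventually_at_topological using O'(1) xO eq by blast
        show "x \<in> ?T" by (rule x)
      qed
      then show "\<exists>f'. (inv_into W q \<circ> q has_derivative f') (at x within ?T) \<and>
          (\<forall>c v. f' (cscale c v) = cscale c (f' v))"
        using f'(2) by blast
    qed
  qed
  have cov: "\<exists>C. countable C \<and> C \<subseteq> params (quot S q) \<and> points (quot S q) = (\<Union>(V, \<phi>)\<in>C. \<phi> ` V)"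
  proof -
    let ?F = "{V. openin (top_of_set S) V \<and> inj_on q V}"
    obtain F' where F': "F' \<subseteq> ?F" "countable F'" "\<Union>F' = \<Union>?F"
      using Lindelof_openin[of ?F S] by auto
    have "\<Union>?F = S"
    proof
      show "\<Union>?F \<subseteq> S" using openin_imp_subset by blast
      show "S \<subseteq> \<Union>?F" using locally_injective by blast
    qed
    then have "points (quot S q) = (\<Union>(V, \<phi>)\<in>(\<lambda>V. (V, q)) ` F'. \<phi> ` V)"
      using F'(3) by (auto simp: quot_def)
    moreover have "(\<lambda>V. (V, q)) ` F' \<subseteq> params (quot S q)" using F'(1) by (auto simp: quot_def)
    ultimately show ?thesis using F'(2) by blast
  qed
  have haus: "\<exists>U U'. mfd_open (quot S q) U \<and> mfd_open (quot S q) U' \<and> x \<in> U \<and> y \<in> U' \<and> U \<inter> U' = {}"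
    if xy: "x \<in> points (quot S q)" "y \<in> points (quot S q)" "x \<noteq> y" for x y
  proof -
    obtain s s' where s: "s \<in> S" "s' \<in> S" "x = q s" "y = q s'" using xy by (auto simp: quot_def)
    obtain U U' where "openin (top_of_set S) U" "openin (top_of_set S) U'" "s \<in> U" "s' \<in> U'"
      "q ` U \<inter> q ` U' = {}"
      using hausdorff[of s s'] s xy by metis
    then show ?thesis using s mfd_open_image by blast
  qed
  have ball: "(\<forall>(V, \<phi>)\<in>params (quot S q). P V \<phi>) \<longleftrightarrow>
      (\<forall>V. openin (top_of_set S) V \<longrightarrow> inj_on q V \<longrightarrow> P V q)" for P
    by (auto simp: quot_def)
  show ?thesis unfolding complex_manifold_def ball
  proof (intro conjI cov)
    show "\<forall>x\<in>points (quot S q). \<forall>y\<in>points (quot S q). x \<noteq> y \<longrightarrow>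
       (\<exists>U U'. mfd_open (quot S q) U \<and> mfd_open (quot S q) U' \<and> x \<in> U \<and> y \<in> U' \<and> U \<inter> U' = {})"
      by (intro ballI impI haus)
  qed (intro allI impI charts overlap; assumption)+
qed

end

section \<open>The Siegel space\<close>

lemma sum_UNIV_Plus:
  fixes f :: "'a::finite + 'b::finite \<Rightarrow> 'c::comm_monoid_add"
  shows "(\<Sum>k\<in>UNIV. f k) = (\<Sum>a\<in>UNIV. f (Inl a)) + (\<Sum>b\<in>UNIV. f (Inr b))"
  unfolding UNIV_Plus_UNIV[symmetric] by (simp add: sum.Plus o_def del: UNIV_Plus_UNIV)

definition im_mat :: "complex ^ 'd ^ ('d::finite) \<Rightarrow> real ^ 'd ^ 'd" where
  "im_mat \<tau> = (\<chi> i j. Im (\<tau> $ i $ j))"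

lemma siegelD:
  assumes "\<tau> \<in> siegel"
  shows "\<tau> $ i $ j = \<tau> $ j $ i" "x \<noteq> 0 \<Longrightarrow> 0 < x \<bullet> (im_mat \<tau> *v x)"
proof -
  have "transpose \<tau> $ j $ i = \<tau> $ j $ i" using assms by (simp add: siegel_def)
  then show "\<tau> $ i $ j = \<tau> $ j $ i" by (simp add: transpose_def)
  show "0 < x \<bullet> (im_mat \<tau> *v x)" if "x \<noteq> 0"
    using assms that by (simp add: siegel_def im_mat_def)
qed

lemma siegel_vector_matrix: "\<tau> \<in> siegel \<Longrightarrow> x v* \<tau> = \<tau> *v x"
  using transpose_matrix_vector[of \<tau> x] by (simp add: siegel_def)

lemma det_im_mat_nonzero:
  assumes "\<tau> \<in> siegel"
  shows "det (im_mat \<tau>) \<noteq> 0"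
proof -
  have "x = 0" if "im_mat \<tau> *v x = 0" for x
    using siegelD(2)[OF assms, of x] that by force
  then have "\<exists>B. B ** im_mat \<tau> = mat 1"
    unfolding matrix_left_invertible_ker by blast
  then show ?thesis using invertible_det_nz invertible_left_inverse by blast
qed

text \<open>The complex subspace in which the Siegel space is open; for d > 1 it is not open in the
  space of all matrices.\<close>

definition symmetric_mats :: "(complex ^ 'd ^ ('d::finite)) set" where
  "symmetric_mats = {\<tau>. transpose \<tau> = \<tau>}"

lemma complex_subspace_symmetric_mats: "complex_subspace symmetric_mats"
  by (auto simp: complex_subspace_def subspace_def symmetric_mats_def transpose_def vec_eq_iff
      cscale_vec_def)

text \<open>By homogeneity it is enough to test positivity on unit vectors. The matrices that fail
  the test form the projection of a closed set along the compact unit sphere, which is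
  closed.\<close>

lemma openin_siegel: "openin (top_of_set symmetric_mats) (siegel :: (complex ^ 'd ^ ('d::finite)) set)"
proof -
  let ?f = "\<lambda>(x :: real ^ 'd, \<tau> :: complex ^ 'd ^ 'd). x \<bullet> (im_mat \<tau> *v x)"
  have cont: "continuous_on UNIV ?f"
    unfolding case_prod_beta inner_vec_def matrix_vector_mult_def im_mat_def
    by (simp, intro continuous_intros)
  have "closed {p. ?f p \<le> 0}"
    using continuous_closed_preimage[OF cont closed_UNIV closed_atMost[of 0]] by (simp add: vimage_def)
  then have "closed {\<tau>. \<exists>x. x \<in> sphere 0 1 \<and> (x, \<tau>) \<in> {p. ?f p \<le> 0}}"
    by (intro closed_compact_projection compact_sphere)
  then have op: "open (- {\<tau>. \<exists>x. x \<in> sphere 0 1 \<and> (x, \<tau>) \<in> {p. ?f p \<le> 0}})" (is "open ?O")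
    by (simp add: closed_def)
  have "siegel = symmetric_mats \<inter> ?O"
  proof (intro equalityI subsetI)
    fix \<tau> :: "complex ^ 'd ^ 'd" assume \<tau>: "\<tau> \<in> siegel"
    have "0 < x \<bullet> (im_mat \<tau> *v x)" if "norm x = 1" for x
      using siegelD(2)[OF \<tau>, of x] that by force
    then show "\<tau> \<in> symmetric_mats \<inter> ?O"
      using \<tau> by (force simp: symmetric_mats_def siegel_def)
  next
    fix \<tau> :: "complex ^ 'd ^ 'd" assume \<tau>: "\<tau> \<in> symmetric_mats \<inter> ?O"
    have "0 < x \<bullet> (im_mat \<tau> *v x)" if x: "x \<noteq> 0" for x
    proof -
      have "x /\<^sub>R norm x \<in> sphere 0 1" using x by simp
      then have "0 < (x /\<^sub>R norm x) \<bullet> (im_mat \<tau> *v (x /\<^sub>R norm x))"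
        using \<tau> unfolding Int_iff Compl_iff mem_Collect_eq prod.case by (meson not_le)
      also have "\<dots> = (x \<bullet> (im_mat \<tau> *v x)) / (norm x)\<^sup>2"
        by (simp add: matrix_vector_mult_scaleR power2_eq_square divide_inverse)
      finally show ?thesis using x by (simp add: zero_less_divide_iff)
    qed
    then show "\<tau> \<in> siegel" using \<tau> by (simp add: symmetric_mats_def siegel_def im_mat_def)
  qed
  then show ?thesis using openin_open_Int[OF op, of symmetric_mats] by (simp only:)
qed

lemma openin_siegel_times: "openin (top_of_set (symmetric_mats \<times> UNIV)) (siegel \<times> UNIV)"
  by (intro openin_Times openin_siegel) simp

lemma complex_subspace_times_UNIV:
  "complex_subspace L \<Longrightarrow> complex_subspace (L \<times> UNIV)"
  by (auto simp: complex_subspace_def subspace_def cscale_prod_def zero_prod_def)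

section \<open>The Heisenberg action in coordinates\<close>

text \<open>\<open>up\<close> and \<open>lo\<close> are the halves of a vector that face the blocks
  \<tau> and 1 of the period matrix (\<tau>; 1).\<close>

definition up :: "complex ^ ('d + 'd) \<Rightarrow> complex ^ ('d::finite)" where
  "up x = (\<chi> a. x $ Inl a)"

definition lo :: "complex ^ ('d + 'd) \<Rightarrow> complex ^ ('d::finite)" where
  "lo x = (\<chi> a. x $ Inr a)"

lemma up_lo_simps [simp]:
  "up (x + y) = up x + up y" "lo (x + y) = lo x + lo y" "up (- x) = - up x" "lo (- x) = - lo x"
  "up 0 = 0" "lo 0 = 0"
  by (simp_all add: up_def lo_def vec_eq_iff)

lemma dotc_add: "dotc (x + y) z = dotc x z + dotc y z" "dotc z (x + y) = dotc z x + dotc z y"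
  by (simp_all add: dotc_def algebra_simps sum.distrib)

lemma dotc_minus: "dotc (- x) z = - dotc x z" "dotc z (- x) = - dotc z x"
  by (simp_all add: dotc_def sum_negf)

lemma dotc_diff: "dotc (x - y) z = dotc x z - dotc y z" "dotc z (x - y) = dotc z x - dotc z y"
  by (simp_all add: dotc_def algebra_simps sum_subtractf)

lemma dotc_0 [simp]: "dotc 0 z = 0" "dotc z 0 = 0"
  by (simp_all add: dotc_def)

lemma dotc_commute: "dotc x y = dotc y x"
  by (simp add: dotc_def mult.commute)

lemma dotc_vector_matrix: "dotc (x v* A) y = dotc x (A *v y)"
  unfolding dotc_def vector_matrix_mult_def matrix_vector_mult_def
  by (simp add: sum_distrib_left sum_distrib_right) (subst sum.swap, simp add: algebra_simps)

lemma dotc_Plus: "dotc x y = dotc (up x) (up y) + dotc (lo x) (lo y)"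
  by (simp add: dotc_def up_def lo_def sum_UNIV_Plus)

lemma one_minus_tau_mult: "one_minus_tau \<tau> *v y = up y - \<tau> *v lo y"
  by (simp add: vec_eq_iff one_minus_tau_def matrix_vector_mult_def up_def lo_def sum_UNIV_Plus
      sum_negf if_distrib[of "\<lambda>x. x * _"] cong: if_cong)

lemma tau_one_mult: "x v* tau_one \<tau> = up x v* \<tau> + lo x"
  by (simp add: vec_eq_iff tau_one_def vector_matrix_mult_def up_def lo_def sum_UNIV_Plus
      if_distrib[of "\<lambda>x. x * _"] if_distrib[of "\<lambda>x. _ * x"] cong: if_cong)

text \<open>Substitute up y = (1 -\<tau>)y + \<tau> (lo y) in the splitting of
  \<open>dotc x y\<close> into halves; the terms with lo y collect to x(\<tau>; 1) applied to lo
  y.\<close>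

lemma dotc_one_minus_tau:
  "dotc (up x) (one_minus_tau \<tau> *v y) = dotc x y - dotc (x v* tau_one \<tau>) (lo y)"
  by (simp add: one_minus_tau_mult tau_one_mult dotc_diff dotc_add dotc_vector_matrix dotc_Plus[of x y])

definition Z1_vecs :: "(complex ^ ('n::finite)) set" where
  "Z1_vecs = {x. \<forall>i. x $ i \<in> Z1}"

lemma Z1_iff: "x \<in> Z1 \<longleftrightarrow> x / (2 * of_real pi * \<i>) \<in> \<int>"
proof
  assume "x / (2 * of_real pi * \<i>) \<in> \<int>"
  then obtain n where "x / (2 * of_real pi * \<i>) = of_int n" by (auto elim: Ints_cases)
  then have "x = 2 * of_real pi * \<i> * of_int n" by (simp add: field_simps)
  then show "x \<in> Z1" unfolding Z1_def by blast
qed (auto simp: Z1_def)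

lemma Z1_closed [simp]:
  "0 \<in> Z1" "x \<in> Z1 \<Longrightarrow> y \<in> Z1 \<Longrightarrow> x + y \<in> Z1" "x \<in> Z1 \<Longrightarrow> - x \<in> Z1"
  "x \<in> Z1 \<Longrightarrow> y \<in> Z1 \<Longrightarrow> x - y \<in> Z1" "x \<in> Z1 \<Longrightarrow> y \<in> \<int> \<Longrightarrow> x * y \<in> Z1"
  by (simp_all add: Z1_iff add_divide_distrib diff_divide_distrib)
     (metis Ints_mult times_divide_eq_left)

lemma Z1_sum: "(\<And>i. i \<in> I \<Longrightarrow> f i \<in> Z1) \<Longrightarrow> (\<Sum>i\<in>I. f i) \<in> Z1"
  by (induction I rule: infinite_finite_induct) auto

lemma lattice_vecs_closed [simp]:
  "0 \<in> Z1_vecs" "x \<in> Z1_vecs \<Longrightarrow> y \<in> Z1_vecs \<Longrightarrow> x + y \<in> Z1_vecs" "x \<in> Z1_vecs \<Longrightarrow> - x \<in> Z1_vecs"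
  "0 \<in> int_vecs" "x \<in> int_vecs \<Longrightarrow> y \<in> int_vecs \<Longrightarrow> x + y \<in> int_vecs" "x \<in> int_vecs \<Longrightarrow> - x \<in> int_vecs"
  "x \<in> Z1_vecs \<Longrightarrow> y \<in> int_vecs \<Longrightarrow> dotc x y \<in> Z1"
  by (auto simp: Z1_vecs_def int_vecs_def dotc_def intro: Z1_sum)

type_synonym 'd heis_coords = "(complex ^ ('d + 'd)) \<times> (complex ^ ('d + 'd)) \<times> complex"

definition heis_lattice :: "('d::finite) heis_coords set" where
  "heis_lattice = Z1_vecs \<times> int_vecs \<times> Z1"

text \<open>The Heisenberg matrix is applied to the columns of \<open>F\<^sup>0\<close>; then \<open>y\<^sub>2\<close>-multiples of the first \<open>d\<close> columns
  are subtracted from the last one, to make its entries in the rows of \<open>1\<^sub>d\<close> vanish again.\<close>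

fun heis_act :: "('d::finite) heis_coords \<Rightarrow> 'd coords \<Rightarrow> 'd coords" where
  "heis_act (\<xi>, y, \<zeta>) (\<tau>, u, v, w) =
     (\<tau>, u + \<xi> v* tau_one \<tau>, v + one_minus_tau \<tau> *v y,
      w + dotc (up \<xi>) v + \<zeta> - dotc (u + \<xi> v* tau_one \<tau>) (lo y))"

text \<open>The first translation moves v by (1 -\<tau>)y', so the second one adds
  \<open>dotc (up \<xi>)\<close> of this to w. By \<open>dotc_one_minus_tau\<close> this is the
  cocycle \<open>dotc \<xi> y'\<close> minus a term that completes the intermediate u, paired with
  lo y', to the final u.\<close>

lemma heis_act_act:
  "heis_act (\<xi>, y, \<zeta>) (heis_act (\<xi>', y', \<zeta>') s) = heis_act (\<xi> + \<xi>', y + y', \<zeta> + \<zeta>' + dotc \<xi> y') s"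
  by (cases s) (simp add: matrix_vector_right_distrib vector_matrix_left_distrib dotc_add
      dotc_one_minus_tau)

lemma heis_act_0 [simp]: "heis_act (0, 0, 0) s = s"
  by (cases s) simp

lemma heis_act_inverse:
  "heis_act (- \<xi>, - y, - \<zeta> + dotc \<xi> y) (heis_act (\<xi>, y, \<zeta>) s) = s"
  by (simp add: heis_act_act dotc_minus)

lemma heis_act_domain: "s \<in> coord_domain \<Longrightarrow> heis_act g s \<in> coord_domain"
  by (cases g, cases s) (auto simp: coord_domain_def)

lemma heis_orbit_eq_iff:
  "(\<lambda>g. heis_act g s) ` heis_lattice = (\<lambda>g. heis_act g s') ` heis_lattice \<longleftrightarrow>
     (\<exists>g\<in>heis_lattice. s' = heis_act g s)"
proof
  assume eq: "(\<lambda>g. heis_act g s) ` heis_lattice = (\<lambda>g. heis_act g s') ` heis_lattice"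
  have "s' = heis_act (0, 0, 0) s'" "(0, 0, 0) \<in> heis_lattice" by (simp_all add: heis_lattice_def)
  then have "s' \<in> (\<lambda>g. heis_act g s') ` heis_lattice" by (rule image_eqI)
  then show "\<exists>g\<in>heis_lattice. s' = heis_act g s" unfolding eq[symmetric] by auto
next
  have sub: "(\<lambda>g. heis_act g (heis_act h s)) ` heis_lattice \<subseteq> (\<lambda>g. heis_act g s) ` heis_lattice"
    if "h \<in> heis_lattice" for h and s :: "'a coords"
  proof (rule image_subsetI)
    fix g :: "'a heis_coords" assume g: "g \<in> heis_lattice"
    obtain \<xi> y \<zeta> \<xi>' y' \<zeta>' where gh: "g = (\<xi>, y, \<zeta>)" "h = (\<xi>', y', \<zeta>')" by (cases g, cases h)
    have "(\<xi> + \<xi>', y + y', \<zeta> + \<zeta>' + dotc \<xi> y') \<in> heis_lattice"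
      using g that by (simp add: gh heis_lattice_def)
    then show "heis_act g (heis_act h s) \<in> (\<lambda>g. heis_act g s) ` heis_lattice"
      unfolding gh heis_act_act by (rule imageI)
  qed
  assume "\<exists>g\<in>heis_lattice. s' = heis_act g s"
  then obtain \<xi> y \<zeta> where g: "(\<xi>, y, \<zeta>) \<in> heis_lattice" "s' = heis_act (\<xi>, y, \<zeta>) s" by auto
  let ?h = "(- \<xi>, - y, - \<zeta> + dotc \<xi> y)"
  have h: "?h \<in> heis_lattice" using g(1) by (simp add: heis_lattice_def)
  have "s = heis_act ?h s'" unfolding g(2) heis_act_inverse ..
  then have "(\<lambda>g. heis_act g s) ` heis_lattice \<subseteq> (\<lambda>g. heis_act g s') ` heis_lattice"
    using sub[OF h, of s'] by simp
  moreover have "(\<lambda>g. heis_act g s') ` heis_lattice \<subseteq> (\<lambda>g. heis_act g s) ` heis_lattice"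
    using sub[OF g(1), of s] by (simp add: g(2))
  ultimately show "(\<lambda>g. heis_act g s) ` heis_lattice = (\<lambda>g. heis_act g s') ` heis_lattice" ..
qed

section \<open>Lattice coordinates\<close>

text \<open>Cramer's rule for \<open>Im(\<tau>) x = Im(c)\<close>, which makes the continuity in \<open>\<tau>\<close> evident.\<close>

definition im_solve :: "complex ^ 'd ^ ('d::finite) \<Rightarrow> complex ^ 'd \<Rightarrow> real ^ 'd" where
  "im_solve \<tau> c = (\<chi> k. det (\<chi> i j. if j = k then Im (c $ i) else im_mat \<tau> $ i $ j) / det (im_mat \<tau>))"

lemma im_solve_eq:
  assumes "\<tau> \<in> siegel" "im_mat \<tau> *v x = (\<chi> i. Im (c $ i))"
  shows "im_solve \<tau> c = x"
  using cramer[OF det_im_mat_nonzero[OF assms(1)], of x "\<chi> i. Im (c $ i)"] assms(2)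
  by (simp add: im_solve_def cong: if_cong)

text \<open>For real y and c = (1 -\<tau>)y, the imaginary part is -Im(\<tau>) (lo y), which
  determines lo y by \<open>im_solve\<close> up to sign; the real part then gives up y = Re c +
  Re(\<tau>) (lo y).\<close>

definition av_coord :: "complex ^ 'd ^ ('d::finite) \<Rightarrow> complex ^ 'd \<Rightarrow> complex ^ ('d + 'd)" where
  "av_coord \<tau> c = (\<chi> k. case k of
      Inl a \<Rightarrow> of_real (Re (c $ a) - (\<Sum>b\<in>UNIV. Re (\<tau> $ a $ b) * im_solve \<tau> c $ b))
    | Inr a \<Rightarrow> of_real (- im_solve \<tau> c $ a))"

lemma av_coord_inverse:
  assumes \<tau>: "\<tau> \<in> siegel" and y: "\<And>k. y $ k \<in> \<real>"
  shows "av_coord \<tau> (one_minus_tau \<tau> *v y) = y"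
proof -
  have [simp]: "Im (y $ k) = 0" for k using y by (simp add: complex_is_Real_iff)
  have yr: "y $ k = of_real (Re (y $ k))" for k by (simp add: complex_eq_iff)
  have s: "im_solve \<tau> (one_minus_tau \<tau> *v y) = (\<chi> a. - Re (y $ Inr a))"
    by (rule im_solve_eq[OF \<tau>])
      (unfold one_minus_tau_mult, simp add: vec_eq_iff im_mat_def matrix_vector_mult_def up_def lo_def sum_negf)
  show ?thesis
    unfolding vec_eq_iff
  proof
    fix k show "av_coord \<tau> (one_minus_tau \<tau> *v y) $ k = y $ k"
      unfolding av_coord_def s unfolding one_minus_tau_mult
      by (subst yr, cases k)
        (simp_all add: matrix_vector_mult_def up_def lo_def sum_negf)
  qed
qed

text \<open>With \<xi> = 2\<pi>i x and \<tau> symmetric, \<xi>(\<tau>; 1)/(2\<pi>i) = \<tau> (up x)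
  + lo x = (1 -\<tau>) applied to (lo x, -up x). So \<open>av_coord\<close> recovers x up to the
  exchange of its halves and one sign, which are undone here.\<close>

definition dual_coord :: "complex ^ 'd ^ ('d::finite) \<Rightarrow> complex ^ 'd \<Rightarrow> complex ^ ('d + 'd)" where
  "dual_coord \<tau> c = (let y = av_coord \<tau> (\<chi> i. c $ i / (2 * of_real pi * \<i>)) in
     (\<chi> k. 2 * of_real pi * \<i> * (case k of Inl a \<Rightarrow> - y $ Inr a | Inr a \<Rightarrow> y $ Inl a)))"

lemma dual_coord_inverse:
  assumes \<tau>: "\<tau> \<in> siegel" and \<xi>: "\<xi> \<in> Z1_vecs"
  shows "dual_coord \<tau> (\<xi> v* tau_one \<tau>) = \<xi>"
proof -
  let ?c = "2 * of_real pi * \<i>"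
  define y where "y = (\<chi> k. (case k of Inl a \<Rightarrow> \<xi> $ Inr a | Inr a \<Rightarrow> - \<xi> $ Inl a) / ?c)"
  have *: "\<xi> $ k / ?c \<in> \<real>" for k
  proof -
    have "\<xi> $ k / ?c \<in> \<int>" using \<xi> by (simp add: Z1_vecs_def Z1_iff)
    then show ?thesis by (rule Ints_cases) simp
  qed
  have y: "y $ k \<in> \<real>" for k
    using * by (cases k) (simp_all add: y_def del: Reals_minus_iff)
  have eq: "(\<chi> i. (\<xi> v* tau_one \<tau>) $ i / ?c) = one_minus_tau \<tau> *v y"
    unfolding tau_one_mult one_minus_tau_mult siegel_vector_matrix[OF \<tau>]
    by (simp add: vec_eq_iff y_def up_def lo_def matrix_vector_mult_def
        sum_negf add_divide_distrib sum_divide_distrib mult.commute)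
  show ?thesis
    unfolding dual_coord_def Let_def eq av_coord_inverse[OF \<tau> y]
    by (simp add: vec_eq_iff y_def split: sum.split)
qed

lemma continuous_on_det:
  fixes f :: "'a::topological_space \<Rightarrow> real ^ 'n ^ ('n::finite)"
  assumes "\<And>i j. continuous_on S (\<lambda>x. f x $ i $ j)"
  shows "continuous_on S (\<lambda>x. det (f x))"
  unfolding det_def by (intro continuous_intros assms)

lemma continuous_on_im_solve:
  assumes "continuous_on S f" "continuous_on S g" "\<And>x. x \<in> S \<Longrightarrow> f x \<in> siegel"
  shows "continuous_on S (\<lambda>x. im_solve (f x) (g x))"
  unfolding im_solve_def
proof (intro continuous_on_vec_lambda continuous_on_divide continuous_on_det)
  have f: "continuous_on S (\<lambda>x. im_mat (f x) $ i $ j)" for i j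
    unfolding im_mat_def by (simp, intro continuous_intros assms)
  then show "continuous_on S (\<lambda>x. im_mat (f x) $ i $ j)" for i j .
  show "continuous_on S (\<lambda>x. (\<chi> i j. if j = k then Im (g x $ i) else im_mat (f x) $ i $ j) $ i $ j)" for i j k
    using f by (cases "j = k") (simp_all, intro continuous_intros assms)
  show "\<forall>x\<in>S. det (im_mat (f x)) \<noteq> 0" using det_im_mat_nonzero assms(3) by blast
qed

lemma continuous_on_av_coord:
  assumes "continuous_on S f" "continuous_on S g" "\<And>x. x \<in> S \<Longrightarrow> f x \<in> siegel"
  shows "continuous_on S (\<lambda>x. av_coord (f x) (g x))"
  unfolding av_coord_def
proof (intro continuous_on_vec_lambda)
  note [continuous_intros] = continuous_on_im_solve[OF assms]
  fix k :: "'b + 'b"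
  show "continuous_on S (\<lambda>x. case k of
      Inl a \<Rightarrow> complex_of_real (Re (g x $ a) - (\<Sum>b\<in>UNIV. Re (f x $ a $ b) * im_solve (f x) (g x) $ b))
    | Inr a \<Rightarrow> complex_of_real (- im_solve (f x) (g x) $ a))"
  proof (cases k)
    case (Inl a)
    show ?thesis unfolding Inl sum.case by (intro continuous_intros assms)
  next
    case (Inr a)
    show ?thesis unfolding Inr sum.case by (intro continuous_intros assms)
  qed
qed

lemma continuous_on_dual_coord:
  assumes "continuous_on S f" "continuous_on S g" "\<And>x. x \<in> S \<Longrightarrow> f x \<in> siegel"
  shows "continuous_on S (\<lambda>x. dual_coord (f x) (g x))"
  unfolding dual_coord_def Let_def
proof (intro continuous_on_vec_lambda continuous_on_mult_left)
  have c: "continuous_on S (\<lambda>x. av_coord (f x) (\<chi> i. g x $ i / (2 * of_real pi * \<i>)))"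
    by (intro continuous_on_av_coord continuous_on_vec_lambda continuous_intros assms) auto
  fix k :: "'b + 'b"
  show "continuous_on S (\<lambda>x. case k of
      Inl a \<Rightarrow> - av_coord (f x) (\<chi> i. g x $ i / (2 * of_real pi * \<i>)) $ Inr a
    | Inr a \<Rightarrow> av_coord (f x) (\<chi> i. g x $ i / (2 * of_real pi * \<i>)) $ Inl a)"
    by (cases k) (simp_all, (intro continuous_intros c)+)
qed

text \<open>Neighbours in \<int>(1) have distance 2\<pi> > 1, so the bound 1 that separates integers
  serves all components of the lattice.\<close>

lemma Z1_discrete:
  assumes "x \<in> Z1" "y \<in> Z1" "dist x y < 1" shows "x = y"
proof (rule ccontr)
  assume ne: "x \<noteq> y"
  obtain m n where mn: "x = 2 * of_real pi * \<i> * of_int m" "y = 2 * of_real pi * \<i> * of_int n"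
    using assms(1,2) by (auto simp: Z1_def)
  have "dist x y = 2 * pi * \<bar>of_int (m - n)\<bar>"
    unfolding mn dist_norm right_diff_distrib[symmetric] norm_mult of_int_diff[symmetric] norm_of_int
    by simp
  moreover have "2 * pi * 1 \<le> 2 * pi * \<bar>real_of_int (m - n)\<bar>"
  proof (rule mult_left_mono)
    have "m \<noteq> n" using ne mn by auto
    then show "1 \<le> \<bar>real_of_int (m - n)\<bar>" by linarith
  qed simp
  ultimately show False using assms(3) pi_gt3 by linarith
qed

lemma Z1_vecs_discrete: "x \<in> Z1_vecs \<Longrightarrow> y \<in> Z1_vecs \<Longrightarrow> dist x y < 1 \<Longrightarrow> x = y"
  unfolding vec_eq_iff Z1_vecs_def
  by (metis (mono_tags, lifting) Z1_discrete dist_vec_nth_le le_less_trans mem_Collect_eq)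

lemma int_vecs_discrete:
  assumes "x \<in> int_vecs" "y \<in> int_vecs" "dist x y < 1" shows "x = y"
  unfolding vec_eq_iff
proof
  fix i
  have "x $ i \<in> \<int>" "y $ i \<in> \<int>" using assms(1,2) by (auto simp: int_vecs_def)
  moreover have "dist (x $ i) (y $ i) < 1" using dist_vec_nth_le[of x i y] assms(3) by linarith
  ultimately show "x $ i = y $ i"
    by (auto elim!: Ints_cases simp: dist_norm simp flip: of_int_diff)
qed

lemma dist_Pair_bounds: "dist a c \<le> dist (a, b) (c, d)" "dist b d \<le> dist (a, b) (c, d)"
  using dist_fst_le[of "(a, b)" "(c, d)"] dist_snd_le[of "(a, b)" "(c, d)"] by simp_all

section \<open>Weight filtration and conjugation\<close>

definition mid :: "complex ^ ('d::finite) mix \<Rightarrow> complex ^ ('d + 'd)" where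
  "mid m = (\<chi> k. m $ EM k)"

definition mix_vec :: "complex \<Rightarrow> complex ^ ('d + 'd) \<Rightarrow> complex \<Rightarrow> complex ^ ('d::finite) mix" where
  "mix_vec a x b = (\<chi> i. case i of Inl _ \<Rightarrow> a | Inr (Inl k) \<Rightarrow> x $ k | Inr (Inr _) \<Rightarrow> b)"

definition pair_vec :: "complex ^ 'd \<Rightarrow> complex ^ 'd \<Rightarrow> complex ^ (('d::finite) + 'd)" where
  "pair_vec x y = (\<chi> k. case k of Inl a \<Rightarrow> x $ a | Inr a \<Rightarrow> y $ a)"

lemma mix_vec_simps [simp]:
  "mix_vec a x b $ E0 = a" "mid (mix_vec a x b) = x" "mix_vec a x b $ E1 = b"
  "mix_vec a x b $ EM k = x $ k"
  by (simp_all add: mix_vec_def mid_def vec_eq_iff)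

lemma pair_vec_simps [simp]: "up (pair_vec x y) = x" "lo (pair_vec x y) = y"
  by (simp_all add: pair_vec_def up_def lo_def vec_eq_iff)

lemma up_lo_eqI: "up x = up y \<Longrightarrow> lo x = lo y \<Longrightarrow> x = y"
  by (simp add: up_def lo_def vec_eq_iff split_sum_all)

lemma mix_eqI: "m $ E0 = m' $ E0 \<Longrightarrow> mid m = mid m' \<Longrightarrow> m $ E1 = m' $ E1 \<Longrightarrow> m = m'"
  by (simp add: mid_def vec_eq_iff split_sum_all)

lemma mid_simps [simp]:
  "mid (m + m') = mid m + mid m'" "mid (m - m') = mid m - mid m'" "mid (- m) = - mid m"
  "mid (c *s m) = c *s mid m" "mid 0 = 0"
  by (simp_all add: mid_def vec_eq_iff)

lemma up_lo_linear [simp]: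
  "up (c *s x) = c *s up x" "lo (c *s x) = c *s lo x" "up (x - y) = up x - up y" "lo (x - y) = lo x - lo y"
  by (simp_all add: up_def lo_def vec_eq_iff)

lemma weight_fil_iff:
  "m \<in> weight_fil k \<longleftrightarrow> (k < 0 \<longrightarrow> m $ E1 = 0) \<and> (k < -1 \<longrightarrow> mid m = 0) \<and> (k < -2 \<longrightarrow> m $ E0 = 0)"
  (is "_ \<longleftrightarrow> ?P m")
proof
  assume "m \<in> weight_fil k"
  moreover have "vec.subspace (Collect ?P)"
    by (auto simp: vec.subspace_def)
  moreover have "weight_lat k \<subseteq> Collect ?P" by (auto simp: weight_lat_def mid_def vec_eq_iff)
  ultimately show "?P m" using vec.span_minimal[of "weight_lat k" "Collect ?P"]
    by (auto simp: weight_fil_def)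
next
  assume P: "?P m"
  \<comment> \<open>The lattice contains 2\<pi>i times the unit vector in the direction
    \<open>E0\<close>, so each unit vector is rescaled by \<open>c\<close> to become a lattice
    vector before the span is taken.\<close>
  define c where "c i = (if i = E0 then 2 * of_real pi * \<i> else 1 :: complex)" for i :: "'a mix"
  have c0: "c i \<noteq> 0" for i by (simp add: c_def)
  have "m $ i *s axis i 1 \<in> weight_fil k" for i
  proof (cases "m $ i = 0")
    case True
    then show ?thesis by (simp add: weight_fil_def vec.span_zero)
  next
    case False
    have "c i *s axis i 1 \<in> (latM :: (complex ^ 'a mix) set)"
    proof -
      have "2 * of_real pi * \<i> \<in> Z1" by (simp add: Z1_iff)
      then show ?thesis by (auto simp: latM_def c_def axis_def)
    qed
    moreover have "(c i *s axis i 1) $ j = 0" if "m $ j = 0" for j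
      using that False by (auto simp: axis_def)
    ultimately have "c i *s axis i 1 \<in> weight_lat k"
      using P by (auto simp: weight_lat_def mid_def vec_eq_iff)
    then have "(m $ i / c i) *s (c i *s axis i 1) \<in> weight_fil k"
      unfolding weight_fil_def by (intro vec.span_scale vec.span_base)
    then show ?thesis using c0 by (simp add: vector_smult_assoc)
  qed
  then have "(\<Sum>i\<in>UNIV. m $ i *s axis i 1) \<in> weight_fil k"
    unfolding weight_fil_def by (intro vec.span_sum) auto
  then show "m \<in> weight_fil k" by (simp only: basis_expansion)
qed

lemma weight_fil_UNIV [simp]: "k \<ge> 0 \<Longrightarrow> weight_fil k = UNIV"
  by (auto simp: weight_fil_iff)

lemma weight_fil_zero: "k < -2 \<Longrightarrow> weight_fil k = {0}"
  by (auto simp: weight_fil_iff intro: mix_eqI)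

lemma subspace_weight_fil: "vec.subspace (weight_fil k)"
  by (simp add: weight_fil_def)

lemma weight_fil_mono: "k \<le> l \<Longrightarrow> m \<in> weight_fil k \<Longrightarrow> m \<in> weight_fil l"
  by (auto simp: weight_fil_iff)

lemma cnj_vec_simps [simp]:
  "cnj_vec (cnj_vec x) = x" "cnj_vec (x + y) = cnj_vec x + cnj_vec y" "cnj_vec (x - y) = cnj_vec x - cnj_vec y"
  "cnj_vec (c *s x) = cnj c *s cnj_vec x" "up (cnj_vec z) = cnj_vec (up z)" "lo (cnj_vec z) = cnj_vec (lo z)"
  "cnj_vec x = 0 \<longleftrightarrow> x = 0" "cnj_vec 0 = 0"
  by (simp_all add: cnj_vec_def up_def lo_def vec_eq_iff)

lemma conjM_simps [simp]:
  "conjM (conjM m) = m" "conjM m $ E0 = - cnj (m $ E0)" "mid (conjM m) = cnj_vec (mid m)"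
  "conjM m $ E1 = cnj (m $ E1)" "conjM (m + m') = conjM m + conjM m'" "conjM 0 = 0"
  by (simp_all add: conjM_def mid_def cnj_vec_def vec_eq_iff)

lemma conjM_image_iff: "m \<in> conjM ` S \<longleftrightarrow> conjM m \<in> S"
  by (auto intro: image_eqI[of _ conjM "conjM m"])

lemma conjM_weight_fil [simp]: "conjM m \<in> weight_fil k \<longleftrightarrow> m \<in> weight_fil k"
  by (simp add: weight_fil_iff)

lemma gr_fil_iff: "m \<in> gr_fil F p k \<longleftrightarrow> (\<exists>a\<in>F p. a \<in> weight_fil k \<and> m - a \<in> weight_fil (k - 1))"
proof
  assume "m \<in> gr_fil F p k"
  then show "\<exists>a\<in>F p. a \<in> weight_fil k \<and> m - a \<in> weight_fil (k - 1)"
    unfolding gr_fil_def by force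
next
  assume "\<exists>a\<in>F p. a \<in> weight_fil k \<and> m - a \<in> weight_fil (k - 1)"
  then obtain a where "a \<in> F p \<inter> weight_fil k" "m - a \<in> weight_fil (k - 1)" by auto
  moreover have "m = a + (m - a)" by simp
  ultimately show "m \<in> gr_fil F p k" unfolding gr_fil_def by blast
qed

section \<open>The alternating form and its Hermitian companion\<close>

lemma Psi_eq: "Psi x y = 2 * of_real pi * \<i> * (dotc (lo x) (up y) - dotc (up x) (lo y))"
proof -
  have "up (Jmat *v y) = - lo y" "lo (Jmat *v y) = up y"
    by (simp_all add: vec_eq_iff up_def lo_def Jmat_def matrix_vector_mult_def sum_UNIV_Plus
      if_distrib[of "\<lambda>x. x * _"] cong: if_cong)
  then show ?thesis by (simp add: Psi_def dotc_Plus[of x] dotc_minus)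
qed

lemma dotc_scale: "dotc (c *s x) y = c * dotc x y" "dotc x (c *s y) = c * dotc x y"
  by (simp_all add: dotc_def sum_distrib_left algebra_simps)

lemma dotc_cnj: "cnj (dotc x y) = dotc (cnj_vec x) (cnj_vec y)"
  by (simp add: dotc_def cnj_vec_def)

text \<open>Conjugation negates the factor 2\<pi>i and the exchange of arguments negates the
  alternating form; the two signs cancel, and the sign (-1)^p is real.\<close>

lemma Psi_hermitian: "(-1) powi p * Psi y (cnj_vec x) = cnj ((-1) powi p * Psi x (cnj_vec y))"
  by (simp add: Psi_eq dotc_cnj dotc_commute[of "lo y"] dotc_commute[of "up y"] algebra_simps
      power_int_def)

lemma Psi_integral: "x \<in> int_vecs \<Longrightarrow> y \<in> int_vecs \<Longrightarrow> Psi x y \<in> Z1"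
  unfolding Z1_iff Psi_eq
  by (auto simp: dotc_def up_def lo_def int_vecs_def intro!: Ints_diff Ints_sum Ints_mult)

section \<open>The filtrations given by coordinates\<close>

definition im_cmat :: "complex ^ 'd ^ ('d::finite) \<Rightarrow> complex ^ 'd ^ 'd" where
  "im_cmat \<tau> = (\<chi> i j. of_real (Im (\<tau> $ i $ j)))"

definition cnj_mat :: "complex ^ 'd ^ ('d::finite) \<Rightarrow> complex ^ 'd ^ 'd" where
  "cnj_mat \<tau> = (\<chi> i j. cnj (\<tau> $ i $ j))"

lemma cnj_mat_vec: "cnj_vec (A *v x) = cnj_mat A *v cnj_vec x"
  by (simp add: vec_eq_iff cnj_vec_def cnj_mat_def matrix_vector_mult_def)

lemma cnj_mat_cnj [simp]: "cnj_mat (cnj_mat A) = A"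
  by (simp add: cnj_mat_def vec_eq_iff)

lemma mat_diff_cnj: "\<tau> *v x - cnj_mat \<tau> *v x = (2 * \<i>) *s (im_cmat \<tau> *v x)"
  by (simp add: vec_eq_iff matrix_vector_mult_def im_cmat_def cnj_mat_def sum_distrib_left
      flip: sum_subtractf left_diff_distrib) (simp add: complex_eq_iff mult.assoc)

lemma dotc_symmetric: "transpose \<tau> = \<tau> \<Longrightarrow> dotc (\<tau> *v x) y = dotc x (\<tau> *v y)"
  using dotc_vector_matrix[of x \<tau> y] transpose_matrix_vector[of \<tau> x] by simp

lemma siegel_symmetric: "\<tau> \<in> siegel \<Longrightarrow> transpose \<tau> = \<tau>"
  by (simp add: siegel_def)

text \<open>Im \<tau> is real and invertible, so the equation is solved separately for real and
  imaginary parts.\<close>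

lemma im_cmat_surj:
  assumes "\<tau> \<in> siegel" obtains x where "im_cmat \<tau> *v x = c"
proof -
  have "invertible (im_mat \<tau>)" using det_im_mat_nonzero[OF assms] invertible_det_nz by blast
  then obtain B where B: "im_mat \<tau> ** B = mat 1" unfolding invertible_def by blast
  have s: "im_mat \<tau> *v (B *v y) = y" for y by (simp add: matrix_vector_mul_assoc B)
  define x where "x = (\<chi> i. Complex ((B *v (\<chi> j. Re (c $ j))) $ i) ((B *v (\<chi> j. Im (c $ j))) $ i))"
  have "im_cmat \<tau> *v x = c"
  proof (rule vec_eq_iff[THEN iffD2], rule allI)
    fix i
    have "Re ((im_cmat \<tau> *v x) $ i) = (im_mat \<tau> *v (B *v (\<chi> j. Re (c $ j)))) $ i"
      "Im ((im_cmat \<tau> *v x) $ i) = (im_mat \<tau> *v (B *v (\<chi> j. Im (c $ j)))) $ i"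
      unfolding matrix_vector_mult_def[of "im_cmat \<tau>"] matrix_vector_mult_def[of "im_mat \<tau>"]
      by (simp_all add: im_cmat_def im_mat_def x_def)
    then show "(im_cmat \<tau> *v x) $ i = c $ i" by (simp add: s complex_eq_iff)
  qed
  then show ?thesis using that by blast
qed

text \<open>For x = r + is the Hermitian form is the sum of the real forms at r and s, the mixed
  terms cancelling by symmetry of Im \<tau>; and r or s is nonzero.\<close>

lemma im_cmat_positive:
  assumes "\<tau> \<in> siegel" "x \<noteq> 0"
  shows "dotc (im_cmat \<tau> *v x) (cnj_vec x) \<in> \<real>" "0 < Re (dotc (im_cmat \<tau> *v x) (cnj_vec x))"
proof -
  let ?r = "\<chi> i. Re (x $ i)" and ?s = "\<chi> i. Im (x $ i)"
  have Re: "Re (dotc (im_cmat \<tau> *v x) (cnj_vec x)) = ?r \<bullet> (im_mat \<tau> *v ?r) + ?s \<bullet> (im_mat \<tau> *v ?s)"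
    by (simp add: dotc_def inner_vec_def im_cmat_def im_mat_def matrix_vector_mult_def cnj_vec_def
        sum.distrib algebra_simps)
  have "Im (dotc (im_cmat \<tau> *v x) (cnj_vec x)) = ?r \<bullet> (im_mat \<tau> *v ?s) - ?s \<bullet> (im_mat \<tau> *v ?r)"
    by (simp add: dotc_def inner_vec_def im_cmat_def im_mat_def matrix_vector_mult_def cnj_vec_def
        sum_subtractf sum.distrib algebra_simps)
  also have "?r \<bullet> (im_mat \<tau> *v ?s) = ?s \<bullet> (im_mat \<tau> *v ?r)"
  proof -
    have "transpose (im_mat \<tau>) = im_mat \<tau>"
      using siegelD(1)[OF assms(1)] by (simp add: transpose_def im_mat_def vec_eq_iff)
    then have "?r v* im_mat \<tau> = im_mat \<tau> *v ?r"
      using transpose_matrix_vector[of "im_mat \<tau>" ?r] by simp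
    then show ?thesis by (simp add: dot_lmul_matrix[symmetric] inner_commute)
  qed
  finally have "Im (dotc (im_cmat \<tau> *v x) (cnj_vec x)) = 0" by simp
  then show "dotc (im_cmat \<tau> *v x) (cnj_vec x) \<in> \<real>" by (simp add: complex_is_Real_iff)
  have nn: "0 \<le> y \<bullet> (im_mat \<tau> *v y)" for y
    using siegelD(2)[OF assms(1), of y] by (cases "y = 0") auto
  have "?r \<noteq> 0 \<or> ?s \<noteq> 0" using assms(2) by (auto simp: vec_eq_iff complex_eq_iff)
  then have "0 < ?r \<bullet> (im_mat \<tau> *v ?r) \<or> 0 < ?s \<bullet> (im_mat \<tau> *v ?s)"
    using siegelD(2)[OF assms(1)] by blast
  then show "0 < Re (dotc (im_cmat \<tau> *v x) (cnj_vec x))"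
    unfolding Re using nn[of ?r] nn[of ?s] by linarith
qed

lemma im_cmat_inj: "\<tau> \<in> siegel \<Longrightarrow> im_cmat \<tau> *v x = 0 \<Longrightarrow> x = 0"
  using im_cmat_positive(2)[of \<tau> x] by force

lemma F0_mat_mult:
  "F0_mat (\<tau>, u, v, w) *v x =
    (let a = (\<chi> i. x $ Inl i); b = x $ Inr () in
       mix_vec (dotc u a + w * b) (pair_vec (\<tau> *v a + b *s v) a) b)"
  unfolding Let_def
proof (rule mix_eqI; (rule up_lo_eqI)?)
  note defs = UNIV_unit F0_mat_def matrix_vector_mult_def dotc_def sum_UNIV_Plus mid_def up_def lo_def pair_vec_def vec_eq_iff
  let ?m = "F0_mat (\<tau>, u, v, w) *v x" and ?a = "\<chi> i. x $ Inl i" and ?b = "x $ Inr ()"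
  let ?m' = "mix_vec (dotc u ?a + w * ?b) (pair_vec (\<tau> *v ?a + ?b *s v) ?a) ?b"
  show "?m $ E0 = ?m' $ E0" by (simp add: defs)
  show "up (mid ?m) = up (mid ?m')" by (simp add: defs)
  show "lo (mid ?m) = lo (mid ?m')" by (simp add: defs if_distrib[of "\<lambda>x. x * _"] cong: if_cong)
  show "?m $ E1 = ?m' $ E1" by (simp add: defs)
qed

text \<open>The rows of \<open>F0_mat\<close> with the blocks 1_d and 1 return the coefficients of
  the column combination. So the range is a graph over \<open>lo (mid m)\<close> and
  \<open>m $ E1\<close>, and two equations describe it.\<close>

lemma F0_range:
  "m \<in> range ((*v) (F0_mat (\<tau>, u, v, w))) \<longleftrightarrow>
     m $ E0 = dotc u (lo (mid m)) + w * m $ E1 \<and> up (mid m) = \<tau> *v lo (mid m) + m $ E1 *s v"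
  (is "_ \<longleftrightarrow> ?P m")
proof
  assume "m \<in> range ((*v) (F0_mat (\<tau>, u, v, w)))"
  then show "?P m" by (auto simp: F0_mat_mult Let_def)
next
  assume P: "?P m"
  let ?x = "\<chi> j. case j of Inl b \<Rightarrow> lo (mid m) $ b | Inr _ \<Rightarrow> m $ E1"
  have "F0_mat (\<tau>, u, v, w) *v ?x = m"
    unfolding F0_mat_mult Let_def
    by (rule mix_eqI; (rule up_lo_eqI)?) (use P in simp_all)
  then show "m \<in> range ((*v) (F0_mat (\<tau>, u, v, w)))" by (metis rangeI)
qed

lemma hodge_fil_simps:
  "p < 0 \<Longrightarrow> hodge_fil c p = UNIV" "p > 0 \<Longrightarrow> hodge_fil c p = {0}"
  "hodge_fil c 0 = range ((*v) (F0_mat c))"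
  by (simp_all add: hodge_fil_def)

text \<open>A graph determines its defining map: its values at unit vectors recover u and the
  columns of \<tau>, and its value at the last basis vector recovers v and w.\<close>

lemma inj_hodge_fil: "inj hodge_fil"
proof (rule injI)
  fix c c' :: "'a coords" assume eq: "hodge_fil c = hodge_fil c'"
  obtain \<tau> u v w \<tau>' u' v' w' where c: "c = (\<tau>, u, v, w)" "c' = (\<tau>', u', v', w')" by (cases c, cases c')
  have eq: "range ((*v) (F0_mat c)) = range ((*v) (F0_mat c'))"
    using fun_cong[OF eq, of 0] by (simp add: hodge_fil_simps)
  have 1: "dotc u a + w * b = dotc u' a + w' * b \<and> \<tau> *v a + b *s v = \<tau>' *v a + b *s v'" for a b
  proof -
    let ?m = "mix_vec (dotc u a + w * b) (pair_vec (\<tau> *v a + b *s v) a) b"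
    have "?m \<in> range ((*v) (F0_mat c))" unfolding c F0_range by simp
    then have "?m \<in> range ((*v) (F0_mat c'))" unfolding eq .
    then show ?thesis unfolding c F0_range by simp
  qed
  have "w = w'" "v = v'" using 1[of 0 1] by simp_all
  moreover have "u $ i = u' $ i" for i
    using 1[of "axis i 1" 0] by (simp add: dotc_def axis_def if_distrib cong: if_cong)
  moreover have "\<tau> $ i $ j = \<tau>' $ i $ j" for i j
    using 1[of "axis j 1" 0]
    by (simp add: matrix_vector_mult_def axis_def vec_eq_iff if_distrib cong: if_cong)
  ultimately show "c = c'" by (simp add: c vec_eq_iff)
qed

text \<open>\<open>F 0\<close> maps onto \<open>Gr_0\<close> by its last column, cuts out the graph
  of \<tau> in \<open>Gr_{-1}\<close>, and meets \<open>W_{-2}\<close> only in 0. The coordinates u,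
  v, w disappear from the graded pieces: they describe only the extension data.\<close>

lemma gr_fil_hodge_fil:
  "m \<in> gr_fil (hodge_fil (\<tau>, u, v, w)) p k \<longleftrightarrow> m \<in> weight_fil k \<and>
     (k = 0 \<longrightarrow> p > 0 \<longrightarrow> m $ E1 = 0) \<and>
     (k = -1 \<longrightarrow> (p = 0 \<longrightarrow> up (mid m) = \<tau> *v lo (mid m)) \<and> (p > 0 \<longrightarrow> mid m = 0)) \<and>
     (k = -2 \<longrightarrow> p \<ge> 0 \<longrightarrow> m $ E0 = 0)" (is "_ \<longleftrightarrow> ?P")
proof -
  let ?F = "hodge_fil (\<tau>, u, v, w)"
  consider "p < 0" | "p > 0" | "p = 0" by linarith
  then show ?thesis
  proof cases
    case 1
    have "m \<in> gr_fil ?F p k \<longleftrightarrow> m \<in> weight_fil k"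
      unfolding gr_fil_iff hodge_fil_simps(1)[OF 1]
    proof
      assume "\<exists>a\<in>UNIV. a \<in> weight_fil k \<and> m - a \<in> weight_fil (k - 1)"
      then obtain a where "a \<in> weight_fil k" "m - a \<in> weight_fil (k - 1)" by auto
      then have "a + (m - a) \<in> weight_fil k"
        by (intro vec.subspace_add[OF subspace_weight_fil]) (auto intro: weight_fil_mono[of "k - 1"])
      then show "m \<in> weight_fil k" by simp
    next
      assume "m \<in> weight_fil k"
      then show "\<exists>a\<in>UNIV. a \<in> weight_fil k \<and> m - a \<in> weight_fil (k - 1)"
        by (intro bexI[of _ m]) (auto simp: weight_fil_iff)
    qed
    then show ?thesis using 1 by auto
  next
    case 2
    have "m \<in> gr_fil ?F p k \<longleftrightarrow> m \<in> weight_fil (k - 1)"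
      unfolding gr_fil_iff hodge_fil_simps(2)[OF 2] by (simp add: weight_fil_iff)
    also have "\<dots> \<longleftrightarrow> ?P" using 2 by (auto simp: weight_fil_iff)
    finally show ?thesis .
  next
    case 3
    show ?thesis unfolding gr_fil_iff 3 hodge_fil_simps(3)
    proof
      assume "\<exists>a\<in>range ((*v) (F0_mat (\<tau>, u, v, w))). a \<in> weight_fil k \<and> m - a \<in> weight_fil (k - 1)"
      then obtain a where a: "a \<in> range ((*v) (F0_mat (\<tau>, u, v, w)))"
        and w: "a \<in> weight_fil k" "m - a \<in> weight_fil (k - 1)"
        by blast
      show "m \<in> weight_fil k \<and> (k = 0 \<longrightarrow> 0 < (0::int) \<longrightarrow> m $ E1 = 0) \<and>
        (k = -1 \<longrightarrow> ((0::int) = 0 \<longrightarrow> up (mid m) = \<tau> *v lo (mid m)) \<and> (0 < (0::int) \<longrightarrow> mid m = 0)) \<and>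
        (k = -2 \<longrightarrow> 0 \<le> (0::int) \<longrightarrow> m $ E0 = 0)"
        using a w unfolding F0_range by (auto simp: weight_fil_iff)
    next
      assume m: "m \<in> weight_fil k \<and> (k = 0 \<longrightarrow> 0 < (0::int) \<longrightarrow> m $ E1 = 0) \<and>
        (k = -1 \<longrightarrow> ((0::int) = 0 \<longrightarrow> up (mid m) = \<tau> *v lo (mid m)) \<and> (0 < (0::int) \<longrightarrow> mid m = 0)) \<and>
        (k = -2 \<longrightarrow> 0 \<le> (0::int) \<longrightarrow> m $ E0 = 0)"
      \<comment> \<open>A lift of the class of m to \<open>F 0\<close>: for k = 0 a multiple of the
        last column of \<open>F0_mat\<close>, for k = -1 the vector m with its \<open>E0\<close>
        entry replaced by the one that membership in \<open>F 0\<close> dictates, which changes it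
        only by an element of \<open>W_{-2}\<close>. For other k the class is zero.\<close>
      define a where "a = (if k = 0 then mix_vec (w * m $ E1) (pair_vec (m $ E1 *s v) 0) (m $ E1)
        else if k = -1 then mix_vec (dotc u (lo (mid m))) (mid m) 0 else 0)"
      have "a \<in> range ((*v) (F0_mat (\<tau>, u, v, w)))"
        unfolding F0_range a_def using m by auto
      moreover have "a \<in> weight_fil k" "m - a \<in> weight_fil (k - 1)"
        using m by (auto simp: weight_fil_iff a_def)
      ultimately show "\<exists>a\<in>range ((*v) (F0_mat (\<tau>, u, v, w))). a \<in> weight_fil k \<and> m - a \<in> weight_fil (k - 1)"
        by blast
    qed
  qed
qed

lemma cnj_tau_eq: "cnj_vec x = \<tau> *v cnj_vec y \<longleftrightarrow> x = cnj_mat \<tau> *v y"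
  by (metis cnj_mat_vec cnj_mat_cnj cnj_vec_simps(1))

lemma conj_gr_fil_hodge_fil:
  "m \<in> conjM ` gr_fil (hodge_fil (\<tau>, u, v, w)) p k \<longleftrightarrow> m \<in> weight_fil k \<and>
     (k = 0 \<longrightarrow> p > 0 \<longrightarrow> m $ E1 = 0) \<and>
     (k = -1 \<longrightarrow> (p = 0 \<longrightarrow> up (mid m) = cnj_mat \<tau> *v lo (mid m)) \<and> (p > 0 \<longrightarrow> mid m = 0)) \<and>
     (k = -2 \<longrightarrow> p \<ge> 0 \<longrightarrow> m $ E0 = 0)"
  unfolding conjM_image_iff gr_fil_hodge_fil by (simp add: cnj_tau_eq)

lemma mixed_hodge_structure_hodge_fil:
  fixes \<tau> :: "complex ^ 'd ^ ('d::finite)"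
  assumes \<tau>: "\<tau> \<in> siegel"
  shows "mixed_hodge_structure (hodge_fil (\<tau>, u, v, w))"
proof -
  let ?F = "hodge_fil (\<tau>, u, v, w)"
  have sub: "vec.subspace (?F p)" for p
  proof -
    have "vec.subspace (range ((*v) (F0_mat (\<tau>, u, v, w))))"
      by (intro vec.subspace_image vec.subspace_UNIV matrix_vector_mul_linear_gen)
    then show ?thesis by (auto simp: hodge_fil_def vec.subspace_def)
  qed
  have anti: "antimono ?F"
  proof (rule antimonoI)
    fix p q :: int assume "p \<le> q"
    then show "?F q \<le> ?F p"
      using vec.subspace_0[OF sub[of 0]] by (auto simp: hodge_fil_def split: if_splits)
  qed
  have opp: "{a + b |a b. a \<in> gr_fil ?F p k \<and> b \<in> conjM ` gr_fil ?F (k + 1 - p) k} = weight_fil k \<and>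
      gr_fil ?F p k \<inter> conjM ` gr_fil ?F (k + 1 - p) k = weight_fil (k - 1)" (is "?A \<and> ?B") for k p
  proof
    show ?A
    proof (intro equalityI subsetI)
      fix m :: "complex ^ 'd mix" assume "m \<in> {a + b |a b. a \<in> gr_fil ?F p k \<and> b \<in> conjM ` gr_fil ?F (k + 1 - p) k}"
      then obtain a b where ab: "m = a + b" "a \<in> gr_fil ?F p k" "b \<in> conjM ` gr_fil ?F (k + 1 - p) k"
        by blast
      show "m \<in> weight_fil k"
        unfolding ab(1) using ab(2,3) unfolding gr_fil_hodge_fil conj_gr_fil_hodge_fil
        by (intro vec.subspace_add[OF subspace_weight_fil]) blast+
    next
      fix m :: "complex ^ 'd mix" assume m: "m \<in> weight_fil k"
      have "\<exists>a b. m = a + b \<and> a \<in> gr_fil ?F p k \<and> b \<in> conjM ` gr_fil ?F (k + 1 - p) k"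
      \<comment> \<open>Only for k = -1 and p = 0 do both summands matter; for all other indices one
        of them is already the whole of \<open>W_k\<close>.\<close>
      proof (cases "k = -1 \<and> p = 0")
        case False
        have "m \<in> gr_fil ?F p k \<or> m \<in> conjM ` gr_fil ?F (k + 1 - p) k"
          unfolding gr_fil_hodge_fil conj_gr_fil_hodge_fil using m False by (auto simp: weight_fil_iff)
        moreover have "0 \<in> gr_fil ?F p k" "0 \<in> conjM ` gr_fil ?F (k + 1 - p) k"
          unfolding gr_fil_hodge_fil conj_gr_fil_hodge_fil
          by (auto simp: weight_fil_iff)
        ultimately show ?thesis by (metis add.left_neutral add.right_neutral)
      next
        case True
        \<comment> \<open>The decomposition m = (\<tau>x, x) + remainder has its remainder on the
          conjugate graph exactly when (\<tau> - conj \<tau>)x is the defect of m. As \<tau> - conj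
          \<tau> = 2i Im \<tau>, this can be solved for x.\<close>
        obtain x where x: "im_cmat \<tau> *v x = (1 / (2 * \<i>)) *s (up (mid m) - cnj_mat \<tau> *v lo (mid m))"
          using im_cmat_surj[OF \<tau>] by blast
        let ?a = "mix_vec 0 (pair_vec (\<tau> *v x) x) 0"
        have "\<tau> *v x - cnj_mat \<tau> *v x = up (mid m) - cnj_mat \<tau> *v lo (mid m)"
          unfolding mat_diff_cnj x by (simp add: vector_smult_assoc)
        then have "up (mid (m - ?a)) = cnj_mat \<tau> *v lo (mid (m - ?a))"
          by (simp add: matrix_vector_mult_diff_distrib algebra_simps)
        then have "m = ?a + (m - ?a) \<and> ?a \<in> gr_fil ?F p k \<and> m - ?a \<in> conjM ` gr_fil ?F (k + 1 - p) k"
          unfolding gr_fil_hodge_fil conj_gr_fil_hodge_fil using True m by (simp add: weight_fil_iff)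
        then show ?thesis by blast
      qed
      then show "m \<in> {a + b |a b. a \<in> gr_fil ?F p k \<and> b \<in> conjM ` gr_fil ?F (k + 1 - p) k}" by blast
    qed
    show ?B
    proof (intro equalityI subsetI)
      fix m :: "complex ^ 'd mix" assume m: "m \<in> gr_fil ?F p k \<inter> conjM ` gr_fil ?F (k + 1 - p) k"
      have "mid m = 0" if "k = -1" "p = 0"
      proof -
        have e: "up (mid m) = \<tau> *v lo (mid m)" "up (mid m) = cnj_mat \<tau> *v lo (mid m)"
          using m that unfolding Int_iff gr_fil_hodge_fil conj_gr_fil_hodge_fil by (elim conjE; simp)+
        then have "(2 * \<i>) *s (im_cmat \<tau> *v lo (mid m)) = 0" unfolding mat_diff_cnj[symmetric] by simp
        then have "im_cmat \<tau> *v lo (mid m) = 0" by (simp add: vec_eq_iff)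
        then have "lo (mid m) = 0" by (rule im_cmat_inj[OF \<tau>])
        then show "mid m = 0" using e(1) by (intro up_lo_eqI) simp_all
      qed
      then show "m \<in> weight_fil (k - 1)"
        using m unfolding Int_iff gr_fil_hodge_fil conj_gr_fil_hodge_fil
        by (cases "p > 0"; cases "p = 0") (auto simp: weight_fil_iff)
    next
      fix m :: "complex ^ 'd mix" assume "m \<in> weight_fil (k - 1)"
      then show "m \<in> gr_fil ?F p k \<inter> conjM ` gr_fil ?F (k + 1 - p) k"
        unfolding Int_iff gr_fil_hodge_fil conj_gr_fil_hodge_fil by (auto simp: weight_fil_iff)
    qed
  qed
  have "?F (-1) = UNIV" "?F 1 = {0}" by (simp_all add: hodge_fil_simps)
  then show ?thesis unfolding mixed_hodge_structure_def using sub anti opp by blast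
qed

text \<open>Outside the four types, either the graded piece of weight p + q is zero, or one of
  \<open>F p\<close> and the conjugate of \<open>F q\<close> induces zero on it.\<close>

lemma hodge_types_hodge_fil:
  "hodge_types (hodge_fil (\<tau>, u, v, w)) \<subseteq> {(-1, -1), (-1, 0), (0, -1), (0, 0)}"
proof -
  have "hodge_piece (hodge_fil (\<tau>, u, v, w)) p q = weight_fil (p + q - 1)"
    if "(p, q) \<notin> {(-1, -1), (-1, 0), (0, -1), (0, 0)}" for p q
  proof (rule Set.set_eqI)
    fix m
    let ?k = "p + q"
    have "p \<noteq> -1 \<or> q \<noteq> -1" "p \<noteq> -1 \<or> q \<noteq> 0" "p \<noteq> 0 \<or> q \<noteq> -1" "p \<noteq> 0 \<or> q \<noteq> 0"
      using that by auto
    then have "?k > 0 \<or> ?k = 0 \<and> (p > 0 \<or> q > 0) \<or> ?k = -1 \<and> (p > 0 \<or> q > 0) \<or>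
        ?k = -2 \<and> (p \<ge> 0 \<or> q \<ge> 0) \<or> ?k < -2"
      by presburger
    then consider "?k > 0" | "?k = 0" "p > 0" | "?k = 0" "q > 0" | "?k = -1" "p > 0" | "?k = -1" "q > 0"
      | "?k = -2" "p \<ge> 0" | "?k = -2" "q \<ge> 0" | "?k < -2"
      by blast
    then show "m \<in> hodge_piece (hodge_fil (\<tau>, u, v, w)) p q \<longleftrightarrow> m \<in> weight_fil (?k - 1)"
      unfolding hodge_piece_def Int_iff gr_fil_hodge_fil conj_gr_fil_hodge_fil weight_fil_iff
      by cases auto
  qed
  then show ?thesis unfolding hodge_types_def by blast
qed

lemma mid_piece_hodge_fil:
  assumes "p + q = -1"
  shows "x \<in> mid_piece (hodge_fil (\<tau>, u, v, w)) p q \<longleftrightarrow>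
    (p = 0 \<longrightarrow> up x = \<tau> *v lo x) \<and> (p > 0 \<longrightarrow> x = 0) \<and>
    (q = 0 \<longrightarrow> up x = cnj_mat \<tau> *v lo x) \<and> (q > 0 \<longrightarrow> x = 0)" (is "_ \<longleftrightarrow> ?P x")
proof
  assume "x \<in> mid_piece (hodge_fil (\<tau>, u, v, w)) p q"
  then obtain m where m: "x = mid m" "m \<in> hodge_piece (hodge_fil (\<tau>, u, v, w)) p q"
    unfolding mid_piece_def mid_def by blast
  show "?P x"
    using m(2) unfolding m(1) hodge_piece_def assms Int_iff gr_fil_hodge_fil conj_gr_fil_hodge_fil
    by simp
next
  assume "?P x"
  then have "mix_vec 0 x 0 \<in> hodge_piece (hodge_fil (\<tau>, u, v, w)) p q"
    by (simp add: hodge_piece_def assms gr_fil_hodge_fil conj_gr_fil_hodge_fil weight_fil_iff)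
  then have "mid (mix_vec 0 x 0) \<in> mid_piece (hodge_fil (\<tau>, u, v, w)) p q"
    unfolding mid_piece_def mid_def by (rule imageI)
  then show "x \<in> mid_piece (hodge_fil (\<tau>, u, v, w)) p q" by simp
qed

lemma cnj_mat_dotc_symmetric: "transpose \<tau> = \<tau> \<Longrightarrow> dotc (cnj_mat \<tau> *v x) y = dotc x (cnj_mat \<tau> *v y)"
  using arg_cong[OF dotc_symmetric[of \<tau> "cnj_vec x" "cnj_vec y"], of cnj] by (simp add: dotc_cnj cnj_mat_vec)

text \<open>On the graph, symmetry of \<tau> moves both occurrences of \<tau> to one side, leaving
  -(\<tau> - conj \<tau>) = -2i Im \<tau>; the constant is 2\<pi>i times -2i.\<close>

lemma Psi_graph:
  assumes \<tau>: "transpose \<tau> = \<tau>" and x: "up x = \<tau> *v lo x"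
  shows "Psi x (cnj_vec x) = 4 * of_real pi * dotc (im_cmat \<tau> *v lo x) (cnj_vec (lo x))"
proof -
  have "Psi x (cnj_vec x) = 2 * of_real pi * \<i> * - dotc (\<tau> *v lo x - cnj_mat \<tau> *v lo x) (cnj_vec (lo x))"
    by (simp add: Psi_eq x cnj_mat_vec cnj_mat_dotc_symmetric[OF \<tau>, symmetric] dotc_diff)
  then show ?thesis unfolding mat_diff_cnj by (simp add: dotc_scale)
qed

lemma Psi_antisym: "Psi x y = - Psi y x"
  by (simp add: Psi_eq dotc_commute[of "lo x"] dotc_commute[of "up x"] algebra_simps)

lemma Psi_linear [simp]:
  "Psi (x + y) z = Psi x z + Psi y z" "Psi z (x + y) = Psi z x + Psi z y" "Psi (c *s x) z = c * Psi x z"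
  "Psi 0 z = 0" "Psi z 0 = 0"
  by (simp_all add: Psi_eq dotc_add dotc_scale algebra_simps)

lemma Psi_polarises_hodge_fil:
  assumes \<tau>: "\<tau> \<in> siegel"
  shows "Psi_polarises (hodge_fil (\<tau>, u, v, w))"
  unfolding Psi_polarises_def
proof (intro conjI ballI allI impI)
  let ?F = "hodge_fil (\<tau>, u, v, w)"
  show "Psi x y \<in> Z1" if "x \<in> int_vecs" "y \<in> int_vecs" for x y :: "complex ^ ('a + 'a)"
    using that by (rule Psi_integral)
  fix p q p' q' :: int and x y
  assume pq: "p + q = -1" "p' + q' = -1" "(p + p', q + q') \<noteq> (-1, -1)"
    and x: "x \<in> mid_piece ?F p q" and y: "y \<in> mid_piece ?F p' q'"
  show "Psi x y = 0"
  proof (cases "x = 0 \<or> y = 0")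
    case False
    \<comment> \<open>Only the pieces (0, -1) and (-1, 0) are nonzero, so two pieces whose types do
      not add up to (-1, -1) are the same piece. It is the graph of a symmetric matrix, hence
      isotropic.\<close>
    have "p = 0 \<and> q = -1 \<and> p' = 0 \<and> q' = -1 \<or> p = -1 \<and> q = 0 \<and> p' = -1 \<and> q' = 0"
      using x y False pq unfolding mid_piece_hodge_fil[OF pq(1)] mid_piece_hodge_fil[OF pq(2)]
      by auto
    then show ?thesis
      using x y unfolding mid_piece_hodge_fil[OF pq(1)] mid_piece_hodge_fil[OF pq(2)]
      by (auto simp: Psi_eq dotc_symmetric[OF siegel_symmetric[OF \<tau>]]
          cnj_mat_dotc_symmetric[OF siegel_symmetric[OF \<tau>]])
  qed auto
next
  let ?F = "hodge_fil (\<tau>, u, v, w)"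
  fix p q :: int assume pq: "p + q = -1"
  show "complex_inner_product_on (mid_piece ?F p q) (\<lambda>x y. (-1) powi p * Psi x (cnj_vec y))"
    unfolding complex_inner_product_on_def
  proof (intro conjI ballI allI impI Psi_hermitian)
    fix x assume x: "x \<in> mid_piece ?F p q" "x \<noteq> 0"
    then have "p = 0 \<and> q = -1 \<or> p = -1 \<and> q = 0"
      using pq unfolding mid_piece_hodge_fil[OF pq] by auto
    \<comment> \<open>Conjugation carries the piece (-1, 0) to the graph of \<tau>; the sign (-1)^p
      with p = -1 cancels the sign from exchanging the arguments. So one computation on the graph
      serves both pieces.\<close>
    then obtain y where y: "y \<noteq> 0" "up y = \<tau> *v lo y" "(-1) powi p * Psi x (cnj_vec x) = Psi y (cnj_vec y)"
    proof (elim disjE conjE)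
      assume "p = 0" "q = -1"
      then show ?thesis using that[of x] x unfolding mid_piece_hodge_fil[OF pq] by simp
    next
      assume p: "p = -1" "q = 0"
      have "cnj_vec (up x) = \<tau> *v cnj_vec (lo x)" unfolding cnj_tau_eq
        using x p unfolding mid_piece_hodge_fil[OF pq] by simp
      moreover have "- Psi x (cnj_vec x) = Psi (cnj_vec x) x"
        using Psi_antisym[of x "cnj_vec x"] by simp
      ultimately show ?thesis using that[of "cnj_vec x"] x p by simp
    qed
    have "lo y \<noteq> 0" using y(1,2) up_lo_eqI[of y 0] by auto
    then have "Psi y (cnj_vec y) \<in> \<real>" "0 < Re (Psi y (cnj_vec y))"
      unfolding Psi_graph[OF siegel_symmetric[OF \<tau>] y(2)]
      using im_cmat_positive[OF \<tau>] by (auto simp: complex_is_Real_iff)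
    then show "(-1) powi p * Psi x (cnj_vec x) \<in> \<real>" "0 < Re ((-1) powi p * Psi x (cnj_vec x))"
      unfolding y(3) .
  qed (simp_all add: algebra_simps)
qed

lemma hodge_fil_in_period_domain:
  assumes "c \<in> coord_domain" shows "hodge_fil c \<in> period_domain"
proof -
  obtain \<tau> u v w where "c = (\<tau>, u, v, w)" "\<tau> \<in> siegel" using assms by (auto simp: coord_domain_def)
  then show ?thesis
    unfolding period_domain_def using hodge_types_hodge_fil
    by (simp only: mem_Collect_eq mixed_hodge_structure_hodge_fil Psi_polarises_hodge_fil simp_thms)
qed

section \<open>Coordinates of a filtration in the period domain\<close>

lemma gr_fil_subset: "m \<in> gr_fil F p k \<Longrightarrow> m \<in> weight_fil k"
  unfolding gr_fil_iff
  by (auto simp: weight_fil_iff)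

lemma gr_fil_of_mem: "m \<in> F p \<Longrightarrow> m \<in> weight_fil k \<Longrightarrow> m \<in> gr_fil F p k"
  unfolding gr_fil_iff by (intro bexI[of _ m]) (auto simp: weight_fil_iff)

lemma gr_fil_add_weight: "m \<in> gr_fil F p k \<Longrightarrow> b \<in> weight_fil (k - 1) \<Longrightarrow> m + b \<in> gr_fil F p k"
  unfolding gr_fil_iff
  by (elim bexE conjE, rule bexI) (auto simp: weight_fil_iff)

lemma opposed:
  assumes "mixed_hodge_structure F"
  shows "m \<in> weight_fil k \<Longrightarrow> \<exists>a b. m = a + b \<and> a \<in> gr_fil F p k \<and> conjM b \<in> gr_fil F (k + 1 - p) k"
    and "m \<in> gr_fil F p k \<Longrightarrow> conjM m \<in> gr_fil F (k + 1 - p) k \<Longrightarrow> m \<in> weight_fil (k - 1)"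
proof -
  have *: "{a + b |a b. a \<in> gr_fil F p k \<and> b \<in> conjM ` gr_fil F (k + 1 - p) k} = weight_fil k"
    "gr_fil F p k \<inter> conjM ` gr_fil F (k + 1 - p) k = weight_fil (k - 1)"
    using assms unfolding mixed_hodge_structure_def by blast+
  show "\<exists>a b. m = a + b \<and> a \<in> gr_fil F p k \<and> conjM b \<in> gr_fil F (k + 1 - p) k" if "m \<in> weight_fil k"
    using that unfolding *(1)[symmetric] conjM_image_iff by blast
  show "m \<in> weight_fil (k - 1)" if "m \<in> gr_fil F p k" "conjM m \<in> gr_fil F (k + 1 - p) k"
    unfolding *(2)[symmetric] by (rule IntI[OF that(1) conjM_image_iff[THEN iffD2, OF that(2)]])
qed

text \<open>If \<open>F p\<close> contributes nothing to \<open>Gr_k\<close>, opposedness leaves the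
  conjugate of \<open>F (k + 1 - p)\<close> to fill all of it; applying this to
  \<open>conjM m\<close> removes the conjugation.\<close>

lemma gr_fil_full:
  assumes F: "mixed_hodge_structure F" and van: "gr_fil F p k \<subseteq> weight_fil (k - 1)" and m: "m \<in> weight_fil k"
  shows "m \<in> gr_fil F (k + 1 - p) k"
proof -
  obtain a b where ab: "conjM m = a + b" "a \<in> gr_fil F p k" "conjM b \<in> gr_fil F (k + 1 - p) k"
    using opposed(1)[OF F, of "conjM m" k p] m by auto
  have "conjM (conjM m) = conjM a + conjM b" unfolding ab(1) by (rule conjM_simps)
  then have "m = conjM b + conjM a" unfolding conjM_simps(1) by (simp only: add.commute)
  moreover have "conjM a \<in> weight_fil (k - 1)" unfolding conjM_weight_fil by (rule subsetD[OF van ab(2)])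
  ultimately show ?thesis using gr_fil_add_weight[OF ab(3)] by blast
qed

text \<open>Descending induction on \<open>p\<close>: once \<open>F\<^sup>p\<^sup>+\<^sup>1 Gr = 0\<close>, opposedness gives \<open>F\<^sup>k\<^sup>-\<^sup>p Gr = Gr\<close>, so that
  \<open>F\<^sup>p Gr = M\<^sup>p\<^sup>,\<^sup>k\<^sup>-\<^sup>p\<close>.\<close>

lemma gr_fil_vanish:
  assumes F: "mixed_hodge_structure F"
    and types: "\<And>p. p \<ge> P \<Longrightarrow> (p, k - p) \<notin> hodge_types F" and "p \<ge> P"
  shows "gr_fil F p k \<subseteq> weight_fil (k - 1)"
proof -
  obtain b where b: "F b = {0}" using F unfolding mixed_hodge_structure_def by blast
  have anti: "antimono F" and sub: "\<And>p. vec.subspace (F p)"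
    using F unfolding mixed_hodge_structure_def by blast+
  show ?thesis using \<open>p \<ge> P\<close>
  \<comment> \<open>Truncation by \<open>nat\<close> puts all p \<ge> b, where \<open>F p\<close> is
    zero, into the base case.\<close>
  proof (induction "nat (b - p)" arbitrary: p)
    case 0
    then have "F p \<subseteq> {0}" using antimonoD[OF anti, of b p] b by auto
    then have z: "a = 0" if "a \<in> F p" for a using that by blast
    show ?case
    proof
      fix m assume "m \<in> gr_fil F p k"
      then obtain a where "a \<in> F p" "m - a \<in> weight_fil (k - 1)" unfolding gr_fil_iff by blast
      then show "m \<in> weight_fil (k - 1)" using z[of a] by simp
    qed
  next
    case (Suc n)
    have IH: "gr_fil F (p + 1) k \<subseteq> weight_fil (k - 1)" using Suc by simp
    have piece: "hodge_piece F p (k - p) = weight_fil (k - 1)"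
      using types[OF Suc.prems] by (simp add: hodge_types_def)
    show ?case
    proof
      fix m assume m: "m \<in> gr_fil F p k"
      then have "conjM m \<in> weight_fil k" using gr_fil_subset by simp
      then have "conjM m \<in> gr_fil F (k - p) k" using gr_fil_full[OF F IH, of "conjM m"] by simp
      then show "m \<in> weight_fil (k - 1)" using m
        unfolding piece[symmetric] hodge_piece_def by (simp add: conjM_image_iff)
    qed
  qed
qed

text \<open>A real orthogonal vector z is available for any proper real subspace. As
  \<open>N\<close> is stable under multiplication by i, z is orthogonal to x and to ix, which kills
  the real and the imaginary part of the pairing of x with the conjugate of z.\<close>

lemma orthogonal_vector:
  fixes N :: "(complex ^ ('d::finite)) set"
  assumes add: "\<And>x y. x \<in> N \<Longrightarrow> y \<in> N \<Longrightarrow> x + y \<in> N" and scale: "\<And>c x. x \<in> N \<Longrightarrow> c *s x \<in> N"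
    and ne: "N \<noteq> UNIV" "N \<noteq> {}"
  obtains b where "b \<noteq> 0" "\<And>x. x \<in> N \<Longrightarrow> dotc x b = 0"
proof -
  have sc: "r *\<^sub>R x = of_real r *s x" for r and x :: "complex ^ 'd"
    by (simp add: vec_eq_iff scaleR_conv_of_real[where 'a=complex])
  obtain x0 where "x0 \<in> N" using ne(2) by blast
  then have "0 \<in> N" using scale[of x0 0] by simp
  then have sub: "subspace N" by (intro subspaceI) (simp_all only: sc add scale)
  have "span N \<subset> span UNIV" unfolding span_eq_iff[THEN iffD2, OF sub] span_UNIV using ne(1) by blast
  then obtain z where z: "z \<noteq> 0" "\<And>y. y \<in> span N \<Longrightarrow> orthogonal z y"
    by (rule orthogonal_to_subspace_exists_gen) blast
  have "dotc x (cnj_vec z) = 0" if x: "x \<in> N" for x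
  proof -
    have re: "inner z y = Re (dotc y (cnj_vec z))" for y
      by (simp add: inner_vec_def dotc_def cnj_vec_def inner_complex_def algebra_simps)
    have "inner z x = 0" "inner z (\<i> *s x) = 0"
      using z(2)[of x] z(2)[of "\<i> *s x"] x scale[OF x] by (simp_all add: orthogonal_def span_base)
    then show ?thesis unfolding re dotc_scale by (simp add: complex_eq_iff)
  qed
  moreover have "cnj_vec z \<noteq> 0" using z(1) by simp
  ultimately show ?thesis using that by blast
qed

text \<open>The types leave nothing for p \<ge> 1 on \<open>Gr_0\<close> and \<open>Gr_{-1}\<close>,
  and nothing for p \<ge> 0 on \<open>Gr_{-2}\<close>. So \<open>gr_fil_vanish\<close> removes
  \<open>F p\<close> there, and \<open>gr_fil_full\<close> makes it full for p \<le> 0 on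
  \<open>Gr_0\<close> and for p \<le> -1 on the other two.\<close>

lemma period_domain_steps:
  assumes "F \<in> period_domain"
  shows "p > 0 \<Longrightarrow> F p = {0}" "p < 0 \<Longrightarrow> F p = UNIV"
    and "\<And>m. \<exists>a\<in>F 0. m - a \<in> weight_fil (-1)"
    and "\<And>m. m \<in> F 0 \<Longrightarrow> m \<in> weight_fil (-2) \<Longrightarrow> m = 0"
    and "gr_fil F 1 (-1) \<subseteq> weight_fil (-2)"
proof -
  have F: "mixed_hodge_structure F" and T: "hodge_types F \<subseteq> {(-1, -1), (-1, 0), (0, -1), (0, 0)}"
    using assms by (auto simp: period_domain_def)
  have sub: "vec.subspace (F p)" for p using F unfolding mixed_hodge_structure_def by blast
  have v0: "gr_fil F p 0 \<subseteq> weight_fil (-1)" if "p \<ge> 1" for p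
    using gr_fil_vanish[OF F, of 1 0 p] T that by force
  have v1: "gr_fil F p (-1) \<subseteq> weight_fil (-2)" if "p \<ge> 1" for p
    using gr_fil_vanish[OF F, of 1 "-1" p] T that by force
  have v2: "gr_fil F p (-2) \<subseteq> weight_fil (-3)" if "p \<ge> 0" for p
    using gr_fil_vanish[OF F, of 0 "-2" p] T that by force
  have w3: "m = 0" if "m \<in> weight_fil (-3)" for m :: "complex ^ 'a mix"
    using that by (simp add: weight_fil_zero)
  show "gr_fil F 1 (-1) \<subseteq> weight_fil (-2)" by (rule v1) simp
  show z: "m = 0" if "m \<in> F 0" "m \<in> weight_fil (-2)" for m
    using v2[of 0] gr_fil_of_mem[of m F 0 "-2", OF that] w3 by auto
  have full0: "\<exists>a\<in>F p. m - a \<in> weight_fil (-1)" if "p \<le> 0" for p m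
    using gr_fil_full[OF F, of "1 - p" 0 m] v0[of "1 - p"] that by (auto simp: gr_fil_iff)
  have full1: "\<exists>a\<in>F p. m - a \<in> weight_fil (-2)" if "p \<le> -1" "m \<in> weight_fil (-1)" for p m
    using gr_fil_full[OF F, of "- p" "-1" m] v1[of "- p"] that by (auto simp: gr_fil_iff)
  have full2: "\<exists>a\<in>F p. m - a \<in> weight_fil (-3)" if "p \<le> -1" "m \<in> weight_fil (-2)" for p m
    using gr_fil_full[OF F, of "-1 - p" "-2" m] v2[of "-1 - p"] that by (auto simp: gr_fil_iff)
  show "\<exists>a\<in>F 0. m - a \<in> weight_fil (-1)" for m using full0[of 0] by simp
  show "F p = {0}" if "p > 0"
  proof -
    have "m = 0" if m: "m \<in> F p" for m
    proof -
      have "m \<in> weight_fil (-1)" using v0[of p] gr_fil_of_mem[of m F p 0, OF m] \<open>p > 0\<close> by auto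
      then have "m \<in> weight_fil (-2)" using v1[of p] gr_fil_of_mem[of m F p "-1", OF m] \<open>p > 0\<close> by auto
      then show ?thesis using v2[of p] gr_fil_of_mem[of m F p "-2", OF m] \<open>p > 0\<close> w3 by auto
    qed
    then show ?thesis using vec.subspace_0[OF sub[of p]] by auto
  qed
  show "F p = UNIV" if "p < 0"
  proof -
    have "m \<in> F p" for m
    proof -
      have p: "p \<le> 0" "p \<le> -1" using that by auto
      \<comment> \<open>m is corrected successively by elements of \<open>F p\<close> until the
        remainder lies in \<open>W_{-3}\<close> = 0.\<close>
      obtain a where a: "a \<in> F p" "m - a \<in> weight_fil (-1)" using full0[OF p(1)] by blast
      obtain b where b: "b \<in> F p" "m - a - b \<in> weight_fil (-2)" using full1[OF p(2) a(2)] by blast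
      obtain c where c: "c \<in> F p" "m - a - b - c \<in> weight_fil (-3)" using full2[OF p(2) b(2)] by blast
      have "m = a + b + c" using w3[OF c(2)] by (simp add: algebra_simps)
      then show "m \<in> F p" using a(1) b(1) c(1) vec.subspace_add[OF sub[of p]] by blast
    qed
    then show ?thesis by blast
  qed
qed

text \<open>The image of \<open>F\<^sup>0 \<inter> W\<^sub>-\<^sub>1\<close> in \<open>\<complex>\<^sup>2\<^sup>d\<close> is isotropic for \<open>\<Psi>\<close>, and it spans \<open>\<complex>\<^sup>2\<^sup>d\<close> together with its conjugate.
  If it did not project onto the last \<open>d\<close> coordinates, there would be \<open>b \<noteq> 0\<close> such that \<open>(b, 0) = l + conj l'\<close>
  is orthogonal to it; then \<open>\<Psi>(l', conj l') = 0\<close>, so \<open>l' = 0\<close> and \<open>(b, 0)\<close> is a null vector for the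
  polarisation.\<close>

lemma period_domain_middle:
  fixes F :: "int \<Rightarrow> (complex ^ ('d::finite) mix) set"
  assumes F: "F \<in> period_domain"
  defines "L \<equiv> mid ` (F 0 \<inter> weight_fil (-1))"
  shows "\<And>x y. x \<in> L \<Longrightarrow> y \<in> L \<Longrightarrow> Psi x y = 0"
    and "\<And>x. x \<in> L \<Longrightarrow> x \<noteq> 0 \<Longrightarrow> 0 < Re (Psi x (cnj_vec x))"
    and "\<And>x. x \<in> L \<Longrightarrow> lo x = 0 \<Longrightarrow> x = 0"
    and "\<exists>x\<in>L. lo x = a"
proof -
  have mhs: "mixed_hodge_structure F" and pol: "Psi_polarises F" using F by (auto simp: period_domain_def)
  have sub: "vec.subspace (F 0)" using mhs unfolding mixed_hodge_structure_def by blast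
  \<comment> \<open>Since \<open>F 1\<close> vanishes on \<open>Gr_{-1}\<close>,
    \<open>F (-1)\<close> is everything there, so the conjugate condition is empty and
    \<open>L\<close> lies in the piece of type (0, -1), where (-1)^p = 1.\<close>
  have full: "m \<in> gr_fil F (-1) (-1)" if "m \<in> weight_fil (-1)" for m
    using gr_fil_full[OF mhs, of 1 "-1" m] period_domain_steps(5)[OF F] that by simp
  have L_mid: "L \<subseteq> mid_piece F 0 (-1)"
  proof
    fix x assume "x \<in> L"
    then obtain m where m: "x = mid m" "m \<in> F 0" "m \<in> weight_fil (-1)" by (auto simp: L_def)
    have "m \<in> hodge_piece F 0 (-1)"
      using gr_fil_of_mem[of m F 0 "-1", OF m(2,3)] full[of "conjM m"] m(3) by (simp add: hodge_piece_def conjM_image_iff)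
    then show "x \<in> mid_piece F 0 (-1)" unfolding m(1) mid_piece_def mid_def by (rule imageI)
  qed
  show iso: "Psi x y = 0" if "x \<in> L" "y \<in> L" for x y
  proof -
    have "\<forall>p q p' q'. p + q = -1 \<longrightarrow> p' + q' = -1 \<longrightarrow> (p + p', q + q') \<noteq> (-1, -1) \<longrightarrow>
       (\<forall>x\<in>mid_piece F p q. \<forall>y\<in>mid_piece F p' q'. Psi x y = 0)"
      using pol unfolding Psi_polarises_def by blast
    then have "\<forall>x\<in>mid_piece F 0 (-1). \<forall>y\<in>mid_piece F 0 (-1). Psi x y = 0"
      by (elim allE[of _ 0] allE[of _ "-1"]) simp
    then show ?thesis using that L_mid by blast
  qed
  show pos: "0 < Re (Psi x (cnj_vec x))" if "x \<in> L" "x \<noteq> 0" for x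
  proof -
    have "\<forall>p q. p + q = -1 \<longrightarrow>
       complex_inner_product_on (mid_piece F p q) (\<lambda>x y. (-1) powi p * Psi x (cnj_vec y))"
      using pol unfolding Psi_polarises_def by blast
    then have "complex_inner_product_on (mid_piece F 0 (-1)) (\<lambda>x y. (-1) powi 0 * Psi x (cnj_vec y))"
      by (elim allE[of _ 0] allE[of _ "-1"]) simp
    then have "\<forall>x\<in>mid_piece F 0 (-1). x \<noteq> 0 \<longrightarrow> 0 < Re ((-1) powi 0 * Psi x (cnj_vec x))"
      unfolding complex_inner_product_on_def by blast
    then show ?thesis using that L_mid by auto
  qed
  \<comment> \<open>A vector with vanishing second half is null for \<Psi> paired with its
    conjugate, which positivity allows only for 0.\<close>
  show inj: "x = 0" if "x \<in> L" "lo x = 0" for x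
    using pos[OF that(1)] that(2) by (auto simp: Psi_eq)
  have L_add: "x + y \<in> L" if "x \<in> L" "y \<in> L" for x y
  proof -
    obtain m m' where "x = mid m" "y = mid m'" "m \<in> F 0 \<inter> weight_fil (-1)" "m' \<in> F 0 \<inter> weight_fil (-1)"
      using \<open>x \<in> L\<close> \<open>y \<in> L\<close> by (auto simp: L_def)
    then show ?thesis unfolding L_def
      by (intro image_eqI[of _ mid "m + m'"])
        (auto intro: vec.subspace_add[OF sub] vec.subspace_add[OF subspace_weight_fil])
  qed
  have L_scale: "c *s x \<in> L" if "x \<in> L" for c x
  proof -
    obtain m where "x = mid m" "m \<in> F 0 \<inter> weight_fil (-1)" using \<open>x \<in> L\<close> by (auto simp: L_def)
    then show ?thesis unfolding L_def
      by (intro image_eqI[of _ mid "c *s m"])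
        (auto intro: vec.subspace_scale[OF sub] vec.subspace_scale[OF subspace_weight_fil])
  qed
  have mid_gr: "mid a \<in> L" if a: "a \<in> gr_fil F 0 (-1)" for a
  proof -
    obtain a' where a': "a' \<in> F 0" "a' \<in> weight_fil (-1)" "a - a' \<in> weight_fil (-1 - 1)"
      using a unfolding gr_fil_iff by blast
    then have "mid a = mid a'" by (simp add: weight_fil_iff)
    then show ?thesis using a' by (auto simp: L_def)
  qed
  have split: "\<exists>l\<in>L. \<exists>l'\<in>L. x = l + cnj_vec l'" for x
  proof -
    have "mix_vec 0 x 0 \<in> weight_fil (-1)" by (simp add: weight_fil_iff)
    then obtain a b where ab: "mix_vec 0 x 0 = a + b" "a \<in> gr_fil F 0 (-1)" "conjM b \<in> gr_fil F 0 (-1)"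
      using opposed(1)[OF mhs, of "mix_vec 0 x 0" "-1" 0] by auto
    have "x = mid a + cnj_vec (mid (conjM b))" using arg_cong[OF ab(1), of mid] by simp
    then show ?thesis using mid_gr[OF ab(2)] mid_gr[OF ab(3)] by blast
  qed
  have "lo ` L = UNIV"
  proof (rule ccontr)
    assume ne: "lo ` L \<noteq> UNIV"
    have "L \<noteq> {}" using split by blast
    moreover have "x + y \<in> lo ` L" if "x \<in> lo ` L" "y \<in> lo ` L" for x y
      using that L_add by (auto simp flip: up_lo_simps)
    moreover have "c *s x \<in> lo ` L" if "x \<in> lo ` L" for c x
      using that L_scale by (auto simp flip: up_lo_linear)
    ultimately obtain b where b: "b \<noteq> 0" "\<And>x. x \<in> lo ` L \<Longrightarrow> dotc x b = 0"
      using orthogonal_vector[of "lo ` L"] ne by (metis image_is_empty)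
    obtain l l' where l: "l \<in> L" "l' \<in> L" "pair_vec b 0 = l + cnj_vec l'" using split by blast
    have "Psi l' (pair_vec b 0) = 0" using b(2) l(2) by (simp add: Psi_eq)
    then have "Psi l' (cnj_vec l') = 0" unfolding l(3) using iso[OF l(2,1)] by simp
    then have "l' = 0" using pos[OF l(2)] by auto
    then have "pair_vec b 0 \<in> L" using l by simp
    then have "pair_vec b 0 = 0" using inj by simp
    then show False using b(1) by (metis pair_vec_simps(1) up_lo_simps(5))
  qed
  then show "\<exists>x\<in>L. lo x = a" by (metis UNIV_I imageE)
qed

text \<open>Positivity of Im \<tau> only concerns real vectors; on the graph over a real vector x,
  the Hermitian form is 4\<pi> times the real form at x.\<close>

lemma siegelI:
  assumes sym: "transpose \<tau> = \<tau>"
    and pos: "\<And>a. a \<noteq> 0 \<Longrightarrow> 0 < Re (Psi (pair_vec (\<tau> *v a) a) (cnj_vec (pair_vec (\<tau> *v a) a)))"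
  shows "\<tau> \<in> siegel"
proof -
  have "0 < x \<bullet> (im_mat \<tau> *v x)" if x: "x \<noteq> 0" for x
  proof -
    let ?a = "\<chi> i. complex_of_real (x $ i)"
    have "?a \<noteq> 0" using x by (simp add: vec_eq_iff)
    then have "0 < Re (Psi (pair_vec (\<tau> *v ?a) ?a) (cnj_vec (pair_vec (\<tau> *v ?a) ?a)))" by (rule pos)
    also have "Psi (pair_vec (\<tau> *v ?a) ?a) (cnj_vec (pair_vec (\<tau> *v ?a) ?a)) =
        4 * of_real pi * dotc (im_cmat \<tau> *v ?a) (cnj_vec ?a)"
      using Psi_graph[OF sym, of "pair_vec (\<tau> *v ?a) ?a"] unfolding pair_vec_simps by blast
    also have "dotc (im_cmat \<tau> *v ?a) (cnj_vec ?a) = of_real (x \<bullet> (im_mat \<tau> *v x))"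
      unfolding inner_vec_def dotc_def matrix_vector_mult_def
      by (simp add: im_cmat_def im_mat_def cnj_vec_def) (simp add: mult.commute)
    also have "4 * of_real pi * complex_of_real (x \<bullet> (im_mat \<tau> *v x)) = of_real (4 * pi * (x \<bullet> (im_mat \<tau> *v x)))"
      by simp
    finally show ?thesis unfolding Re_complex_of_real by (simp add: zero_less_mult_iff)
  qed
  then show ?thesis using sym by (simp add: siegel_def im_mat_def)
qed

text \<open>The columns of \<open>F0_mat\<close> are recovered from \<open>F 0\<close>: the f j lie
  in \<open>W_{-1}\<close> and lift the unit vectors of the second half, and one further element,
  normalised to have zero second half, lifts the last basis vector.\<close>

lemma period_domain_coordinates:
  fixes F :: "int \<Rightarrow> (complex ^ ('d::finite) mix) set"
  assumes F: "F \<in> period_domain"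
  obtains c where "c \<in> coord_domain" "F = hodge_fil c"
proof -
  have sub: "vec.subspace (F 0)"
    using F by (simp add: period_domain_def mixed_hodge_structure_def)
  note mem = vec.subspace_add[OF sub] vec.subspace_scale[OF sub] vec.subspace_diff[OF sub]
  note Fp = period_domain_steps[OF F] and M = period_domain_middle[OF F]
  have "\<forall>j. \<exists>m. m \<in> F 0 \<and> m $ E1 = 0 \<and> lo (mid m) = axis j 1"
  proof
    fix j
    obtain x where x: "x \<in> mid ` (F 0 \<inter> weight_fil (-1))" "lo x = axis j 1"
      using M(4)[of "axis j 1"] by (rule bexE)
    from x(1) obtain m where "x = mid m" "m \<in> F 0 \<inter> weight_fil (-1)" by (rule imageE)
    then show "\<exists>m. m \<in> F 0 \<and> m $ E1 = 0 \<and> lo (mid m) = axis j 1"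
      using x(2) by (intro exI[of _ m]) (simp add: weight_fil_iff)
  qed
  then have "\<exists>f. \<forall>j. f j \<in> F 0 \<and> f j $ E1 = 0 \<and> lo (mid (f j)) = axis j 1" by (rule choice)
  then obtain f where "\<forall>j. f j \<in> F 0 \<and> f j $ E1 = 0 \<and> lo (mid (f j)) = axis j 1" ..
  then have f: "f j \<in> F 0" "f j $ E1 = 0" "lo (mid (f j)) = axis j 1" for j by simp_all
  define \<tau> where "\<tau> = (\<chi> i j. up (mid (f j)) $ i)"
  define u where "u = (\<chi> j. f j $ E0)"
  define g where "g a = (\<Sum>j\<in>UNIV. a $ j *s f j)" for a
  have g_F: "g a \<in> F 0" for a
    unfolding g_def by (intro vec.subspace_sum[OF sub] vec.subspace_scale[OF sub] f)
  have g_E1: "g a $ E1 = 0" for a by (simp add: g_def f)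
  have g_E0: "g a $ E0 = dotc u a" for a by (simp add: g_def dotc_def u_def mult.commute)
  have g_lo: "lo (mid (g a)) = a" for a
  proof -
    have fe: "f j $ EM (Inr i) = (if i = j then 1 else 0)" for i j
      using arg_cong[OF f(3)[of j], of "\<lambda>v. v $ i"] by (simp add: lo_def mid_def axis_def)
    show ?thesis
      by (simp add: vec_eq_iff g_def lo_def mid_def fe if_distrib[of "\<lambda>x. _ * x"] cong: if_cong)
  qed
  have g_up: "up (mid (g a)) = \<tau> *v a" for a
    by (simp add: vec_eq_iff g_def \<tau>_def up_def mid_def matrix_vector_mult_def mult.commute)
  have g_mid: "mid (g a) = pair_vec (\<tau> *v a) a" for a
    by (rule up_lo_eqI) (simp_all add: g_lo g_up)
  have g_L: "pair_vec (\<tau> *v a) a \<in> mid ` (F 0 \<inter> weight_fil (-1))" for a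
    unfolding g_mid[symmetric] using g_F[of a] g_E1[of a] by (intro imageI) (simp add: weight_fil_iff)
  have "\<tau> \<in> siegel"
  proof (rule siegelI)
    \<comment> \<open>Isotropy of the graph, tested on two of its basis vectors.\<close>
    have "\<tau> $ j $ i = \<tau> $ i $ j" for i j
      using M(1)[OF g_L[of "axis i 1"] g_L[of "axis j 1"]]
      by (simp add: Psi_eq dotc_def matrix_vector_mult_def axis_def if_distrib[of "\<lambda>x. x * _"]
          if_distrib[of "\<lambda>x. _ * x"] cong: if_cong)
    then show "transpose \<tau> = \<tau>" by (simp add: vec_eq_iff transpose_def)
    fix a :: "complex ^ 'd" assume "a \<noteq> 0"
    then have "pair_vec (\<tau> *v a) a \<noteq> 0" by (metis pair_vec_simps(2) up_lo_simps(6))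
    then show "0 < Re (Psi (pair_vec (\<tau> *v a) a) (cnj_vec (pair_vec (\<tau> *v a) a)))"
      using M(2)[OF g_L] by blast
  qed
  obtain m1 where m1: "m1 \<in> F 0" "mix_vec 0 0 1 - m1 \<in> weight_fil (-1)" using Fp(3) by blast
  \<comment> \<open>Subtracting an element of the graph clears the entries of m1 in the rows of 1_d
    without changing the entry 1 in the last row; what remains is the last column (w, v, 0,
    1).\<close>
  define m2 where "m2 = m1 - g (lo (mid m1))"
  have m2: "m2 \<in> F 0" "m2 $ E1 = 1" "lo (mid m2) = 0"
    using m1(2) mem(3)[OF m1(1) g_F] by (simp_all add: m2_def weight_fil_iff g_E1 g_lo)
  define v where "v = up (mid m2)"
  define w where "w = m2 $ E0"
  have "F 0 = hodge_fil (\<tau>, u, v, w) 0"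
  proof (rule Set.set_eqI)
    fix m
    show "m \<in> F 0 \<longleftrightarrow> m \<in> hodge_fil (\<tau>, u, v, w) 0"
      unfolding hodge_fil_simps F0_range
    proof
      assume m: "m \<in> F 0"
      \<comment> \<open>The remainder lies in \<open>F 0\<close> and \<open>W_{-1}\<close> and has
        zero second half. Injectivity of \<open>lo\<close> on the middle part places it in
        \<open>W_{-2}\<close>, which meets \<open>F 0\<close> only in 0.\<close>
      let ?m = "m - m $ E1 *s m2 - g (lo (mid m))"
      have in_F: "?m \<in> F 0" by (intro mem m m2(1) g_F)
      have W: "?m \<in> weight_fil (-1)" using m2 by (simp add: weight_fil_iff g_E1)
      have "lo (mid ?m) = 0" by (simp add: m2 g_lo)
      then have "mid ?m = 0" using M(3)[of "mid ?m"] imageI[of ?m "F 0 \<inter> weight_fil (-1)" mid] in_F W by simp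
      then have "?m \<in> weight_fil (-2)" using W by (simp add: weight_fil_iff)
      then have "?m = 0" using Fp(4)[OF in_F] by blast
      then have eq: "m = m $ E1 *s m2 + g (lo (mid m))" by (simp add: algebra_simps)
      show "m $ E0 = dotc u (lo (mid m)) + w * m $ E1 \<and> up (mid m) = \<tau> *v lo (mid m) + m $ E1 *s v"
        using arg_cong[OF eq, of "\<lambda>m. m $ E0"] arg_cong[OF eq, of "\<lambda>m. up (mid m)"]
        by (simp add: g_E0 g_up w_def v_def algebra_simps)
    next
      assume m: "m $ E0 = dotc u (lo (mid m)) + w * m $ E1 \<and> up (mid m) = \<tau> *v lo (mid m) + m $ E1 *s v"
      have "m = g (lo (mid m)) + m $ E1 *s m2"
        by (rule mix_eqI; (rule up_lo_eqI)?)
          (use m in \<open>simp_all add: g_E0 g_E1 g_up g_lo m2 v_def w_def\<close>)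
      also have "\<dots> \<in> F 0" by (intro mem g_F m2(1))
      finally show "m \<in> F 0" .
    qed
  qed
  then have "F p = hodge_fil (\<tau>, u, v, w) p" for p
    using Fp(1,2)[of p] by (cases p "0::int" rule: linorder_cases) (simp_all add: hodge_fil_simps)
  then have "F = hodge_fil (\<tau>, u, v, w)" by blast
  moreover have "(\<tau>, u, v, w) \<in> coord_domain" using \<open>\<tau> \<in> siegel\<close> by (simp add: coord_domain_def)
  ultimately show ?thesis using that by blast
qed

lemma hodge_fil_image: "hodge_fil ` coord_domain = period_domain"
  using hodge_fil_in_period_domain period_domain_coordinates by blast

section \<open>Orbits\<close>

lemma Pu_mat_mult:
  fixes m :: "complex ^ ('d::finite) mix"
  defines "c \<equiv> 2 * of_real pi * \<i>"
  shows "Pu_mat (heis x y z) *v m =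
    mix_vec (m $ E0 + dotc (\<chi> k. c * of_int (x $ k)) (mid m) + c * of_int z * m $ E1)
      (mid m + m $ E1 *s (\<chi> k. of_int (y $ k))) (m $ E1)"
proof (rule mix_eqI)
  have sum: "(\<Sum>i\<in>UNIV. h i) = h E0 + (\<Sum>k\<in>UNIV. h (EM k)) + h E1" for h :: "'d mix \<Rightarrow> complex"
    by (simp add: sum_UNIV_Plus UNIV_unit add.assoc)
  note defs = matrix_vector_mult_def sum Pu_mat_def heis_def mid_def dotc_def c_def
  let ?m = "Pu_mat (heis x y z) *v m"
    and ?m' = "mix_vec (m $ E0 + dotc (\<chi> k. c * of_int (x $ k)) (mid m) + c * of_int z * m $ E1)
      (mid m + m $ E1 *s (\<chi> k. of_int (y $ k))) (m $ E1)"
  show "?m $ E0 = ?m' $ E0" by (simp add: defs)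
  show "?m $ E1 = ?m' $ E1" by (simp add: defs)
  show "mid ?m = mid ?m'"
    by (simp add: defs vec_eq_iff if_distrib[of of_int] if_distrib[of "\<lambda>x. x * _"] if_distrib[of "\<lambda>x. _ * x"] mult.commute cong: if_cong)
qed

lemma Pu_mat_image:
  fixes x y :: "int ^ ('d + ('d::finite))"
  shows "(\<lambda>p. (*v) (Pu_mat (heis x y z)) ` hodge_fil s p) =
    hodge_fil (heis_act (\<chi> k. 2 * of_real pi * \<i> * of_int (x $ k), \<chi> k. of_int (y $ k), 2 * of_real pi * \<i> * of_int z) s)"
proof
  fix p
  define \<xi> where "\<xi> = (\<chi> k. 2 * of_real pi * \<i> * complex_of_int (x $ k))"
  define \<eta> where "\<eta> = (\<chi> k. complex_of_int (y $ k))"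
  define \<zeta> where "\<zeta> = 2 * of_real pi * \<i> * complex_of_int z"
  define T where "T m = mix_vec (m $ E0 + dotc \<xi> (mid m) + \<zeta> * m $ E1) (mid m + m $ E1 *s \<eta>) (m $ E1)"
    for m :: "complex ^ 'd mix"
  \<comment> \<open>The inverse of the group element. It carries the new \<open>F 0\<close> back
    into the old one, which gives surjectivity of \<open>T\<close> between them.\<close>
  define T' where "T' m = mix_vec (m $ E0 - dotc \<xi> (mid m - m $ E1 *s \<eta>) - \<zeta> * m $ E1) (mid m - m $ E1 *s \<eta>) (m $ E1)"
    for m :: "complex ^ 'd mix"
  have TT': "T (T' m) = m" for m by (rule mix_eqI) (simp_all add: T_def T'_def)
  have T0: "T 0 = 0" by (rule mix_eqI) (simp_all add: T_def)
  have T_eq: "(*v) (Pu_mat (heis x y z)) = T" by (rule ext) (simp only: T_def Pu_mat_mult \<xi>_def \<eta>_def \<zeta>_def)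
  obtain \<tau> u v w where s: "s = (\<tau>, u, v, w)" by (cases s)
  let ?s = "heis_act (\<xi>, \<eta>, \<zeta>) s"
  have in_T: "T m \<in> range ((*v) (F0_mat ?s))" if "m \<in> range ((*v) (F0_mat s))" for m
    using that unfolding s heis_act.simps F0_range
    by (simp add: T_def dotc_Plus[of \<xi>] dotc_add dotc_scale dotc_vector_matrix tau_one_mult one_minus_tau_mult
        vector_scalar_commute
        matrix_vector_right_distrib matrix_vector_mult_diff_distrib algebra_simps)
  have in_T': "T' m \<in> range ((*v) (F0_mat s))" if m: "m \<in> range ((*v) (F0_mat ?s))" for m
  proof -
    have e: "m $ E0 = dotc (u + \<xi> v* tau_one \<tau>) (lo (mid m)) +
        (w + dotc (up \<xi>) v + \<zeta> - dotc (u + \<xi> v* tau_one \<tau>) (lo \<eta>)) * m $ E1"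
      "up (mid m) = \<tau> *v lo (mid m) + m $ E1 *s (v + one_minus_tau \<tau> *v \<eta>)"
      using m unfolding s heis_act.simps F0_range by blast+
    show ?thesis unfolding s F0_range
      by (simp add: e T'_def dotc_Plus[of \<xi>] dotc_add dotc_diff dotc_scale dotc_vector_matrix tau_one_mult
          one_minus_tau_mult vector_scalar_commute matrix_vector_right_distrib
          matrix_vector_mult_diff_distrib algebra_simps)
  qed
  show "(*v) (Pu_mat (heis x y z)) ` hodge_fil s p = hodge_fil (heis_act (\<chi> k. 2 * of_real pi * \<i> * of_int (x $ k),
      \<chi> k. of_int (y $ k), 2 * of_real pi * \<i> * of_int z) s) p"
    unfolding T_eq \<xi>_def[symmetric] \<eta>_def[symmetric] \<zeta>_def[symmetric]
  proof (cases p "0::int" rule: linorder_cases)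
    case less
    then show "T ` hodge_fil s p = hodge_fil ?s p"
      using TT' by (simp add: hodge_fil_simps) (metis surj_def)
  next
    case greater
    then show "T ` hodge_fil s p = hodge_fil ?s p" using T0 by (simp add: hodge_fil_simps)
  next
    case equal
    have "range ((*v) (F0_mat ?s)) \<subseteq> T ` range ((*v) (F0_mat s))"
      using in_T' TT' by (metis image_eqI subsetI)
    then show "T ` hodge_fil s p = hodge_fil ?s p" using in_T equal by (auto simp: hodge_fil_simps)
  qed
qed

definition heis_orbit :: "('d::finite) coords \<Rightarrow> (int \<Rightarrow> (complex ^ 'd mix) set) set" where
  "heis_orbit = Pu_orbit \<circ> hodge_fil"

lemma heis_orbit_image: "heis_orbit s = hodge_fil ` (\<lambda>g. heis_act g s) ` heis_lattice"
proof (rule equalityI; rule subsetI)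
  fix F assume "F \<in> heis_orbit s"
  then obtain x y z where F: "F = (\<lambda>p. (*v) (Pu_mat (heis x y z)) ` hodge_fil s p)"
    unfolding heis_orbit_def o_apply Pu_orbit_def Pu_def by blast
  let ?g = "(\<chi> k. 2 * of_real pi * \<i> * of_int (x $ k), \<chi> k. of_int (y $ k), 2 * of_real pi * \<i> * of_int z)"
  have "?g \<in> heis_lattice" by (auto simp: heis_lattice_def Z1_vecs_def int_vecs_def Z1_def)
  then show "F \<in> hodge_fil ` (\<lambda>g. heis_act g s) ` heis_lattice"
    unfolding F Pu_mat_image by (intro imageI)
next
  fix F assume "F \<in> hodge_fil ` (\<lambda>g. heis_act g s) ` heis_lattice"
  then obtain \<xi> y \<zeta> where F: "F = hodge_fil (heis_act (\<xi>, y, \<zeta>) s)"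
    and g: "\<And>k. \<xi> $ k \<in> Z1" "\<And>k. y $ k \<in> \<int>" "\<zeta> \<in> Z1"
    by (auto simp: heis_lattice_def Z1_vecs_def int_vecs_def)
  have "\<forall>k. \<exists>n. \<xi> $ k = 2 * of_real pi * \<i> * of_int n" using g(1) by (auto simp: Z1_def)
  then obtain a where a: "\<And>k. \<xi> $ k = 2 * of_real pi * \<i> * of_int (a k)" by metis
  have "\<forall>k. \<exists>n. y $ k = of_int n" using g(2) by (meson Ints_cases)
  then obtain b where b: "\<And>k. y $ k = of_int (b k)" by metis
  obtain n where n: "\<zeta> = 2 * of_real pi * \<i> * of_int n" using g(3) by (auto simp: Z1_def)
  have "F = (\<lambda>p. (*v) (Pu_mat (heis (\<chi> k. a k) (\<chi> k. b k) n)) ` hodge_fil s p)"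
    unfolding F Pu_mat_image by (simp add: n flip: a b)
  then show "F \<in> heis_orbit s" unfolding heis_orbit_def o_apply Pu_orbit_def Pu_def by blast
qed

lemma heis_orbit_eq: "heis_orbit s = heis_orbit s' \<longleftrightarrow> (\<exists>g\<in>heis_lattice. s' = heis_act g s)"
  unfolding heis_orbit_image inj_image_eq_iff[OF inj_hodge_fil] by (rule heis_orbit_eq_iff)

lemma quotient_mfd_single:
  "quotient_mfd (Cmfd P {(S, h)}) q =
    Cmfd (q ` P) {(V, q \<circ> h) | V. openin (top_of_set S) V \<and> inj_on (q \<circ> h) V}"
  by (simp add: quotient_mfd_def)

text \<open>\<open>D_mfd\<close> has one global parametrisation, so the quotient is uniformised by
  \<open>coord_domain\<close> itself. The point set is the right one by
  \<open>hodge_fil_image\<close>, where the description of the period domain enters.\<close>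

lemma Pu_quotient_eq: "Pu_quotient = quot coord_domain heis_orbit"
  unfolding Pu_quotient_def D_mfd_def quotient_mfd_single hodge_fil_image[symmetric] image_comp
    heis_orbit_def[symmetric] quot_def ..

section \<open>The quotient manifolds\<close>

lemma holo_on_matrix_vector [holo_intros]:
  fixes A :: "'a::complex_space \<Rightarrow> complex ^ 'n ^ 'm"
  shows "holo_on A S \<Longrightarrow> holo_on x S \<Longrightarrow> holo_on (\<lambda>s. A s *v x s) S"
  unfolding matrix_vector_mult_def by (intro holo_intros)

lemma holo_on_vector_matrix [holo_intros]:
  fixes A :: "'a::complex_space \<Rightarrow> complex ^ 'n ^ 'm"
  shows "holo_on x S \<Longrightarrow> holo_on A S \<Longrightarrow> holo_on (\<lambda>s. x s v* A s) S"
  unfolding vector_matrix_mult_def by (intro holo_intros)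

lemma holo_on_tau_one [holo_intros]: "holo_on f S \<Longrightarrow> holo_on (\<lambda>s. x v* tau_one (f s)) S"
  unfolding tau_one_mult by (intro holo_intros)

lemma holo_on_one_minus_tau [holo_intros]: "holo_on f S \<Longrightarrow> holo_on (\<lambda>s. one_minus_tau (f s) *v y) S"
  unfolding one_minus_tau_mult by (intro holo_intros)

lemma heis_act_fst_snd:
  "heis_act (\<xi>, y, \<zeta>) s = (fst s, fst (snd s) + \<xi> v* tau_one (fst s),
     fst (snd (snd s)) + one_minus_tau (fst s) *v y,
     snd (snd (snd s)) + dotc (up \<xi>) (fst (snd (snd s))) + \<zeta>
       - dotc (fst (snd s) + \<xi> v* tau_one (fst s)) (lo y))"
  by (cases s) simp

lemma holo_on_heis_act: "holo_on (heis_act g) S"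
proof -
  obtain \<xi> y \<zeta> where g: "g = (\<xi>, y, \<zeta>)" by (cases g)
  show ?thesis unfolding g heis_act_fst_snd[abs_def] by (intro holo_intros)
qed

text \<open>The formula of \<open>heis_act\<close> solved for the group element: \<xi> from the
  change of u, y from the change of v, and then \<zeta> from the change of w.\<close>

definition heis_coord :: "('d::finite) coords \<Rightarrow> 'd coords \<Rightarrow> 'd heis_coords" where
  "heis_coord s s' =
    (let \<xi> = dual_coord (fst s) (fst (snd s') - fst (snd s));
         y = av_coord (fst s) (fst (snd (snd s')) - fst (snd (snd s)))
     in (\<xi>, y, snd (snd (snd s')) - snd (snd (snd s)) - dotc (up \<xi>) (fst (snd (snd s)))
                 + dotc (fst (snd s')) (lo y)))"

lemma int_vecs_real: "y \<in> int_vecs \<Longrightarrow> y $ k \<in> \<real>"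
  unfolding int_vecs_def by (metis Ints_cases Reals_of_int mem_Collect_eq)

lemma coord_domain_iff [simp]: "(\<tau>, u, v, w) \<in> coord_domain \<longleftrightarrow> \<tau> \<in> siegel"
  by (simp add: coord_domain_def)

lemma coord_domain_alt: "coord_domain = siegel \<times> UNIV"
  by (auto simp: coord_domain_def)

lemma continuous_on_dotc [continuous_intros]:
  "continuous_on S f \<Longrightarrow> continuous_on S g \<Longrightarrow> continuous_on S (\<lambda>x. dotc (f x) (g x))"
  unfolding dotc_def by (intro continuous_intros)

lemma continuous_on_up_lo [continuous_intros]:
  "continuous_on S f \<Longrightarrow> continuous_on S (\<lambda>x. up (f x))"
  "continuous_on S f \<Longrightarrow> continuous_on S (\<lambda>x. lo (f x))"
  unfolding up_def lo_def by (intro continuous_on_vec_lambda continuous_intros; assumption)+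

lemma continuous_on_heis_coord:
  "continuous_on (coord_domain \<times> coord_domain) (\<lambda>(s, s'). heis_coord s s')"
  unfolding heis_coord_def Let_def case_prod_beta
  by (intro continuous_intros continuous_on_dual_coord continuous_on_av_coord)
    (auto simp: coord_domain_alt)

lemma heis_coord_act:
  assumes "g \<in> heis_lattice" "s \<in> coord_domain"
  shows "heis_coord s (heis_act g s) = g"
proof -
  obtain \<tau> u v w where s: "s = (\<tau>, u, v, w)" by (cases s)
  obtain \<xi> y \<zeta> where g: "g = (\<xi>, y, \<zeta>)" by (cases g)
  have \<tau>: "\<tau> \<in> siegel" using assms(2) by (simp add: s)
  have "\<xi> \<in> Z1_vecs" "y \<in> int_vecs" using assms(1) by (auto simp: g heis_lattice_def)
  then have "dual_coord \<tau> (\<xi> v* tau_one \<tau>) = \<xi>" "av_coord \<tau> (one_minus_tau \<tau> *v y) = y"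
    using dual_coord_inverse[OF \<tau>] av_coord_inverse[OF \<tau> int_vecs_real] by blast+
  then show ?thesis by (simp add: s g heis_coord_def)
qed

lemma heis_lattice_discrete:
  assumes "g \<in> heis_lattice" "g' \<in> heis_lattice" "dist g g' < 1"
  shows "g = g'"
proof -
  obtain \<xi> y \<zeta> \<xi>' y' \<zeta>' where g: "g = (\<xi>, y, \<zeta>)" "g' = (\<xi>', y', \<zeta>')" by (cases g, cases g')
  have "dist \<xi> \<xi>' < 1" "dist (y, \<zeta>) (y', \<zeta>') < 1"
    using assms(3) unfolding g by (rule le_less_trans[OF dist_Pair_bounds(1)] le_less_trans[OF dist_Pair_bounds(2)])+
  moreover from this(2) have "dist y y' < 1" "dist \<zeta> \<zeta>' < 1"
    by (rule le_less_trans[OF dist_Pair_bounds(1)] le_less_trans[OF dist_Pair_bounds(2)])+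
  ultimately show ?thesis
    using assms(1,2) Z1_vecs_discrete int_vecs_discrete Z1_discrete unfolding g heis_lattice_def by auto
qed

interpretation E: covering_quotient coord_domain heis_orbit heis_lattice heis_act heis_coord 1
proof
  show "heis_orbit s = heis_orbit s' \<longleftrightarrow> (\<exists>g\<in>heis_lattice. s' = heis_act g s)" for s s' :: "'a coords"
    by (rule heis_orbit_eq)
qed (rule heis_act_domain holo_on_heis_act continuous_on_heis_coord heis_coord_act heis_lattice_discrete zero_less_one;
    assumption)+

section \<open>The fibre product of the two families as a quotient by translations\<close>

definition base_domain :: "((complex ^ 'd ^ ('d::finite)) \<times> (complex ^ 'd) \<times> (complex ^ 'd)) set" where
  "base_domain = siegel \<times> UNIV \<times> UNIV"

definition base_cls :: "(complex ^ 'd ^ ('d::finite)) \<times> (complex ^ 'd) \<times> (complex ^ 'd) \<Rightarrow> 'd AAdual" where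
  "base_cls = (\<lambda>(\<tau>, v, u). (\<tau>, av_cls \<tau> v, dual_cls \<tau> u))"

lemma base_cls_simp [simp]: "base_cls (\<tau>, v, u) = (\<tau>, av_cls \<tau> v, dual_cls \<tau> u)"
  by (simp add: base_cls_def)

lemma base_domain_iff [simp]: "(\<tau>, v, u) \<in> base_domain \<longleftrightarrow> \<tau> \<in> siegel"
  by (simp add: base_domain_def)

text \<open>The action induced on (\<tau>, v, u) by the Heisenberg group modulo its centre, which is
  an abelian group of translations.\<close>

definition base_act ::
    "(complex ^ ('d + 'd)) \<times> (complex ^ ('d + 'd)) \<Rightarrow> (complex ^ 'd ^ ('d::finite)) \<times> (complex ^ 'd) \<times> (complex ^ 'd) \<Rightarrow>
     (complex ^ 'd ^ 'd) \<times> (complex ^ 'd) \<times> (complex ^ 'd)" where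
  "base_act g s = (fst s, fst (snd s) + one_minus_tau (fst s) *v fst g, snd (snd s) + snd g v* tau_one (fst s))"

definition base_coord ::
    "(complex ^ 'd ^ ('d::finite)) \<times> (complex ^ 'd) \<times> (complex ^ 'd) \<Rightarrow> (complex ^ 'd ^ 'd) \<times> (complex ^ 'd) \<times> (complex ^ 'd) \<Rightarrow>
     (complex ^ ('d + 'd)) \<times> (complex ^ ('d + 'd))" where
  "base_coord s s' = (av_coord (fst s) (fst (snd s') - fst (snd s)), dual_coord (fst s) (snd (snd s') - snd (snd s)))"

lemma base_act_simp [simp]:
  "base_act (y, \<xi>) (\<tau>, v, u) = (\<tau>, v + one_minus_tau \<tau> *v y, u + \<xi> v* tau_one \<tau>)"
  by (simp add: base_act_def)

lemma coset_eq_iff: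
  fixes f :: "'a \<Rightarrow> 'b::ab_group_add"
  assumes zero: "\<exists>a\<in>A. f a = 0" and add: "\<And>a b. a \<in> A \<Longrightarrow> b \<in> A \<Longrightarrow> \<exists>c\<in>A. f c = f a + f b"
    and minus: "\<And>a. a \<in> A \<Longrightarrow> \<exists>c\<in>A. f c = - f a"
  shows "{v + f y | y. y \<in> A} = {v' + f y | y. y \<in> A} \<longleftrightarrow> (\<exists>y\<in>A. v' = v + f y)"
proof
  assume eq: "{v + f y | y. y \<in> A} = {v' + f y | y. y \<in> A}"
  have "v' \<in> {v' + f y | y. y \<in> A}" using zero by force
  then show "\<exists>y\<in>A. v' = v + f y" unfolding eq[symmetric] by blast
next
  have sub: "{(v + f y) + f x | x. x \<in> A} \<subseteq> {v + f x | x. x \<in> A}" if y: "y \<in> A" for v y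
  proof clarify
    fix x assume "x \<in> A"
    then obtain z where "z \<in> A" "f z = f y + f x" using add[OF y] by blast
    then have "(v + f y) + f x = v + f z \<and> z \<in> A" by (simp add: add.assoc)
    then show "\<exists>z. (v + f y) + f x = v + f z \<and> z \<in> A" by blast
  qed
  assume "\<exists>y\<in>A. v' = v + f y"
  then obtain y where y: "y \<in> A" "v' = v + f y" by blast
  obtain z where z: "z \<in> A" "f z = - f y" using minus[OF y(1)] by blast
  have v: "v = v' + f z" using y z by simp
  have "{v' + f x | x. x \<in> A} \<subseteq> {v + f x | x. x \<in> A}" using sub[OF y(1), of v] unfolding y(2) .
  moreover have "{v + f x | x. x \<in> A} \<subseteq> {v' + f x | x. x \<in> A}" using sub[OF z(1), of v'] unfolding v[symmetric] .
  ultimately show "{v + f y | y. y \<in> A} = {v' + f y | y. y \<in> A}" by blast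
qed

lemma av_cls_eq_iff: "av_cls \<tau> v = av_cls \<tau> v' \<longleftrightarrow> (\<exists>y\<in>int_vecs. v' = v + one_minus_tau \<tau> *v y)"
  unfolding av_cls_def
proof (rule coset_eq_iff)
  show "\<exists>a\<in>int_vecs. one_minus_tau \<tau> *v a = 0" by (rule bexI[of _ 0]) auto
  show "\<exists>c\<in>int_vecs. one_minus_tau \<tau> *v c = one_minus_tau \<tau> *v a + one_minus_tau \<tau> *v b"
    if "a \<in> int_vecs" "b \<in> int_vecs" for a b
    using that by (intro bexI[of _ "a + b"]) (simp_all add: matrix_vector_right_distrib)
  show "\<exists>c\<in>int_vecs. one_minus_tau \<tau> *v c = - (one_minus_tau \<tau> *v a)" if "a \<in> int_vecs" for a
    using that matrix_vector_mult_diff_distrib[of "one_minus_tau \<tau>" 0 a]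
    by (intro bexI[of _ "- a"]) simp_all
qed

lemma dual_cls_alt: "dual_cls \<tau> u = {u + x v* tau_one \<tau> | x. x \<in> Z1_vecs}"
  by (simp add: dual_cls_def Z1_vecs_def)

lemma dual_cls_eq_iff: "dual_cls \<tau> u = dual_cls \<tau> u' \<longleftrightarrow> (\<exists>\<xi>\<in>Z1_vecs. u' = u + \<xi> v* tau_one \<tau>)"
  unfolding dual_cls_alt
proof (rule coset_eq_iff)
  show "\<exists>a\<in>Z1_vecs. a v* tau_one \<tau> = 0" by (rule bexI[of _ 0]) auto
  show "\<exists>c\<in>Z1_vecs. c v* tau_one \<tau> = a v* tau_one \<tau> + b v* tau_one \<tau>"
    if "a \<in> Z1_vecs" "b \<in> Z1_vecs" for a b
    using that by (intro bexI[of _ "a + b"]) (simp_all add: vector_matrix_left_distrib)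
  show "\<exists>c\<in>Z1_vecs. c v* tau_one \<tau> = - (a v* tau_one \<tau>)" if "a \<in> Z1_vecs" for a
    using that vector_matrix_mult_diff_distrib[of 0 a "tau_one \<tau>"]
    by (intro bexI[of _ "- a"]) simp_all
qed

interpretation B: covering_quotient base_domain base_cls "int_vecs \<times> Z1_vecs" base_act base_coord 1
proof
  fix s s' :: "(complex ^ 'a ^ 'a) \<times> (complex ^ 'a) \<times> (complex ^ 'a)"
  obtain \<tau> v u where s: "s = (\<tau>, v, u)" by (cases s)
  obtain \<tau>' v' u' where s': "s' = (\<tau>', v', u')" by (cases s')
  show "base_cls s = base_cls s' \<longleftrightarrow> (\<exists>g\<in>int_vecs \<times> Z1_vecs. s' = base_act g s)"
  proof -
    have "base_cls s = base_cls s' \<longleftrightarrow> \<tau>' = \<tau> \<and> av_cls \<tau> v = av_cls \<tau> v' \<and> dual_cls \<tau> u = dual_cls \<tau> u'"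
      unfolding s s' base_cls_simp prod.inject by blast
    also have "\<dots> \<longleftrightarrow> (\<exists>g\<in>int_vecs \<times> Z1_vecs. s' = base_act g s)"
      unfolding s s' base_act_def av_cls_eq_iff dual_cls_eq_iff by auto
    finally show ?thesis .
  qed
  fix g :: "(complex ^ ('a + 'a)) \<times> (complex ^ ('a + 'a))" assume g: "g \<in> int_vecs \<times> Z1_vecs"
  obtain y \<xi> where g_eq: "g = (y, \<xi>)" by (cases g)
  show "base_act g s \<in> base_domain" if "s \<in> base_domain" using that by (simp add: s g_eq)
  show "base_coord s (base_act g s) = g" if "s \<in> base_domain"
  proof -
    have \<tau>: "\<tau> \<in> siegel" using that by (simp add: s)
    have "\<xi> \<in> Z1_vecs" "y \<in> int_vecs" using g by (auto simp: g_eq)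
    then have "dual_coord \<tau> (\<xi> v* tau_one \<tau>) = \<xi>" "av_coord \<tau> (one_minus_tau \<tau> *v y) = y"
      using dual_coord_inverse[OF \<tau>] av_coord_inverse[OF \<tau> int_vecs_real] by blast+
    then show ?thesis by (simp add: s g_eq base_coord_def)
  qed
  fix g' :: "(complex ^ ('a + 'a)) \<times> (complex ^ ('a + 'a))" assume g': "g' \<in> int_vecs \<times> Z1_vecs" and d: "dist g g' < 1"
  obtain y' \<xi>' where g'_eq: "g' = (y', \<xi>')" by (cases g')
  have "dist y y' < 1" "dist \<xi> \<xi>' < 1"
    using d unfolding g_eq g'_eq by (rule le_less_trans[OF dist_Pair_bounds(1)] le_less_trans[OF dist_Pair_bounds(2)])+
  then show "g = g'" using g g' Z1_vecs_discrete int_vecs_discrete unfolding g_eq g'_eq by auto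
next
  show "holo_on (base_act g) base_domain" for g :: "(complex ^ ('a + 'a)) \<times> (complex ^ ('a + 'a))"
    unfolding base_act_def by (intro holo_intros)
  show "continuous_on (base_domain \<times> base_domain)
      (\<lambda>(s, s'). base_coord s s' :: (complex ^ ('a + 'a)) \<times> (complex ^ ('a + 'a)))"
    unfolding base_coord_def case_prod_beta
    by (intro continuous_intros continuous_on_dual_coord continuous_on_av_coord)
      (auto simp: base_domain_def)
qed auto

lemma AAdual_family_eq: "AAdual_family = quot base_domain base_cls"
  unfolding AAdual_family_def quotient_mfd_domain base_domain_def base_cls_def ..

lemma complex_manifold_Pu_quotient: "complex_manifold Pu_quotient"
  unfolding Pu_quotient_eq
proof (rule E.complex_manifold_quot)
  show "complex_subspace (symmetric_mats \<times> UNIV)"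
    by (rule complex_subspace_times_UNIV[OF complex_subspace_symmetric_mats])
  show "openin (top_of_set (symmetric_mats \<times> UNIV)) coord_domain"
    unfolding coord_domain_alt by (rule openin_siegel_times)
qed

lemma complex_manifold_AAdual_family: "complex_manifold AAdual_family"
  unfolding AAdual_family_eq
proof (rule B.complex_manifold_quot)
  show "complex_subspace (symmetric_mats \<times> UNIV)"
    by (rule complex_subspace_times_UNIV[OF complex_subspace_symmetric_mats])
  show "openin (top_of_set (symmetric_mats \<times> UNIV)) base_domain"
    unfolding base_domain_def UNIV_Times_UNIV by (rule openin_siegel_times)
qed

section \<open>Maps on the quotient\<close>

abbreviation orb :: "complex ^ 'd ^ ('d::finite) \<Rightarrow> complex ^ 'd \<Rightarrow> complex ^ 'd \<Rightarrow> complex \<Rightarrow>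
    (int \<Rightarrow> (complex ^ 'd mix) set) set" where
  "orb \<tau> u v w \<equiv> heis_orbit (\<tau>, u, v, w)"

lemma orb_eqE:
  assumes "orb \<tau> u v w = orb \<tau>' u' v' w'"
  obtains \<xi> y \<zeta> where "\<tau>' = \<tau>" "\<xi> \<in> Z1_vecs" "y \<in> int_vecs" "\<zeta> \<in> Z1"
    "u' = u + \<xi> v* tau_one \<tau>" "v' = v + one_minus_tau \<tau> *v y"
    "w' = w + dotc (up \<xi>) v + \<zeta> - dotc u' (lo y)"
proof -
  obtain g where g: "g \<in> heis_lattice" "(\<tau>', u', v', w') = heis_act g (\<tau>, u, v, w)"
    using assms unfolding heis_orbit_eq by blast
  obtain \<xi> y \<zeta> where "g = (\<xi>, y, \<zeta>)" by (cases g)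
  then show ?thesis using that[of \<xi> y \<zeta>] g by (simp add: heis_lattice_def)
qed

lemma orb_eqI:
  assumes "\<xi> \<in> Z1_vecs" "y \<in> int_vecs" "\<zeta> \<in> Z1"
    "u' = u + \<xi> v* tau_one \<tau>" "v' = v + one_minus_tau \<tau> *v y"
    "w' = w + dotc (up \<xi>) v + \<zeta> - dotc u' (lo y)"
  shows "orb \<tau> u v w = orb \<tau> u' v' w'"
  unfolding heis_orbit_eq using assms
  by (intro bexI[of _ "(\<xi>, y, \<zeta>)"]) (simp_all add: heis_lattice_def)

lemma orb_cases:
  assumes "e \<in> points Pu_quotient"
  obtains \<tau> u v w where "\<tau> \<in> siegel" "e = orb \<tau> u v w"
proof -
  obtain s where s: "s \<in> coord_domain" "e = heis_orbit s"
    using assms by (auto simp: Pu_quotient_eq quot_def)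
  then show ?thesis using that by (cases s) simp
qed

lemma orb_in_points [simp]: "\<tau> \<in> siegel \<Longrightarrow> orb \<tau> u v w \<in> points Pu_quotient"
  by (simp add: Pu_quotient_eq quot_def)

lemma exp_eq_Z1: "exp a = exp b \<longleftrightarrow> a - b \<in> Z1"
proof -
  have "a = b + complex_of_real (of_int (2 * n) * pi) * \<i> \<longleftrightarrow> a - b = 2 * of_real pi * \<i> * of_int n" for n
    by (auto simp: algebra_simps)
  then show ?thesis unfolding exp_eq Z1_def by simp
qed

lemma tau_one_cancel:
  assumes "\<tau> \<in> siegel" "\<xi> \<in> Z1_vecs" "\<xi>' \<in> Z1_vecs" "\<xi> v* tau_one \<tau> = \<xi>' v* tau_one \<tau>"
  shows "\<xi> = \<xi>'"
  using dual_coord_inverse assms by metis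

text \<open>A group element that fixes u and v has \<xi> = 0 and y = 0 by uniqueness of lattice
  coordinates, so it is central and shifts w by \<zeta> in \<int>(1), the kernel of exp.\<close>

lemma orb_w_eq:
  assumes \<tau>: "\<tau> \<in> siegel"
  shows "orb \<tau> u v w = orb \<tau> u v w' \<longleftrightarrow> exp w = exp w'"
proof
  assume "orb \<tau> u v w = orb \<tau> u v w'"
  then obtain \<xi> y \<zeta> where *: "\<xi> \<in> Z1_vecs" "y \<in> int_vecs" "\<zeta> \<in> Z1"
    "u = u + \<xi> v* tau_one \<tau>" "v = v + one_minus_tau \<tau> *v y"
    "w' = w + dotc (up \<xi>) v + \<zeta> - dotc u (lo y)"
    by (rule orb_eqE)
  have "\<xi> = 0" using dual_coord_inverse[OF \<tau> *(1)] dual_coord_inverse[OF \<tau> lattice_vecs_closed(1)] *(4) by simp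
  moreover have "y = 0"
    using av_coord_inverse[OF \<tau> int_vecs_real[OF *(2)]] av_coord_inverse[OF \<tau>, of 0] *(5) by simp
  ultimately have "w' - w \<in> Z1" using *(3,6) by simp
  then show "exp w = exp w'" unfolding exp_eq_Z1[symmetric] by simp
next
  assume "exp w = exp w'"
  then have "w' - w \<in> Z1" unfolding exp_eq_Z1[symmetric] by simp
  then show "orb \<tau> u v w = orb \<tau> u v w'" by (intro orb_eqI[of 0 0 "w' - w"]) simp_all
qed

text \<open>Computed from an arbitrary representative; \<open>proj_orb\<close> is the proof that the
  choice does not matter.\<close>

definition orb_proj :: "(int \<Rightarrow> (complex ^ ('d::finite) mix) set) set \<Rightarrow> 'd AAdual" where
  "orb_proj e = (SOME x. \<exists>\<tau> u v w. e = orb \<tau> u v w \<and> x = base_cls (\<tau>, v, u))"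

text \<open>A logarithm a of t is chosen along with the representative. For t = 0 there is none, and
  the value is unspecified.\<close>

definition orb_scale :: "complex \<Rightarrow> (int \<Rightarrow> (complex ^ ('d::finite) mix) set) set \<Rightarrow> (int \<Rightarrow> (complex ^ 'd mix) set) set" where
  "orb_scale t e = (SOME x. \<exists>\<tau> u v w a. e = orb \<tau> u v w \<and> t = exp a \<and> x = orb \<tau> u v (w + a))"

lemma proj_orb: "orb_proj (orb \<tau> u v w) = (\<tau>, av_cls \<tau> v, dual_cls \<tau> u)"
  unfolding orb_proj_def
proof (rule some_equality)
  show "\<exists>\<tau>' u' v' w'. orb \<tau> u v w = orb \<tau>' u' v' w' \<and> (\<tau>, av_cls \<tau> v, dual_cls \<tau> u) = base_cls (\<tau>', v', u')"
    unfolding base_cls_simp by blast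
  fix x assume "\<exists>\<tau>' u' v' w'. orb \<tau> u v w = orb \<tau>' u' v' w' \<and> x = base_cls (\<tau>', v', u')"
  then obtain \<tau>' u' v' w' where "orb \<tau> u v w = orb \<tau>' u' v' w'" and x: "x = base_cls (\<tau>', v', u')" by blast
  then obtain \<xi> y \<zeta> where *: "\<tau>' = \<tau>" "\<xi> \<in> Z1_vecs" "y \<in> int_vecs"
    "u' = u + \<xi> v* tau_one \<tau>" "v' = v + one_minus_tau \<tau> *v y"
    by (elim orb_eqE)
  have "av_cls \<tau> v = av_cls \<tau> v'" "dual_cls \<tau> u = dual_cls \<tau> u'"
    unfolding av_cls_eq_iff dual_cls_eq_iff using * by blast+
  then show "x = (\<tau>, av_cls \<tau> v, dual_cls \<tau> u)" using x *(1) by simp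
qed

lemma scale_orb: "orb_scale (exp a) (orb \<tau> u v w) = orb \<tau> u v (w + a)"
  unfolding orb_scale_def
proof (rule some_equality)
  show "\<exists>\<tau>' u' v' w' a'. orb \<tau> u v w = orb \<tau>' u' v' w' \<and> exp a = exp a' \<and> orb \<tau> u v (w + a) = orb \<tau>' u' v' (w' + a')"
    by blast
  fix x assume "\<exists>\<tau>' u' v' w' a'. orb \<tau> u v w = orb \<tau>' u' v' w' \<and> exp a = exp a' \<and> x = orb \<tau>' u' v' (w' + a')"
  then obtain \<tau>' u' v' w' a' where o: "orb \<tau> u v w = orb \<tau>' u' v' w'" and x: "exp a' = exp a" "x = orb \<tau>' u' v' (w' + a')"
    by metis
  from o obtain \<xi> y \<zeta> where *: "\<tau>' = \<tau>" "\<xi> \<in> Z1_vecs" "y \<in> int_vecs" "\<zeta> \<in> Z1"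
    "u' = u + \<xi> v* tau_one \<tau>" "v' = v + one_minus_tau \<tau> *v y"
    "w' = w + dotc (up \<xi>) v + \<zeta> - dotc u' (lo y)"
    by (rule orb_eqE)
  \<comment> \<open>Two logarithms of the same number differ by an element of \<int>(1), which the
    central entry \<zeta> absorbs.\<close>
  have "\<zeta> + (a' - a) \<in> Z1" using *(4) x(1) unfolding exp_eq_Z1 by simp
  then have "orb \<tau> u v (w + a) = orb \<tau> u' v' (w' + a')"
    using * by (intro orb_eqI[of \<xi> y "\<zeta> + (a' - a)"]) simp_all
  then show "x = orb \<tau> u v (w + a)" using x(2) *(1) by simp
qed

lemma scale_orb':
  assumes "t \<noteq> 0"
  shows "orb_scale t (orb \<tau> u v w) = orb \<tau> u v (w + Ln t)"
  using scale_orb[of "Ln t"] assms by simp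

text \<open>The representative can be moved to prescribed u and v in their classes, so that w alone
  parametrises a fibre.\<close>

lemma fibre_rep:
  assumes "e \<in> points Pu_quotient" "orb_proj e = (\<tau>, av_cls \<tau> v, dual_cls \<tau> u)"
  obtains w where "e = orb \<tau> u v w"
proof -
  obtain \<tau>' u' v' w' where e: "e = orb \<tau>' u' v' w'" using assms(1) by (rule orb_cases)
  have "\<tau>' = \<tau>" and c: "av_cls \<tau> v' = av_cls \<tau> v" "dual_cls \<tau> u' = dual_cls \<tau> u"
    using assms(2) unfolding e proj_orb by auto
  obtain y where y: "y \<in> int_vecs" "v = v' + one_minus_tau \<tau> *v y" using c(1) unfolding av_cls_eq_iff by blast
  obtain \<xi> where \<xi>: "\<xi> \<in> Z1_vecs" "u = u' + \<xi> v* tau_one \<tau>" using c(2) unfolding dual_cls_eq_iff by blast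
  have "orb \<tau> u' v' w' = orb \<tau> u v (w' + dotc (up \<xi>) v' + 0 - dotc u (lo y))"
    by (rule orb_eqI[OF \<xi>(1) y(1) _ \<xi>(2) y(2) refl]) simp
  then show ?thesis using that e \<open>\<tau>' = \<tau>\<close> by blast
qed

section \<open>The torsor\<close>

lemma charts_cover_Pu: "charts_cover Pu_quotient coord_domain heis_orbit"
  unfolding Pu_quotient_eq by (rule E.charts_cover_quot)

lemma charts_cover_AAdual: "charts_cover AAdual_family base_domain base_cls"
  unfolding AAdual_family_eq by (rule B.charts_cover_quot)

lemma charts_cover_Cx: "charts_cover Cx_mfd (- {0}) (\<lambda>t. t)"
  unfolding Cx_mfd_def by (rule charts_cover_domain)

lemma local_log:
  assumes "t0 \<noteq> (0::complex)"
  obtains N l where "open N" "t0 \<in> N" "0 \<notin> N" "holo_on l N" "\<And>t. t \<in> N \<Longrightarrow> exp (l t) = t"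
proof
  \<comment> \<open>On this half plane t / t0 avoids the branch cut of \<open>Ln\<close>, so the
    logarithm is holomorphic near every nonzero t0, negative reals included.\<close>
  let ?N = "{t. 0 < Re (t / t0)}" and ?l = "\<lambda>t. Ln (t / t0) + Ln t0"
  show "open ?N" by (intro open_Collect_less continuous_intros) (use assms in auto)
  show "t0 \<in> ?N" "0 \<notin> ?N" using assms by auto
  show "exp (?l t) = t" if "t \<in> ?N" for t
  proof -
    have "t \<noteq> 0" using that by auto
    then show ?thesis using assms by (simp add: exp_add)
  qed
  show "holo_on ?l ?N"
  proof (rule holo_on_field)
    fix t assume "t \<in> ?N"
    then have "t / t0 \<notin> \<real>\<^sub>\<le>\<^sub>0" by (auto simp: complex_nonpos_Reals_iff)
    then have "(?l has_field_derivative (1 / t0) / (t / t0)) (at t)"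
      using assms by (auto intro!: derivative_eq_intros)
    then show "\<exists>D. (?l has_field_derivative D) (at t)" by blast
  qed
qed

definition base_of :: "('d::finite) coords \<Rightarrow> (complex ^ 'd ^ 'd) \<times> (complex ^ 'd) \<times> (complex ^ 'd)" where
  "base_of s = (fst s, fst (snd (snd s)), fst (snd s))"

lemma base_of_simp [simp]: "base_of (\<tau>, u, v, w) = (\<tau>, v, u)"
  by (simp add: base_of_def)

lemma base_of_act: "base_of (heis_act (\<xi>, y, \<zeta>) s) = base_act (y, \<xi>) (base_of s)"
  by (cases s) simp

lemma hol_map_proj: "hol_map Pu_quotient (points Pu_quotient) AAdual_family orb_proj"
proof (rule hol_map_lift_global[OF charts_from_cover[OF charts_cover_Pu] charts_cover_AAdual])
  show "holo_on base_of coord_domain" unfolding base_of_def by (intro holo_intros)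
  show "base_of s \<in> base_domain \<and> orb_proj (heis_orbit s) = base_cls (base_of s)" if "s \<in> coord_domain" for s
    using that by (cases s) (simp add: proj_orb)
qed

text \<open>A global lift would need a continuous logarithm on the nonzero numbers; near each t a
  local one is added to w instead.\<close>

lemma hol_map_scale:
  "hol_map (prod_mfd Cx_mfd Pu_quotient) ((- {0}) \<times> points Pu_quotient) Pu_quotient (\<lambda>(t, e). orb_scale t e)"
proof (rule hol_map_lift[OF charts_from_prod[OF charts_from_cover[OF charts_cover_Cx]
      charts_from_cover[OF charts_cover_Pu]] charts_cover_Pu])
  let ?Z = "(- {0}) \<times> points (Pu_quotient :: (_, 'a coords) cmfd)" and ?S = "(- {0::complex}) \<times> (coord_domain :: 'a coords set)"
  show "?Z \<subseteq> map_prod (\<lambda>t. t) heis_orbit ` ?S"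
    unfolding charts_from_points[OF charts_from_cover[OF charts_cover_Pu]] by force
  fix x assume x: "x \<in> ?S"
  then have "fst x \<noteq> 0" by auto
  then obtain N l where N: "open N" "fst x \<in> N" "0 \<notin> N" "holo_on l N" "\<And>t. t \<in> N \<Longrightarrow> exp (l t) = t"
    using local_log by metis
  let ?F = "\<lambda>z. (fst (snd z), fst (snd (snd z)), fst (snd (snd (snd z))), snd (snd (snd (snd z))) + l (fst z))"
  let ?D = "N \<times> UNIV \<inter> {z \<in> ?S. map_prod (\<lambda>t. t) heis_orbit z \<in> ?Z}"
  have "holo_on (\<lambda>z. l (fst z)) ?D"
    by (rule holo_on_compose[OF holo_on_fst[OF holo_on_id] N(4)]) auto
  then have "holo_on ?F ?D" by (intro holo_intros)
  moreover have "?F z \<in> coord_domain \<and> (case map_prod (\<lambda>t. t) heis_orbit z of (t, e) \<Rightarrow> orb_scale t e) = heis_orbit (?F z)"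
    if "z \<in> ?D" for z
  proof -
    obtain t \<tau> u v w where z: "z = (t, \<tau>, u, v, w)" by (cases z)
    have "t = exp (l t)" "\<tau> \<in> siegel" using that N(5) by (auto simp: z)
    then show ?thesis using scale_orb[of "l t" \<tau> u v w] by (simp add: z)
  qed
  ultimately show "\<exists>N F. open N \<and> x \<in> N \<and> holo_on F (N \<inter> {z \<in> ?S. map_prod (\<lambda>t. t) heis_orbit z \<in> ?Z}) \<and>
        (\<forall>z\<in>N \<inter> {z \<in> ?S. map_prod (\<lambda>t. t) heis_orbit z \<in> ?Z}. F z \<in> coord_domain \<and>
          (case map_prod (\<lambda>t. t) heis_orbit z of (t, e) \<Rightarrow> orb_scale t e) = heis_orbit (F z))"
    using N(1,2) by (intro exI[of _ "N \<times> UNIV"] exI[of _ ?F]) (auto simp: open_Times mem_Times_iff)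
qed

lemma scale_simply_transitive:
  assumes e: "e \<in> points Pu_quotient" "e' \<in> points Pu_quotient" and eq: "orb_proj e = orb_proj e'"
  shows "\<exists>!t. t \<noteq> 0 \<and> e' = orb_scale t e"
proof -
  obtain \<tau> u v w where 1: "\<tau> \<in> siegel" "e = orb \<tau> u v w" using e(1) by (rule orb_cases)
  have "orb_proj e' = (\<tau>, av_cls \<tau> v, dual_cls \<tau> u)" using eq unfolding 1 proj_orb by simp
  then obtain w' where 2: "e' = orb \<tau> u v w'" using fibre_rep[OF e(2)] by blast
  show ?thesis
  proof (rule ex1I[of _ "exp (w' - w)"])
    show "exp (w' - w) \<noteq> 0 \<and> e' = orb_scale (exp (w' - w)) e" unfolding 1 2 scale_orb by simp
    fix t assume t: "t \<noteq> 0 \<and> e' = orb_scale t e"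
    then have "orb \<tau> u v w' = orb \<tau> u v (w + Ln t)" unfolding 1 2 using scale_orb' by metis
    then have "exp w' = exp (w + Ln t)" unfolding orb_w_eq[OF 1(1)] .
    then show "t = exp (w' - w)" using t by (simp add: exp_add exp_diff)
  qed
qed

text \<open>Over the image \<open>U\<close> of an open set \<open>W\<close> on which \<^const>\<open>base_cls\<close> is injective, the points
  \<open>(\<tau>, u, v, 0)\<close> with \<open>(\<tau>, v, u) \<in> W\<close> form a section of the torsor.\<close>

lemma local_triviality:
  fixes b :: "('d::finite) AAdual"
  assumes "b \<in> points AAdual_family"
  shows "\<exists>U \<Phi>. mfd_open AAdual_family U \<and> b \<in> U \<and>
     biholomorphic Pu_quotient {e\<in>points Pu_quotient. orb_proj e \<in> U} (prod_mfd AAdual_family Cx_mfd) (U \<times> (- {0})) \<Phi> \<and>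
     (\<forall>e\<in>points Pu_quotient. orb_proj e \<in> U \<longrightarrow> fst (\<Phi> e) = orb_proj e \<and>
        (\<forall>t. t \<noteq> 0 \<longrightarrow> snd (\<Phi> (orb_scale t e)) = t * snd (\<Phi> e)))"
proof -
  obtain s0 where s0: "s0 \<in> base_domain" "b = base_cls s0"
    using assms by (auto simp: AAdual_family_eq quot_def)
  obtain W where W: "openin (top_of_set base_domain) W" "s0 \<in> W" "inj_on base_cls W"
    using B.locally_injective[OF s0(1)] .
  have W_sub: "W \<subseteq> base_domain" using W(1) openin_imp_subset by blast
  define U where "U = base_cls ` W"
  define Z where "Z = {e\<in>points Pu_quotient. orb_proj e \<in> U}"
  \<comment> \<open>Injectivity of \<open>base_cls\<close> on \<open>W\<close> pins down (\<tau>, v,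
    u), which leaves w determined modulo \<int>(1) and exp w unique.\<close>
  define \<Phi> where "\<Phi> e = (orb_proj e, SOME t. \<exists>\<tau> u v w. (\<tau>, v, u) \<in> W \<and> e = orb \<tau> u v w \<and> t = exp w)"
    for e :: "(int \<Rightarrow> (complex ^ 'd mix) set) set"
  have \<Phi>: "\<Phi> (orb \<tau> u v w) = (base_cls (\<tau>, v, u), exp w)" if w: "(\<tau>, v, u) \<in> W" for \<tau> u v w
  proof -
    have "(SOME t. \<exists>\<tau>' u' v' w'. (\<tau>', v', u') \<in> W \<and> orb \<tau> u v w = orb \<tau>' u' v' w' \<and> t = exp w') = exp w"
    proof (rule some_equality)
      show "\<exists>\<tau>' u' v' w'. (\<tau>', v', u') \<in> W \<and> orb \<tau> u v w = orb \<tau>' u' v' w' \<and> exp w = exp w'" using w by blast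
      fix t assume "\<exists>\<tau>' u' v' w'. (\<tau>', v', u') \<in> W \<and> orb \<tau> u v w = orb \<tau>' u' v' w' \<and> t = exp w'"
      then obtain \<tau>' u' v' w' where *: "(\<tau>', v', u') \<in> W" "orb \<tau> u v w = orb \<tau>' u' v' w'" "t = exp w'" by blast
      have "base_cls (\<tau>, v, u) = base_cls (\<tau>', v', u')"
        using arg_cong[OF *(2), of orb_proj] unfolding proj_orb base_cls_simp .
      then have "(\<tau>, v, u) = (\<tau>', v', u')" using inj_onD[OF W(3)] w *(1) by blast
      moreover have "\<tau> \<in> siegel" using w W_sub by auto
      ultimately show "t = exp w" using *(2,3) orb_w_eq[of \<tau> u v w w'] by simp
    qed
    then show ?thesis by (simp add: \<Phi>_def proj_orb)
  qed
  have Z_rep: "\<exists>\<tau> u v w. (\<tau>, v, u) \<in> W \<and> e = orb \<tau> u v w" if e: "e \<in> Z" for e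
  proof -
    obtain x where x: "x \<in> W" "orb_proj e = base_cls x" using e unfolding Z_def U_def by blast
    obtain \<tau> v u where "x = (\<tau>, v, u)" by (cases x)
    with x have *: "(\<tau>, v, u) \<in> W" "orb_proj e = base_cls (\<tau>, v, u)" by simp_all
    then obtain w where "e = orb \<tau> u v w"
      using e fibre_rep[of e \<tau> v u] unfolding Z_def base_cls_simp by blast
    then show ?thesis using *(1) by blast
  qed
  have Z_orb: "orb \<tau> u v w \<in> Z" if "(\<tau>, v, u) \<in> W" for \<tau> u v w
  proof -
    have "orb_proj (orb \<tau> u v w) \<in> U"
      unfolding U_def proj_orb using imageI[OF that, of base_cls] by simp
    moreover have "\<tau> \<in> siegel" using that W_sub by auto
    ultimately show ?thesis by (simp add: Z_def)
  qed
  have bij: "bij_betw \<Phi> Z (U \<times> (- {0}))"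
    unfolding bij_betw_def
  proof
    show "inj_on \<Phi> Z"
    proof (rule inj_onI)
      fix e e' assume e: "e \<in> Z" "e' \<in> Z" and eq: "\<Phi> e = \<Phi> e'"
      obtain \<tau> u v w where 1: "(\<tau>, v, u) \<in> W" "e = orb \<tau> u v w" using Z_rep[OF e(1)] by blast
      obtain \<tau>' u' v' w' where 2: "(\<tau>', v', u') \<in> W" "e' = orb \<tau>' u' v' w'" using Z_rep[OF e(2)] by blast
      have *: "base_cls (\<tau>, v, u) = base_cls (\<tau>', v', u')" "exp w = exp w'"
        using eq unfolding 1(2) 2(2) \<Phi>[OF 1(1)] \<Phi>[OF 2(1)] by blast+
      have "(\<tau>, v, u) = (\<tau>', v', u')" using inj_onD[OF W(3) *(1) 1(1) 2(1)] .
      moreover have "\<tau> \<in> siegel" using 1(1) W_sub by auto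
      ultimately show "e = e'" using *(2) orb_w_eq[of \<tau> u v w w'] unfolding 1(2) 2(2) by simp
    qed
    show "\<Phi> ` Z = U \<times> (- {0})"
    proof (intro equalityI subsetI)
      fix x assume "x \<in> \<Phi> ` Z"
      then obtain e where e: "e \<in> Z" "x = \<Phi> e" by blast
      obtain \<tau> u v w where 1: "(\<tau>, v, u) \<in> W" "e = orb \<tau> u v w" using Z_rep[OF e(1)] by blast
      show "x \<in> U \<times> (- {0})" unfolding e(2) 1(2) \<Phi>[OF 1(1)] U_def by (rule SigmaI[OF imageI[OF 1(1)]]) simp
    next
      fix x :: "'d AAdual \<times> complex" assume "x \<in> U \<times> (- {0})"
      then obtain c t where bt: "x = (c, t)" "c \<in> U" "t \<noteq> 0" by blast
      obtain z where z: "z \<in> W" "c = base_cls z" using bt(2) unfolding U_def by blast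
      obtain \<tau> v u where "z = (\<tau>, v, u)" by (cases z)
      with bt z have x: "x = (base_cls (\<tau>, v, u), t)" "(\<tau>, v, u) \<in> W" "t \<noteq> 0" by simp_all
      have "x = \<Phi> (orb \<tau> u v (Ln t))" unfolding \<Phi>[OF x(2)] x(1) using x(3) by simp
      then show "x \<in> \<Phi> ` Z" using Z_orb[OF x(2)] by blast
    qed
  qed
  have inv: "inv_into Z \<Phi> (base_cls (\<tau>, v, u), exp w) = orb \<tau> u v w" if "(\<tau>, v, u) \<in> W" for \<tau> u v w
    using inv_into_f_f[OF bij_betw_imp_inj_on[OF bij] Z_orb[OF that]] unfolding \<Phi>[OF that] .
  \<comment> \<open>A point over \<open>U\<close> is in general only a translate of a point of
    \<open>W\<close>. As \<open>W\<close> is open, one translation serves a whole neighbourhood, so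
    the lifts built from it are holomorphic.\<close>
  have move: "\<exists>y \<xi> N. y \<in> int_vecs \<and> \<xi> \<in> Z1_vecs \<and> open N \<and> s \<in> N \<and>
      (\<forall>x\<in>N \<inter> base_domain. base_act (y, \<xi>) x \<in> W)" if s: "s \<in> base_domain" "base_cls s \<in> U" for s
  proof -
    obtain g where g: "g \<in> int_vecs \<times> Z1_vecs" "base_act g s \<in> W"
      using B.saturation_eq[OF W_sub] s unfolding U_def by blast
    obtain N where N: "open N" "{x\<in>base_domain. base_act g x \<in> W} = base_domain \<inter> N"
      using B.open_A_preimage[OF W(1) g(1)] unfolding openin_open by blast
    have "s \<in> N" using N(2) s(1) g(2) by blast
    moreover have "\<forall>x\<in>N \<inter> base_domain. base_act g x \<in> W" using N(2) by blast
    ultimately show ?thesis using g(1) N(1) by (cases g) blast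
  qed
  have hol: "hol_map Pu_quotient Z (prod_mfd AAdual_family Cx_mfd) \<Phi>"
  proof (rule hol_map_lift[OF charts_from_cover[OF charts_cover_Pu]
        charts_cover_prod[OF charts_cover_AAdual charts_cover_Cx]])
    show "Z \<subseteq> heis_orbit ` coord_domain" unfolding Z_def Pu_quotient_eq quot_def by auto
    fix s :: "'d coords" assume s: "s \<in> coord_domain" "heis_orbit s \<in> Z"
    have "base_of s \<in> base_domain" "base_cls (base_of s) \<in> U"
      using s unfolding Z_def by (cases s; simp add: proj_orb)+
    then obtain y \<xi> N where N: "y \<in> int_vecs" "\<xi> \<in> Z1_vecs" "open N" "base_of s \<in> N"
      "\<And>x. x \<in> N \<Longrightarrow> x \<in> base_domain \<Longrightarrow> base_act (y, \<xi>) x \<in> W"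
      using move[of "base_of s"] by blast
    \<comment> \<open>The base translation (y, \<xi>) is lifted to the Heisenberg group with \<zeta>
      = 0; after it, the representative lies over \<open>W\<close>, where \<open>\<Phi>\<close> is
      read off directly.\<close>
    let ?N = "base_of -` N" and ?F = "\<lambda>x. (base_of (heis_act (\<xi>, y, 0) x), exp (snd (snd (snd (heis_act (\<xi>, y, 0) x)))))"
    have "open ?N"
      using N(3) by (rule open_vimage) (simp add: base_of_def, intro continuous_intros)
    moreover have "holo_on ?F (?N \<inter> {x \<in> coord_domain. heis_orbit x \<in> Z})"
      unfolding base_of_def by (intro holo_intros holo_on_heis_act)
    moreover have "?F x \<in> base_domain \<times> - {0} \<and> \<Phi> (heis_orbit x) = map_prod base_cls (\<lambda>t. t) (?F x)"
      if x: "x \<in> ?N" "x \<in> coord_domain" for x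
    proof -
      obtain \<tau> u v w where h: "heis_act (\<xi>, y, 0) x = (\<tau>, u, v, w)" by (cases "heis_act (\<xi>, y, 0) x")
      have "base_of x \<in> base_domain" using x(2) by (cases x) simp
      then have "base_act (y, \<xi>) (base_of x) \<in> W" using N(5) x(1) by blast
      then have in_W: "(\<tau>, v, u) \<in> W" unfolding base_of_act[of \<xi> y 0, symmetric] h base_of_simp .
      have "(\<xi>, y, 0) \<in> heis_lattice" using N(1,2) by (simp add: heis_lattice_def)
      then have "heis_orbit x = orb \<tau> u v w" using E.q_A[of "(\<xi>, y, 0)" x] x(2) unfolding h by simp
      then show ?thesis using \<Phi>[OF in_W] in_W W_sub unfolding h by auto
    qed
    ultimately show "\<exists>N F. open N \<and> s \<in> N \<and> holo_on F (N \<inter> {x \<in> coord_domain. heis_orbit x \<in> Z}) \<and>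
       (\<forall>x\<in>N \<inter> {x \<in> coord_domain. heis_orbit x \<in> Z}. F x \<in> base_domain \<times> - {0} \<and>
           \<Phi> (heis_orbit x) = map_prod base_cls (\<lambda>t. t) (F x))"
      using N(4) by (intro exI[of _ ?N] exI[of _ ?F] conjI ballI) (simp_all only: vimage_eq Int_iff mem_Collect_eq)
  qed
  have hol_inv: "hol_map (prod_mfd AAdual_family Cx_mfd) (U \<times> (- {0})) Pu_quotient (inv_into Z \<Phi>)"
  proof (rule hol_map_lift[OF charts_from_prod[OF charts_from_cover[OF charts_cover_AAdual]
        charts_from_cover[OF charts_cover_Cx]] charts_cover_Pu])
    let ?r = "map_prod base_cls (\<lambda>t::complex. t)" and ?S = "base_domain \<times> (- {0}) :: (((complex ^ 'd ^ 'd) \<times> (complex ^ 'd) \<times> (complex ^ 'd)) \<times> complex) set"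
    show "U \<times> (- {0}) \<subseteq> ?r ` ?S" unfolding U_def using W_sub by force
    fix s assume s: "s \<in> ?S" "?r s \<in> U \<times> (- {0})"
    have "fst s \<in> base_domain" "base_cls (fst s) \<in> U" using s by auto
    then obtain y \<xi> N where N: "y \<in> int_vecs" "\<xi> \<in> Z1_vecs" "open N" "fst s \<in> N"
      "\<And>x. x \<in> N \<Longrightarrow> x \<in> base_domain \<Longrightarrow> base_act (y, \<xi>) x \<in> W"
      using move[of "fst s"] by blast
    have "snd s \<noteq> 0" using s by auto
    then obtain N' l where N': "open N'" "snd s \<in> N'" "0 \<notin> N'" "holo_on l N'" "\<And>t. t \<in> N' \<Longrightarrow> exp (l t) = t"
      using local_log by metis
    let ?D = "N \<times> N' \<inter> {x \<in> ?S. ?r x \<in> U \<times> (- {0})}"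
    let ?a = "\<lambda>x. base_act (y, \<xi>) (fst x)"
    let ?F = "\<lambda>x. (fst (?a x), snd (snd (?a x)), fst (snd (?a x)), l (snd x))"
    have "holo_on (\<lambda>x. l (snd x)) ?D"
      by (rule holo_on_compose[OF holo_on_snd[OF holo_on_id] N'(4)]) auto
    then have holF: "holo_on ?F ?D" unfolding base_act_def by (intro holo_intros)
    have F: "?F x \<in> coord_domain \<and> inv_into Z \<Phi> (?r x) = heis_orbit (?F x)" if x: "x \<in> ?D" for x
    proof -
      obtain \<tau> v u where a: "?a x = (\<tau>, v, u)" by (cases "?a x")
      have xd: "fst x \<in> base_domain" using x by auto
      have in_W: "(\<tau>, v, u) \<in> W" using N(5)[of "fst x"] x xd unfolding a by auto
      have "base_cls (fst x) = base_cls (\<tau>, v, u)"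
        using B.q_A[of "(y, \<xi>)" "fst x"] N(1,2) xd unfolding a by simp
      moreover have "snd x = exp (l (snd x))" using N'(5) x by auto
      ultimately have "?r x = (base_cls (\<tau>, v, u), exp (l (snd x)))" by (cases x) simp
      moreover have "\<tau> \<in> siegel" using in_W W_sub by auto
      ultimately show ?thesis using inv[OF in_W] unfolding a by simp
    qed
    have all: "\<forall>x\<in>?D. ?F x \<in> coord_domain \<and> inv_into Z \<Phi> (?r x) = heis_orbit (?F x)" by (intro ballI F)
    have opn: "open (N \<times> N')" "s \<in> N \<times> N'" using N(3,4) N'(1,2) by (auto simp: open_Times mem_Times_iff)
    show "\<exists>N F. open N \<and> s \<in> N \<and> holo_on F (N \<inter> {x \<in> ?S. ?r x \<in> U \<times> (- {0})}) \<and>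
        (\<forall>x\<in>N \<inter> {x \<in> ?S. ?r x \<in> U \<times> (- {0})}. F x \<in> coord_domain \<and> inv_into Z \<Phi> (?r x) = heis_orbit (F x))"
      by (rule exI[of _ "N \<times> N'"], rule exI[of _ ?F], intro conjI opn holF all)
  qed
  have equiv: "fst (\<Phi> e) = orb_proj e \<and> (\<forall>t. t \<noteq> 0 \<longrightarrow> snd (\<Phi> (orb_scale t e)) = t * snd (\<Phi> e))" if e: "e \<in> Z" for e
  proof -
    obtain \<tau> u v w where 1: "(\<tau>, v, u) \<in> W" "e = orb \<tau> u v w" using Z_rep[OF e] by blast
    show ?thesis unfolding 1(2) using \<Phi>[OF 1(1)] by (simp add: proj_orb scale_orb' exp_add)
  qed
  show ?thesis
  proof (rule exI[of _ U], rule exI[of _ \<Phi>], unfold Z_def[symmetric], intro conjI)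
    show "mfd_open AAdual_family U" unfolding AAdual_family_eq U_def by (rule B.mfd_open_image[OF W(1)])
    show "b \<in> U" unfolding s0(2) U_def by (rule imageI[OF W(2)])
    show "biholomorphic Pu_quotient Z (prod_mfd AAdual_family Cx_mfd) (U \<times> (- {0})) \<Phi>"
      unfolding biholomorphic_def by (intro conjI bij hol hol_inv)
    show "\<forall>e\<in>points Pu_quotient. orb_proj e \<in> U \<longrightarrow> fst (\<Phi> e) = orb_proj e \<and>
        (\<forall>t. t \<noteq> 0 \<longrightarrow> snd (\<Phi> (orb_scale t e)) = t * snd (\<Phi> e))"
      using equiv unfolding Z_def by simp
  qed
qed

lemma Cx_torsor_Pu_quotient: "Cx_torsor (Pu_quotient :: (_, ('d::finite) coords) cmfd) AAdual_family orb_proj orb_scale"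
  unfolding Cx_torsor_def
proof (intro conjI ballI allI impI complex_manifold_Pu_quotient complex_manifold_AAdual_family
    hol_map_proj hol_map_scale)
  show "orb_proj ` points (Pu_quotient :: (_, 'd coords) cmfd) = points AAdual_family"
  proof (intro equalityI subsetI)
    fix b :: "'d AAdual" assume "b \<in> orb_proj ` points Pu_quotient"
    moreover have "orb_proj ` points (Pu_quotient :: (_, 'd coords) cmfd) \<subseteq> points AAdual_family"
      using hol_map_proj[where 'a='d] unfolding hol_map_def by (elim conjE)
    ultimately show "b \<in> points AAdual_family" by (rule rev_subsetD)
  next
    fix b :: "'d AAdual" assume "b \<in> points AAdual_family"
    then obtain \<tau> v u where "\<tau> \<in> siegel" "b = base_cls (\<tau>, v, u)"
      by (auto simp: AAdual_family_eq quot_def base_domain_def base_cls_def)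
    then have "b = orb_proj (orb \<tau> u v 0)" by (simp add: proj_orb)
    then show "b \<in> orb_proj ` points Pu_quotient" by (rule image_eqI) (rule orb_in_points[OF \<open>\<tau> \<in> siegel\<close>])
  qed
next
  fix e :: "(int \<Rightarrow> (complex ^ 'd mix) set) set" assume "e \<in> points Pu_quotient"
  then obtain \<tau> u v w where e: "\<tau> \<in> siegel" "e = orb \<tau> u v w" by (rule orb_cases)
  show "orb_scale 1 e = e" unfolding e(2) using scale_orb[of 0] by simp
  show "orb_scale (s * t) e = orb_scale s (orb_scale t e)" if "s \<noteq> 0" "t \<noteq> 0" for s t
    using that scale_orb[of "Ln t + Ln s"] by (simp add: e(2) scale_orb' exp_add mult.commute add.assoc)
  show "orb_proj (orb_scale t e) = orb_proj e" if "t \<noteq> 0" for t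
    using that by (simp add: e(2) scale_orb' proj_orb)
qed (rule scale_simply_transitive local_triviality; assumption)+

section \<open>The Poincare torsor and the universal extension\<close>

definition dual_of :: "(int \<Rightarrow> (complex ^ ('d::finite) mix) set) set \<Rightarrow> (complex ^ 'd ^ 'd) \<times> (complex ^ 'd) set" where
  "dual_of e = (fst (orb_proj e), snd (snd (orb_proj e)))"

definition orb_add :: "(int \<Rightarrow> (complex ^ ('d::finite) mix) set) set \<Rightarrow> (int \<Rightarrow> (complex ^ 'd mix) set) set \<Rightarrow>
    (int \<Rightarrow> (complex ^ 'd mix) set) set" where
  "orb_add e e' = (SOME x. \<exists>\<tau> u v w v' w'. \<tau> \<in> siegel \<and> e = orb \<tau> u v w \<and> e' = orb \<tau> u v' w' \<and>
     x = orb \<tau> u (v + v') (w + w'))"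

definition orb_zero :: "(complex ^ 'd ^ 'd) \<times> (complex ^ 'd) set \<Rightarrow> (int \<Rightarrow> (complex ^ ('d::finite) mix) set) set" where
  "orb_zero x = (SOME e. \<exists>u. snd x = dual_cls (fst x) u \<and> e = orb (fst x) u 0 0)"

lemma dual_of_orb [simp]: "dual_of (orb \<tau> u v w) = (\<tau>, dual_cls \<tau> u)"
  by (simp add: dual_of_def proj_orb)

text \<open>Both summands pass from u to s, so they change by the same \<xi>. For this fixed \<xi>,
  the corrections \<open>dotc (up \<xi>) v\<close> and \<open>dotc s (lo y)\<close> are additive in
  v and y, and the two changes add up to the change of the sum.\<close>

lemma orb_add_orb:
  assumes \<tau>: "\<tau> \<in> siegel"
  shows "orb_add (orb \<tau> u v w) (orb \<tau> u v' w') = orb \<tau> u (v + v') (w + w')"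
  unfolding orb_add_def
proof (rule some_equality)
  show "\<exists>\<sigma> s a b a' b'. \<sigma> \<in> siegel \<and> orb \<tau> u v w = orb \<sigma> s a b \<and> orb \<tau> u v' w' = orb \<sigma> s a' b' \<and>
      orb \<tau> u (v + v') (w + w') = orb \<sigma> s (a + a') (b + b')"
    using \<tau> by blast
  fix x assume "\<exists>\<sigma> s a b a' b'. \<sigma> \<in> siegel \<and> orb \<tau> u v w = orb \<sigma> s a b \<and> orb \<tau> u v' w' = orb \<sigma> s a' b' \<and>
      x = orb \<sigma> s (a + a') (b + b')"
  then obtain \<sigma> s a b a' b' where o: "orb \<tau> u v w = orb \<sigma> s a b" "orb \<tau> u v' w' = orb \<sigma> s a' b'"
    and x: "x = orb \<sigma> s (a + a') (b + b')"
    by blast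
  obtain \<xi> y \<zeta> where 1: "\<sigma> = \<tau>" "\<xi> \<in> Z1_vecs" "y \<in> int_vecs" "\<zeta> \<in> Z1"
    "s = u + \<xi> v* tau_one \<tau>" "a = v + one_minus_tau \<tau> *v y" "b = w + dotc (up \<xi>) v + \<zeta> - dotc s (lo y)"
    using o(1) by (rule orb_eqE)
  obtain \<xi>' y' \<zeta>' where 2: "\<xi>' \<in> Z1_vecs" "y' \<in> int_vecs" "\<zeta>' \<in> Z1"
    "s = u + \<xi>' v* tau_one \<tau>" "a' = v' + one_minus_tau \<tau> *v y'" "b' = w' + dotc (up \<xi>') v' + \<zeta>' - dotc s (lo y')"
    using o(2) by (rule orb_eqE)
  have \<xi>: "\<xi>' = \<xi>" using tau_one_cancel[OF \<tau> 2(1) 1(2)] 1(5) 2(4) by simp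
  have "orb \<tau> u (v + v') (w + w') = orb \<tau> s (a + a') (b + b')"
  proof (rule orb_eqI[OF 1(2) _ _ 1(5)])
    show "y + y' \<in> int_vecs" "\<zeta> + \<zeta>' \<in> Z1" using 1(3,4) 2(2,3) by simp_all
    show "a + a' = v + v' + one_minus_tau \<tau> *v (y + y')"
      unfolding 1(6) 2(5) by (simp add: matrix_vector_right_distrib)
    show "b + b' = w + w' + dotc (up \<xi>) (v + v') + (\<zeta> + \<zeta>') - dotc s (lo (y + y'))"
      unfolding 1(7) 2(6) \<xi> by (simp add: dotc_add)
  qed
  then show "x = orb \<tau> u (v + v') (w + w')" using x 1(1) by simp
qed

text \<open>Replacing u by another representative shifts w by \<open>dotc (up \<xi>) v\<close>,
  which vanishes at v = 0.\<close>

lemma orb_zero_dual_cls: "orb_zero (\<tau>, dual_cls \<tau> u) = orb \<tau> u 0 0"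
  unfolding orb_zero_def
proof (rule some_equality)
  show "\<exists>s. snd (\<tau>, dual_cls \<tau> u) = dual_cls (fst (\<tau>, dual_cls \<tau> u)) s \<and> orb \<tau> u 0 0 = orb (fst (\<tau>, dual_cls \<tau> u)) s 0 0"
    by auto
  fix e assume "\<exists>s. snd (\<tau>, dual_cls \<tau> u) = dual_cls (fst (\<tau>, dual_cls \<tau> u)) s \<and> e = orb (fst (\<tau>, dual_cls \<tau> u)) s 0 0"
  then obtain s where s: "dual_cls \<tau> u = dual_cls \<tau> s" "e = orb \<tau> s 0 0" by auto
  then obtain \<xi> where "\<xi> \<in> Z1_vecs" "s = u + \<xi> v* tau_one \<tau>" unfolding dual_cls_eq_iff by blast
  then have "orb \<tau> u 0 0 = orb \<tau> s 0 0" by (intro orb_eqI[of \<xi> 0 0]) simp_all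
  then show "e = orb \<tau> u 0 0" using s(2) by simp
qed

lemma fibre_over_dual:
  assumes "e \<in> points Pu_quotient" "dual_of e = (\<tau>, dual_cls \<tau> u)"
  obtains v w where "e = orb \<tau> u v w"
proof -
  obtain \<tau>' u' v' w' where e: "e = orb \<tau>' u' v' w'" using assms(1) by (rule orb_cases)
  then have "orb_proj e = (\<tau>, av_cls \<tau> v', dual_cls \<tau> u)" using assms(2) by (auto simp: proj_orb)
  then show ?thesis using that fibre_rep[OF assms(1)] by blast
qed

section \<open>The group structure on the fibres over the dual family\<close>

definition ext_group :: "(complex ^ 'd ^ 'd) \<times> (complex ^ 'd) set \<Rightarrow>
    (int \<Rightarrow> (complex ^ ('d::finite) mix) set) set monoid" where
  "ext_group x = \<lparr>carrier = {e\<in>points Pu_quotient. dual_of e = x}, monoid.mult = orb_add, one = orb_zero x\<rparr>"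

lemma ext_group_simps:
  "carrier (ext_group x) = {e\<in>points Pu_quotient. dual_of e = x}"
  "e \<otimes>\<^bsub>ext_group x\<^esub> e' = orb_add e e'" "\<one>\<^bsub>ext_group x\<^esub> = orb_zero x"
  by (simp_all add: ext_group_def)

lemma ext_group_carrierE:
  assumes "e \<in> carrier (ext_group (\<tau>, dual_cls \<tau> u))"
  obtains v w where "e = orb \<tau> u v w"
  using assms fibre_over_dual[of e \<tau> u] unfolding ext_group_simps by blast

lemma orb_in_ext_group:
  "\<tau> \<in> siegel \<Longrightarrow> orb \<tau> u v w \<in> carrier (ext_group (\<tau>, dual_cls \<tau> u))"
  by (simp add: ext_group_simps)

lemma comm_group_ext_group:
  assumes \<tau>: "\<tau> \<in> siegel"
  shows "comm_group (ext_group (\<tau>, dual_cls \<tau> u))" (is "comm_group ?G")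
proof (rule comm_groupI)
  note simps = ext_group_simps(2,3) orb_add_orb[OF \<tau>] orb_zero_dual_cls
  show "x \<otimes>\<^bsub>?G\<^esub> y \<in> carrier ?G" if x: "x \<in> carrier ?G" and y: "y \<in> carrier ?G" for x y
  proof -
    obtain v w where "x = orb \<tau> u v w" using x by (rule ext_group_carrierE)
    moreover obtain v' w' where "y = orb \<tau> u v' w'" using y by (rule ext_group_carrierE)
    ultimately show ?thesis using orb_in_ext_group[OF \<tau>] by (simp only: simps)
  qed
  show "\<one>\<^bsub>?G\<^esub> \<in> carrier ?G" unfolding simps by (rule orb_in_ext_group[OF \<tau>])
  show "x \<otimes>\<^bsub>?G\<^esub> y \<otimes>\<^bsub>?G\<^esub> z = x \<otimes>\<^bsub>?G\<^esub> (y \<otimes>\<^bsub>?G\<^esub> z)"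
    if x: "x \<in> carrier ?G" and y: "y \<in> carrier ?G" and z: "z \<in> carrier ?G" for x y z
  proof -
    obtain v w where "x = orb \<tau> u v w" using x by (rule ext_group_carrierE)
    moreover obtain v' w' where "y = orb \<tau> u v' w'" using y by (rule ext_group_carrierE)
    moreover obtain v'' w'' where "z = orb \<tau> u v'' w''" using z by (rule ext_group_carrierE)
    ultimately show ?thesis by (simp only: simps add.assoc)
  qed
  show "x \<otimes>\<^bsub>?G\<^esub> y = y \<otimes>\<^bsub>?G\<^esub> x" if x: "x \<in> carrier ?G" and y: "y \<in> carrier ?G" for x y
  proof -
    obtain v w where "x = orb \<tau> u v w" using x by (rule ext_group_carrierE)
    moreover obtain v' w' where "y = orb \<tau> u v' w'" using y by (rule ext_group_carrierE)
    ultimately show ?thesis by (simp only: simps add.commute)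
  qed
  fix x assume "x \<in> carrier ?G"
  then obtain v w where x: "x = orb \<tau> u v w" by (rule ext_group_carrierE)
  show "\<one>\<^bsub>?G\<^esub> \<otimes>\<^bsub>?G\<^esub> x = x" unfolding x simps by simp
  show "\<exists>y\<in>carrier ?G. y \<otimes>\<^bsub>?G\<^esub> x = \<one>\<^bsub>?G\<^esub>"
    unfolding x simps
    by (rule bexI[OF _ orb_in_ext_group[OF \<tau>, of u "- v" "- w"]]) (simp add: orb_add_orb[OF \<tau>])
qed

lemma ext_group_inv:
  assumes \<tau>: "\<tau> \<in> siegel"
  shows "inv\<^bsub>ext_group (dual_of (orb \<tau> u v w))\<^esub> (orb \<tau> u v w) = orb \<tau> u (- v) (- w)"
  unfolding dual_of_orb
proof (rule group.inv_equality[OF comm_group.axioms(2)[OF comm_group_ext_group[OF \<tau>]]])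
  show "orb \<tau> u (- v) (- w) \<otimes>\<^bsub>ext_group (\<tau>, dual_cls \<tau> u)\<^esub> orb \<tau> u v w = \<one>\<^bsub>ext_group (\<tau>, dual_cls \<tau> u)\<^esub>"
    by (simp add: ext_group_simps orb_add_orb[OF \<tau>] orb_zero_dual_cls)
qed (rule orb_in_ext_group[OF \<tau>])+

lemma av_group_mult: "{a + b | a b. a \<in> av_cls \<tau> v \<and> b \<in> av_cls \<tau> v'} = av_cls \<tau> (v + v')"
proof (intro equalityI subsetI)
  fix x assume "x \<in> {a + b | a b. a \<in> av_cls \<tau> v \<and> b \<in> av_cls \<tau> v'}"
  then obtain y y' where y: "y \<in> int_vecs" "y' \<in> int_vecs"
    and x: "x = (v + one_minus_tau \<tau> *v y) + (v' + one_minus_tau \<tau> *v y')"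
    unfolding av_cls_def by blast
  have "x = (v + v') + one_minus_tau \<tau> *v (y + y')"
    unfolding x by (simp add: matrix_vector_right_distrib)
  moreover have "y + y' \<in> int_vecs" using y by simp
  ultimately show "x \<in> av_cls \<tau> (v + v')" unfolding av_cls_def by blast
next
  fix x assume "x \<in> av_cls \<tau> (v + v')"
  then obtain y where y: "y \<in> int_vecs" "x = (v + v') + one_minus_tau \<tau> *v y" unfolding av_cls_def by blast
  have "v + one_minus_tau \<tau> *v y \<in> av_cls \<tau> v" using y(1) unfolding av_cls_def by blast
  moreover have "v' + one_minus_tau \<tau> *v 0 \<in> av_cls \<tau> v'"
    using lattice_vecs_closed(4) unfolding av_cls_def by blast
  moreover have "x = (v + one_minus_tau \<tau> *v y) + (v' + one_minus_tau \<tau> *v 0)" unfolding y(2) by simp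
  ultimately show "x \<in> {a + b | a b. a \<in> av_cls \<tau> v \<and> b \<in> av_cls \<tau> v'}" by blast
qed

lemma scale_orb_zero: "orb_scale (exp a) (orb_zero (\<tau>, dual_cls \<tau> u)) = orb \<tau> u 0 a"
  unfolding orb_zero_dual_cls scale_orb by simp

lemma group_extension_ext_group:
  assumes \<tau>: "\<tau> \<in> siegel"
  shows "group_extension Cx_group (\<lambda>t. orb_scale t (orb_zero (\<tau>, dual_cls \<tau> u))) (ext_group (\<tau>, dual_cls \<tau> u))
    (\<lambda>e. fst (snd (orb_proj e))) (av_group \<tau>)" (is "group_extension _ ?\<iota> ?G ?\<pi> _")
  unfolding group_extension_def
proof (intro conjI)
  have \<iota>: "?\<iota> t = orb \<tau> u 0 (Ln t)" if "t \<noteq> 0" for t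
    using scale_orb_zero[of "Ln t"] that by simp
  have pi_orb: "?\<pi> (orb \<tau> u v w) = av_cls \<tau> v" for v w by (simp add: proj_orb)
  show "comm_group ?G" by (rule comm_group_ext_group[OF \<tau>])
  show "?\<iota> \<in> hom Cx_group ?G"
  proof (rule homI)
    fix s t assume st: "s \<in> carrier Cx_group" "t \<in> carrier Cx_group"
    then have ne: "s \<noteq> 0" "t \<noteq> 0" by (simp_all add: Cx_group_def)
    show "?\<iota> s \<in> carrier ?G" unfolding \<iota>[OF ne(1)] by (rule orb_in_ext_group[OF \<tau>])
    have "?\<iota> (exp (Ln s + Ln t)) = orb \<tau> u 0 (Ln s + Ln t)" by (rule scale_orb_zero)
    then show "?\<iota> (s \<otimes>\<^bsub>Cx_group\<^esub> t) = ?\<iota> s \<otimes>\<^bsub>?G\<^esub> ?\<iota> t"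
      unfolding \<iota>[OF ne(1)] \<iota>[OF ne(2)] ext_group_simps orb_add_orb[OF \<tau>]
      using ne by (simp add: Cx_group_def exp_add)
  qed
  show "inj_on ?\<iota> (carrier Cx_group)"
  proof (rule inj_onI)
    fix s t assume st: "s \<in> carrier Cx_group" "t \<in> carrier Cx_group" and eq: "?\<iota> s = ?\<iota> t"
    then have ne: "s \<noteq> 0" "t \<noteq> 0" by (simp_all add: Cx_group_def)
    have "exp (Ln s) = exp (Ln t)" using eq unfolding \<iota>[OF ne(1)] \<iota>[OF ne(2)] orb_w_eq[OF \<tau>] .
    then show "s = t" using ne by simp
  qed
  show "?\<pi> \<in> hom ?G (av_group \<tau>)"
  proof (rule homI)
    fix x y assume x: "x \<in> carrier ?G" and y: "y \<in> carrier ?G"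
    obtain v w where x: "x = orb \<tau> u v w" using x by (rule ext_group_carrierE)
    obtain v' w' where y: "y = orb \<tau> u v' w'" using y by (rule ext_group_carrierE)
    show "?\<pi> x \<in> carrier (av_group \<tau>)" unfolding x pi_orb by (simp add: av_group_def)
    show "?\<pi> (x \<otimes>\<^bsub>?G\<^esub> y) = ?\<pi> x \<otimes>\<^bsub>av_group \<tau>\<^esub> ?\<pi> y"
      unfolding x y ext_group_simps orb_add_orb[OF \<tau>] pi_orb by (simp add: av_group_def av_group_mult)
  qed
  show "?\<pi> ` carrier ?G = carrier (av_group \<tau>)"
  proof (intro equalityI subsetI)
    fix c assume "c \<in> ?\<pi> ` carrier ?G"
    then obtain x where x: "x \<in> carrier ?G" "c = ?\<pi> x" by blast
    obtain v w where "x = orb \<tau> u v w" using x(1) by (rule ext_group_carrierE)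
    then show "c \<in> carrier (av_group \<tau>)" using x(2) by (simp add: pi_orb av_group_def)
  next
    fix c assume "c \<in> carrier (av_group \<tau>)"
    then obtain v where "c = av_cls \<tau> v" by (auto simp: av_group_def)
    then have "c = ?\<pi> (orb \<tau> u v 0)" unfolding pi_orb .
    then show "c \<in> ?\<pi> ` carrier ?G" by (rule image_eqI) (rule orb_in_ext_group[OF \<tau>])
  qed
  show "kernel ?G (av_group \<tau>) ?\<pi> = ?\<iota> ` carrier Cx_group"
  proof (intro equalityI subsetI)
    fix x assume x: "x \<in> kernel ?G (av_group \<tau>) ?\<pi>"
    then have xG: "x \<in> carrier ?G" and "?\<pi> x = av_cls \<tau> 0" by (simp_all add: kernel_def av_group_def)
    obtain v w where "x = orb \<tau> u v w" using xG by (rule ext_group_carrierE)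
    then have "orb_proj x = (\<tau>, av_cls \<tau> 0, dual_cls \<tau> u)" using \<open>?\<pi> x = av_cls \<tau> 0\<close> by (simp add: proj_orb)
    \<comment> \<open>A kernel element has v in the lattice; moving its representative to v = 0 with
      u kept exhibits it as a multiple of zero by exp a.\<close>
    then obtain a where a: "x = orb \<tau> u 0 a" using fibre_rep[of x \<tau> 0 u] xG unfolding ext_group_simps by blast
    have "x = ?\<iota> (exp a)" unfolding a scale_orb_zero ..
    then show "x \<in> ?\<iota> ` carrier Cx_group" by (rule image_eqI) (simp add: Cx_group_def)
  next
    fix x assume "x \<in> ?\<iota> ` carrier Cx_group"
    then obtain t where t: "t \<noteq> 0" "x = ?\<iota> t" by (auto simp: Cx_group_def)
    have x: "x = orb \<tau> u 0 (Ln t)" using t(2) unfolding \<iota>[OF t(1)] .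
    show "x \<in> kernel ?G (av_group \<tau>) ?\<pi>"
      unfolding x kernel_def using orb_in_ext_group[OF \<tau>, of u 0 "Ln t"] by (simp add: pi_orb av_group_def)
  qed
qed

lemma scale_eq_add:
  assumes "\<tau> \<in> siegel" "e \<in> carrier (ext_group (\<tau>, dual_cls \<tau> u))" "t \<noteq> 0"
  shows "orb_scale t e = orb_add (orb_scale t (orb_zero (\<tau>, dual_cls \<tau> u))) e"
proof -
  obtain v w where e: "e = orb \<tau> u v w" using assms(2) by (rule ext_group_carrierE)
  show ?thesis
    unfolding e orb_zero_dual_cls scale_orb'[OF assms(3)] orb_add_orb[OF assms(1)] by (simp add: add.commute)
qed

lemma hol_map_orb_zero: "hol_map (dual_family :: (_, (complex ^ 'd ^ ('d::finite)) \<times> (complex ^ 'd)) cmfd) (points dual_family) Pu_quotient orb_zero"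
proof -
  have "hol_map (quot ((siegel :: (complex ^ 'd ^ ('d::finite)) set) \<times> UNIV) (\<lambda>(\<tau>, u). (\<tau>, dual_cls \<tau> u)))
      (points (quot ((siegel :: (complex ^ 'd ^ ('d::finite)) set) \<times> UNIV) (\<lambda>(\<tau>, u). (\<tau>, dual_cls \<tau> u)))) Pu_quotient orb_zero"
  proof (rule hol_map_lift_global[OF charts_from_quot charts_cover_Pu])
    show "holo_on (\<lambda>x. (fst x, snd x, 0, 0)) ((siegel :: (complex ^ 'd ^ ('d::finite)) set) \<times> UNIV)" by (intro holo_intros)
    fix x :: "(complex ^ 'd ^ 'd) \<times> (complex ^ 'd)" assume "x \<in> siegel \<times> UNIV"
    then show "(fst x, snd x, 0, 0) \<in> coord_domain \<and>
        orb_zero (case x of (\<tau>, u) \<Rightarrow> (\<tau>, dual_cls \<tau> u)) = heis_orbit (fst x, snd x, 0, 0)"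
      by (auto simp: orb_zero_dual_cls)
  qed
  then show ?thesis unfolding dual_family_def quotient_mfd_domain .
qed

lemma hol_map_inv: "hol_map Pu_quotient (points Pu_quotient) Pu_quotient (\<lambda>e. inv\<^bsub>ext_group (dual_of e)\<^esub> e)"
proof (rule hol_map_lift_global[OF charts_from_cover[OF charts_cover_Pu] charts_cover_Pu])
  let ?F = "\<lambda>s :: 'a coords. (fst s, fst (snd s), - fst (snd (snd s)), - snd (snd (snd s)))"
  show "holo_on ?F coord_domain" by (intro holo_intros)
  fix s :: "'a coords" assume s: "s \<in> coord_domain"
  obtain \<tau> u v w where "s = (\<tau>, u, v, w)" by (cases s)
  then show "?F s \<in> coord_domain \<and> inv\<^bsub>ext_group (dual_of (heis_orbit s))\<^esub> (heis_orbit s) = heis_orbit (?F s)"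
    using s ext_group_inv[of \<tau> u v w] by simp
qed

text \<open>Two points with the same image in the family \<open>A\<^sup>\<or>\<close> are represented by \<open>(\<tau>, u, v, w)\<close> and
  \<open>(\<tau>, u + \<xi>(\<tau>; 1), v', w')\<close>, where \<open>\<xi>\<close> is locally constant.\<close>

lemma hol_map_orb_add:
  "hol_map (prod_mfd Pu_quotient Pu_quotient)
     {(e, e'). e \<in> points Pu_quotient \<and> e' \<in> points Pu_quotient \<and> dual_of e = dual_of e'} Pu_quotient
     (\<lambda>(e, e'). orb_add e e')"
proof (rule hol_map_lift[OF charts_from_prod[OF charts_from_cover[OF charts_cover_Pu]
      charts_from_cover[OF charts_cover_Pu]] charts_cover_Pu])
  let ?Z = "{(e, e'). e \<in> points (Pu_quotient :: (_, 'a coords) cmfd) \<and> e' \<in> points Pu_quotient \<and> dual_of e = dual_of e'}"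
  let ?S = "(coord_domain :: 'a coords set) \<times> (coord_domain :: 'a coords set)" and ?q = "map_prod heis_orbit heis_orbit"
  let ?K = "\<lambda>x :: 'a coords \<times> 'a coords. dual_coord (fst (fst x)) (fst (snd (snd x)) - fst (snd (fst x)))"
  show "?Z \<subseteq> ?q ` ?S"
    unfolding charts_from_points[OF charts_from_cover[OF charts_cover_Pu]] by force
  have rel: "\<exists>\<xi>\<in>Z1_vecs. fst (snd x) = fst (fst x) \<and> ?K x = \<xi> \<and> fst (fst x) \<in> siegel \<and>
      fst (snd (snd x)) = fst (snd (fst x)) + \<xi> v* tau_one (fst (fst x))"
    if x: "x \<in> ?S" "?q x \<in> ?Z" for x
  proof -
    obtain \<tau> u v w \<tau>' u' v' w' where x_eq: "x = ((\<tau>, u, v, w), (\<tau>', u', v', w'))"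
      by (cases x) auto
    have \<tau>: "\<tau> \<in> siegel" using x(1) by (simp add: x_eq)
    have "\<tau>' = \<tau>" "dual_cls \<tau> u = dual_cls \<tau> u'" using x(2) by (auto simp: x_eq)
    then obtain \<xi> where "\<xi> \<in> Z1_vecs" "u' = u + \<xi> v* tau_one \<tau>" unfolding dual_cls_eq_iff by blast
    then show ?thesis
      using dual_coord_inverse[OF \<tau>, of \<xi>] \<open>\<tau>' = \<tau>\<close> \<tau> by (intro bexI[of _ \<xi>]) (simp_all add: x_eq)
  qed
  fix s assume s: "s \<in> ?S" "?q s \<in> ?Z"
  have cont: "continuous_on ?S ?K"
    by (intro continuous_on_dual_coord continuous_intros) (auto simp: coord_domain_alt)
  have "openin (top_of_set ?S) (?S \<inter> ?K -` ball (?K s) 1)"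
    by (rule continuous_openin_preimage_gen[OF cont open_ball])
  then obtain N where N: "open N" "?S \<inter> ?K -` ball (?K s) 1 = ?S \<inter> N" unfolding openin_open by blast
  have "s \<in> ?S \<inter> ?K -` ball (?K s) 1" using s(1) by simp
  then have sN: "s \<in> N" unfolding N(2) by (rule IntD2)
  \<comment> \<open>\<open>dual_coord\<close> is built from real and imaginary parts and need not be
    holomorphic, so \<xi> is frozen at its value for s. On points of \<open>N\<close> lying over
    \<open>?Z\<close> it is the correct vector, since lattice vectors less than 1 apart agree.
    Subtracting \<open>dotc (up \<xi>) v'\<close> brings the second summand back to the coordinate u
    of the first.\<close>
  let ?F = "\<lambda>x. (fst (fst x), fst (snd (fst x)), fst (snd (snd (fst x))) + fst (snd (snd (snd x))),
      snd (snd (snd (fst x))) + (snd (snd (snd (snd x))) - dotc (up (?K s)) (fst (snd (snd (snd x))))))"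
  have hol: "holo_on ?F (N \<inter> {x\<in>?S. ?q x \<in> ?Z})" by (intro holo_intros)
  have F: "?F x \<in> coord_domain \<and> (case ?q x of (e, e') \<Rightarrow> orb_add e e') = heis_orbit (?F x)"
    if x: "x \<in> N \<inter> {x\<in>?S. ?q x \<in> ?Z}" for x
  proof -
    have "x \<in> ?S \<and> ?q x \<in> ?Z" using IntD2[OF x] by (rule CollectD)
    then have xS: "x \<in> ?S" "?q x \<in> ?Z" by (rule conjunct1, rule conjunct2)
    have "x \<in> ?S \<inter> N" using xS(1) IntD1[OF x] by (rule IntI)
    then have d: "dist (?K s) (?K x) < 1" unfolding N(2)[symmetric] by simp
    obtain \<tau> u v w \<tau>' u' v' w' where x_eq: "x = ((\<tau>, u, v, w), (\<tau>', u', v', w'))"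
      by (cases x) auto
    have "?K s \<in> Z1_vecs" using rel[OF s] by blast
    moreover obtain \<xi> where "fst (snd x) = fst (fst x)" "fst (fst x) \<in> siegel"
      "fst (snd (snd x)) = fst (snd (fst x)) + \<xi> v* tau_one (fst (fst x))"
      and K\<xi>: "\<xi> \<in> Z1_vecs" "?K x = \<xi>"
      using rel[OF xS] by blast
    then have \<xi>: "\<xi> \<in> Z1_vecs" "\<tau>' = \<tau>" "?K x = \<xi>" "\<tau> \<in> siegel" "u' = u + \<xi> v* tau_one \<tau>"
      by (simp_all add: x_eq)
    ultimately have K: "?K s = \<xi>" using d by (intro Z1_vecs_discrete) simp_all
    have "orb \<tau> u v' (w' - dotc (up \<xi>) v') = orb \<tau> u' v' w'"
      using \<xi> by (intro orb_eqI[of \<xi> 0 0]) simp_all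
    then have "orb_add (orb \<tau> u v w) (orb \<tau>' u' v' w') = orb \<tau> u (v + v') (w + (w' - dotc (up \<xi>) v'))"
      using orb_add_orb[OF \<xi>(4), of u v w v' "w' - dotc (up \<xi>) v'"] \<xi>(2) by simp
    then show ?thesis unfolding K using \<xi>(4) by (simp add: x_eq)
  qed
  show "\<exists>N F. open N \<and> s \<in> N \<and> holo_on F (N \<inter> {x\<in>?S. ?q x \<in> ?Z}) \<and>
      (\<forall>x\<in>N \<inter> {x\<in>?S. ?q x \<in> ?Z}. F x \<in> coord_domain \<and> (case ?q x of (e, e') \<Rightarrow> orb_add e e') = heis_orbit (F x))"
    by (rule exI[of _ N], rule exI[of _ ?F], intro conjI N(1) sN hol ballI[OF F])
qed

text \<open>The coordinate \<open>w = av\<close> (with the first half of \<open>a\<close>) makes the translate of \<open>(\<tau>, a(\<tau>; 1), v, w)\<close> by a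
  lattice vector \<open>(1 -\<tau>)y\<close> differ from it by \<open>ay\<close>.\<close>

definition pushout_section :: "complex ^ 'd ^ ('d::finite) \<Rightarrow> complex ^ ('d + 'd) \<Rightarrow> complex ^ 'd \<Rightarrow>
    (int \<Rightarrow> (complex ^ 'd mix) set) set" where
  "pushout_section \<tau> a v = orb \<tau> (a v* tau_one \<tau>) v (dotc (up a) v)"

lemma hol_map_pushout_section:
  assumes "\<tau> \<in> siegel"
  shows "hol_map (domain_mfd UNIV) UNIV Pu_quotient (pushout_section \<tau> a)"
proof -
  have "hol_map (domain_mfd UNIV) (points (domain_mfd UNIV)) Pu_quotient (pushout_section \<tau> a)"
  proof (rule hol_map_lift_global[OF charts_from_domain charts_cover_Pu])
    show "holo_on (\<lambda>v. (\<tau>, a v* tau_one \<tau>, v, dotc (up a) v)) UNIV" by (intro holo_intros)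
    show "(\<tau>, a v* tau_one \<tau>, v, dotc (up a) v) \<in> coord_domain \<and>
        pushout_section \<tau> a v = heis_orbit (\<tau>, a v* tau_one \<tau>, v, dotc (up a) v)" for v
      using assms by (simp add: pushout_section_def)
  qed
  then show ?thesis by (simp add: domain_mfd_def)
qed

lemma pushout_section_translate:
  assumes y: "y \<in> int_vecs"
  shows "pushout_section \<tau> a (v + one_minus_tau \<tau> *v y) = orb_scale (exp (dotc a y)) (pushout_section \<tau> a v)"
proof -
  let ?u = "a v* tau_one \<tau>"
  have "orb \<tau> ?u v (dotc (up a) v + dotc a y) =
      orb \<tau> ?u (v + one_minus_tau \<tau> *v y) (dotc (up a) (v + one_minus_tau \<tau> *v y))"
    using y by (intro orb_eqI[of 0 y 0]) (simp_all add: dotc_add dotc_one_minus_tau)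
  then show ?thesis by (simp add: pushout_section_def scale_orb)
qed

lemma proj_pushout_section: "orb_proj (pushout_section \<tau> a v) = (\<tau>, av_cls \<tau> v, dual_cls \<tau> (a v* tau_one \<tau>))"
  by (simp add: pushout_section_def proj_orb)

text \<open>The zero section of the extension trivialises the torsor along {0} times the dual
  variety, and \<open>pushout_section\<close> has the factor of automorphy of the class a.\<close>

lemma poincare_torsor_Pu_quotient:
  assumes \<tau>: "\<tau> \<in> siegel"
  shows "poincare_torsor \<tau> Pu_quotient orb_proj orb_scale"
  unfolding poincare_torsor_def
proof (rule conjI)
  have "hol_map (quot UNIV (dual_cls \<tau>)) (points (quot UNIV (dual_cls \<tau>))) Pu_quotient (\<lambda>b. orb_zero (\<tau>, b))"
  proof (rule hol_map_lift_global[OF charts_from_quot charts_cover_Pu])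
    show "holo_on (\<lambda>u. (\<tau>, u, 0, 0)) UNIV" by (intro holo_intros)
    show "(\<tau>, u, 0, 0) \<in> coord_domain \<and> orb_zero (\<tau>, dual_cls \<tau> u) = heis_orbit (\<tau>, u, 0, 0)" for u
      using \<tau> by (simp add: orb_zero_dual_cls)
  qed
  moreover have "orb_proj (orb_zero (\<tau>, b)) = (\<tau>, av_cls \<tau> 0, b)" if "b \<in> points (quot UNIV (dual_cls \<tau>))" for b
    using that by (auto simp: quot_def orb_zero_dual_cls proj_orb)
  ultimately show "\<exists>\<epsilon>. hol_map (dual_mfd \<tau>) (points (dual_mfd \<tau>)) Pu_quotient \<epsilon> \<and>
      (\<forall>b\<in>points (dual_mfd \<tau>). orb_proj (\<epsilon> b) = (\<tau>, av_cls \<tau> 0, b))"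
    unfolding dual_mfd_def quotient_mfd_domain by (intro exI[of _ "\<lambda>b. orb_zero (\<tau>, b)"] conjI ballI)
  show "\<forall>a. \<exists>\<sigma>. hol_map (domain_mfd UNIV) UNIV Pu_quotient \<sigma> \<and>
      (\<forall>v. orb_proj (\<sigma> v) = (\<tau>, av_cls \<tau> v, dual_cls \<tau> (a v* tau_one \<tau>))) \<and>
      (\<forall>v. \<forall>y\<in>int_vecs. \<sigma> (v + one_minus_tau \<tau> *v y) = orb_scale (exp (dotc a y)) (\<sigma> v))"
    using hol_map_pushout_section[OF \<tau>] pushout_section_translate proj_pushout_section
    by (intro allI exI[of _ "pushout_section \<tau> a" for a] conjI ballI) blast+
qed

lemma universal_extension_Pu_quotient:
  "universal_extension (Pu_quotient :: (_, ('d::finite) coords) cmfd) orb_proj orb_scale"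
  unfolding universal_extension_def Let_def
proof (rule exI[of _ orb_add], rule exI[of _ orb_zero],
    unfold dual_of_def[symmetric] ext_group_def[symmetric], intro conjI hol_map_orb_add hol_map_orb_zero hol_map_inv)
  show "\<forall>(\<tau>, b)\<in>points (dual_family :: (_, (complex ^ 'd ^ 'd) \<times> (complex ^ 'd)) cmfd).
      group_extension Cx_group (\<lambda>t. orb_scale t (orb_zero (\<tau>, b))) (ext_group (\<tau>, b)) (\<lambda>e. fst (snd (orb_proj e)))
        (av_group \<tau>) \<and>
      (\<forall>e\<in>carrier (ext_group (\<tau>, b)). \<forall>t. t \<noteq> 0 \<longrightarrow> orb_scale t e = orb_add (orb_scale t (orb_zero (\<tau>, b))) e)"
  proof (rule ballI)
    fix x assume "x \<in> points (dual_family :: (_, (complex ^ 'd ^ 'd) \<times> (complex ^ 'd)) cmfd)"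
    then obtain \<tau> u where x: "\<tau> \<in> siegel" "x = (\<tau>, dual_cls \<tau> u)"
      by (auto simp: dual_family_def quotient_mfd_domain quot_def)
    show "case x of (\<tau>, b) \<Rightarrow>
      group_extension Cx_group (\<lambda>t. orb_scale t (orb_zero (\<tau>, b))) (ext_group (\<tau>, b)) (\<lambda>e. fst (snd (orb_proj e)))
        (av_group \<tau>) \<and>
      (\<forall>e\<in>carrier (ext_group (\<tau>, b)). \<forall>t. t \<noteq> 0 \<longrightarrow> orb_scale t e = orb_add (orb_scale t (orb_zero (\<tau>, b))) e)"
      unfolding x(2) prod.case
      by (intro conjI ballI allI impI group_extension_ext_group scale_eq_add x(1))
  qed
  show "\<forall>\<tau>\<in>siegel. \<forall>a :: complex ^ ('d + 'd). \<exists>\<psi>. hol_map (domain_mfd UNIV) UNIV Pu_quotient \<psi> \<and>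
      (\<forall>v. orb_proj (\<psi> v) = (\<tau>, av_cls \<tau> v, dual_cls \<tau> (a v* tau_one \<tau>))) \<and>
      (\<forall>v v'. \<psi> (v + v') = orb_add (\<psi> v) (\<psi> v')) \<and>
      (\<forall>y\<in>int_vecs. \<psi> (one_minus_tau \<tau> *v y) =
        orb_scale (exp (dotc a y)) (orb_zero (\<tau>, dual_cls \<tau> (a v* tau_one \<tau>))))"
  proof (intro ballI allI)
    fix \<tau> :: "complex ^ 'd ^ 'd" and a :: "complex ^ ('d + 'd)" assume \<tau>: "\<tau> \<in> siegel"
    have "pushout_section \<tau> a (v + v') = orb_add (pushout_section \<tau> a v) (pushout_section \<tau> a v')" for v v'
      by (simp add: pushout_section_def orb_add_orb[OF \<tau>] dotc_add)
    moreover have "pushout_section \<tau> a (one_minus_tau \<tau> *v y) =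
        orb_scale (exp (dotc a y)) (orb_zero (\<tau>, dual_cls \<tau> (a v* tau_one \<tau>)))" if "y \<in> int_vecs" for y
      using pushout_section_translate[OF that, of \<tau> a 0] by (simp add: pushout_section_def orb_zero_dual_cls)
    ultimately show "\<exists>\<psi>. hol_map (domain_mfd UNIV) UNIV Pu_quotient \<psi> \<and>
      (\<forall>v. orb_proj (\<psi> v) = (\<tau>, av_cls \<tau> v, dual_cls \<tau> (a v* tau_one \<tau>))) \<and>
      (\<forall>v v'. \<psi> (v + v') = orb_add (\<psi> v) (\<psi> v')) \<and>
      (\<forall>y\<in>int_vecs. \<psi> (one_minus_tau \<tau> *v y) =
        orb_scale (exp (dotc a y)) (orb_zero (\<tau>, dual_cls \<tau> (a v* tau_one \<tau>))))"
      using hol_map_pushout_section[OF \<tau>] proj_pushout_section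
      by (intro exI[of _ "pushout_section \<tau> a"] conjI allI ballI)
  qed
qed

theorem proposition4p6:
  shows "\<exists>(p :: (int \<Rightarrow> (complex ^ ('d::finite) mix) set) set \<Rightarrow> 'd AAdual) act.
    universal_poincare_torsor Pu_quotient p act \<and>
    (\<forall>(\<tau>, u, v, w)\<in>coord_domain.
       p (Pu_orbit (hodge_fil (\<tau>, u, v, w))) = (\<tau>, av_cls \<tau> v, dual_cls \<tau> u) \<and>
       (\<forall>s. act (exp s) (Pu_orbit (hodge_fil (\<tau>, u, v, w))) = Pu_orbit (hodge_fil (\<tau>, u, v, w + s))))"
proof (rule exI[of _ orb_proj], rule exI[of _ orb_scale], rule conjI)
  show "universal_poincare_torsor (Pu_quotient :: (_, 'd coords) cmfd) orb_proj orb_scale"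
    unfolding universal_poincare_torsor_def
    by (intro conjI ballI Cx_torsor_Pu_quotient poincare_torsor_Pu_quotient universal_extension_Pu_quotient)
  have "Pu_orbit (hodge_fil (\<tau>, u, v, w)) = orb \<tau> u v w" for \<tau> :: "complex ^ 'd ^ 'd" and u v w
    by (simp add: heis_orbit_def)
  then show "\<forall>(\<tau>, u, v, w)\<in>(coord_domain :: 'd coords set).
       orb_proj (Pu_orbit (hodge_fil (\<tau>, u, v, w))) = (\<tau>, av_cls \<tau> v, dual_cls \<tau> u) \<and>
       (\<forall>s. orb_scale (exp s) (Pu_orbit (hodge_fil (\<tau>, u, v, w))) = Pu_orbit (hodge_fil (\<tau>, u, v, w + s)))"
    by (auto simp: proj_orb scale_orb)
qed

end
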